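(* Let $\lambda$ be an $r$-partition of $n$, $\mu\in\mathbb{Z}_{\ge 0}^n$, and let $T$ be a standard Young tableau on $\lambda$. (a) For $1\le i\le n$ the actions of $t_{\zeta_i}$ and $z_i$ on $M(\lambda)$ are given by $$t_{\zeta_i}.x^\mu v_T^\mu=\zeta^{\beta(T(w_\mu(i)))-\mu_i}\,x^\mu v_T^\mu$$ and $$z_i.x^\mu v_T^\mu=\Big(\kappa(\mu_i+1)-\big(d_{\beta(T(w_\mu(i)))}-d_{\beta(T(w_\mu(i)))-\mu_i-1}\big)-c_0\,r\,\mathrm{ct}(T(w_\mu(i)))\Big)x^\mu v_T^\mu+\sum_{(\nu,S)<(\mu,T)}c_{\nu,S}\,x^\nu v_S^\nu$$ for some coefficients $c_{\nu,S}\in F$. (b) Assume that the parameters are generic, so that $F=\mathbb{C}(\kappa,c_0,d_1,\dots,d_{r-1})$. Then for each $\mu\in\mathbb{Z}_{\ge0}^n$ and $T\in\mathrm{SYT}(\lambda)$ there exists a unique $\mathfrak{t}$-eigenvector $f_{\mu,T}\in M(\lambda)$ such that $$f_{\mu,T}=x^\mu v_T^\mu+\text{lower terms},$$ where "lower terms" means an $F$-linear combination of elements $x^\nu v_S^\nu$ with $(\nu,S)<(\mu,T)$. The $\mathfrak{t}$-eigenvalue of $f_{\mu,T}$ is determined by the formulas in part (a): $t_{\zeta_i}$ acts on $f_{\mu,T}$ by $\zeta^{\beta(T(w_\mu(i)))-\mu_i}$ and $z_i$ acts by the coefficient of $x^\mu v_T^\mu$ in the formula for $z_i.x^\mu v_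T^\mu$.
   Context: **Group and tableaux.** Let $r,n\ge 1$, $\zeta=e^{2\pi i/r}$, and let $W=G(r,1,n)$ be the group of $n\times n$ monomial matrices whose nonzero entries are $r$th roots of $1$. $\zeta_i\in W$ is the diagonal matrix with $\zeta$ in position $i$ and $1$'s elsewhere; $s_{ij}$ is the transposition interchanging $i$ and $j$; $s_i=s_{i,i+1}$; $t_w$ is the group-algebra element of $w\in W$. An $r$-partition $\lambda=(\lambda^0,\dots,\lambda^{r-1})$ of $n$ is a sequence of $r$ (possibly empty) partitions with $n$ boxes in total. For a box $b$ of $\lambda^l$ in row $p$ and column $q$ put $\mathrm{ct}(b)=q-p$ and $\beta(b)=l$. A standard Young tableau on $\lambda$ is a bijection $T$ from $\{1,\dots,n\}$ to the boxes of $\lambda$ ($T(i)$ is the box containing $i$) such that within each $\lambda^l$ entries strictly increase left to right and top to bottom; $\mathrm{SYT}(\lambda)$ is the set of these. $s_i.T$ is obtained from $T$ by interchanging $i$ and $i+1$. $S^\lambda$ is the irreducible $\mathbb{C}W$-module with basis $v_T$, $T\in\mathrm{SYT}(\lambda)$, on which $t_{\zeta_i}v_T=\zeta^{\beta(T(i))}v_T$; $t_{s_i}v_T=v_{s_i.T}$ if $\beta(T(i))\ne\beta(T(i+1))$; and if $\beta(T(i))=\beta(T(i+1))$ then with $a=\mathrm{ct}(T(i+1))-\mathrm{ct}(T(i))$, $t_{s_i}v_T=\frac1a v_T+(1-\frac1{a^2})^{1/2}v_{s_i.T}$ (second term read as $0$ if $s_i.T$ is not standard). **Compositions.** $S_n$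 acts on $\mathbb{Z}_{\ge0}^n$ by $(w.\mu)_i=\mu_{w^{-1}(i)}$. $\mu^+$ (resp. $\mu^-$) is the non-increasing (resp. non-decreasing) rearrangement of $\mu$; $w_\mu$ is the longest $w\in S_n$ with $w.\mu=\mu^-$, i.e. $w_\mu(i)=|\{j<i:\mu_j<\mu_i\}|+|\{j\ge i:\mu_j\le\mu_i\}|$. $\epsilon_i$ is the $i$th standard basis vector. Define $\mu<\nu$ iff $\mu^+<_d\nu^+$, or $\mu^+=\nu^+$ and $w_\mu<w_\nu$ in Bruhat order on $S_n$; here $\mu>_d\nu$ (strict dominance) means $\mu\neq\nu$ and $\mu-\nu=\sum_{i=1}^{n-1}k_i(\epsilon_i-\epsilon_{i+1})$ with integers $k_i\ge 0$. On $\mathbb{Z}_{\ge0}^n\times\mathrm{SYT}(\lambda)$ define $(\mu,T)<(\nu,S)$ iff $\mu<\nu$. Put $v_T^\mu=t_{w_\mu}^{-1}.v_T$. **Algebra.** Let $F\supseteq\mathbb{C}$ be a field and $\kappa,c_0,d_1,\dots,d_{r-1}\in F$; define $d_i$ for all $i\in\mathbb{Z}$ by $d_0+\cdots+d_{r-1}=0$ and $d_i=d_j$ if $i=j$ mod $r$. Let $y_1,\dots,y_n$ be the standard basis of $\mathfrak{h}=\mathbb{C}^n$ and $x_1,\dots,x_n$ the dual basis of $\mathfrak{h}^*$. The rational Cherednik algebra $\mathbb{H}$ is the $F$-algebra generated by $F[x_1,\dots,x_n]$, $F[y_1,\dots,y_n]$ and $FW$ with relations $t_wx=(wx)t_w$,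 $t_wy=(wy)t_w$ ($w\in W,x\in\mathfrak{h}^*,y\in\mathfrak{h}$), $$y_ix_j=x_jy_i+c_0\sum_{l=0}^{r-1}\zeta^{-l}t_{\zeta_i^ls_{ij}\zeta_i^{-l}}\ (i\ne j),$$ $$y_ix_i=x_iy_i+\kappa-\sum_{j=0}^{r-1}(d_j-d_{j-1})e_{ij}-c_0\sum_{j\ne i}\sum_{l=0}^{r-1}t_{\zeta_i^ls_{ij}\zeta_i^{-l}},$$ where $e_{ij}=\frac1r\sum_{l=0}^{r-1}\zeta^{-lj}t_{\zeta_i^l}$. Put $z_i=y_ix_i+c_0\phi_i$ with $\phi_i=\sum_{1\le j<i}\sum_{l=0}^{r-1}t_{\zeta_i^ls_{ij}\zeta_i^{-l}}$. $\mathfrak{t}\subseteq\mathbb{H}$ is the commutative subalgebra generated by $z_1,\dots,z_n,t_{\zeta_1},\dots,t_{\zeta_n}$. The standard module is $M(\lambda)=\mathrm{Ind}_{FW\otimes F[y_1,\dots,y_n]}^{\mathbb{H}}S^\lambda$ (scalars of $S^\lambda$ extended to $F$, each $y_i$ acting on $S^\lambda$ by $0$); as a vector space $M(\lambda)\simeq F[x_1,\dots,x_n]\otimes_FS^\lambda$, and the elements $x^\mu v_T^\mu$ form a basis. *)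

theory Defs
  imports Complex_Main "HOL-Library.Poly_Mapping" "HOL-Library.FuncSet"
    "HOL-Combinatorics.Permutations" "HOL-Algebra.Algebra" "Jordan_Normal_Form.Matrix"
begin

text \<open>All indices of the mathematics (matrix rows, coordinates of compositions, entries of tableaux,
  simple reflections) run from 1 to \<open>n\<close>; only the accessor \<open>$$\<close> of matrices is 0-based.\<close>

section \<open>The group $G(r,1,n)$\<close>

definition zeta :: "nat \<Rightarrow> complex" where
  "zeta r = cis (2 * pi / real r)"

definition G_r1n :: "nat \<Rightarrow> nat \<Rightarrow> complex mat monoid" where
  "G_r1n r n = \<lparr>carrier = {A \<in> carrier_mat n n.
       (\<forall>i<n. \<exists>!j. j < n \<and> A $$ (i, j) \<noteq> 0) \<and>
       (\<forall>j<n. \<exists>!i. i < n \<and> A $$ (i, j) \<noteq> 0) \<and>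
       (\<forall>i<n. \<forall>j<n. A $$ (i, j) \<noteq> 0 \<longrightarrow> A $$ (i, j) ^ r = 1)},
     monoid.mult = (*), monoid.one = 1\<^sub>m n\<rparr>"

definition zeta_mat :: "nat \<Rightarrow> nat \<Rightarrow> nat \<Rightarrow> complex mat" where
  "zeta_mat r n i = mat n n (\<lambda>(a, b). if a = b then (if a + 1 = i then zeta r else 1) else 0)"

definition perm_mat :: "nat \<Rightarrow> (nat \<Rightarrow> nat) \<Rightarrow> complex mat" where
  "perm_mat n w = mat n n (\<lambda>(a, b). if w (b + 1) = a + 1 then 1 else 0)"

definition s_mat :: "nat \<Rightarrow> nat \<Rightarrow> nat \<Rightarrow> complex mat" where
  "s_mat n i j = perm_mat n (transpose i j)"

text \<open>The reflection $\zeta_i^l s_{ij} \zeta_i^{-l}$.\<close>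
definition refl_mat :: "nat \<Rightarrow> nat \<Rightarrow> nat \<Rightarrow> nat \<Rightarrow> nat \<Rightarrow> complex mat" where
  "refl_mat r n i j l = (zeta_mat r n i [^]\<^bsub>G_r1n r n\<^esub> l) \<otimes>\<^bsub>G_r1n r n\<^esub> s_mat n i j
     \<otimes>\<^bsub>G_r1n r n\<^esub> (inv\<^bsub>G_r1n r n\<^esub> (zeta_mat r n i [^]\<^bsub>G_r1n r n\<^esub> l))"

section \<open>$r$-partitions and standard Young tableaux\<close>

definition is_partition :: "nat list \<Rightarrow> bool" where
  "is_partition p \<longleftrightarrow> sorted_wrt (\<ge>) p \<and> 0 \<notin> set p"

definition is_multipartition :: "nat \<Rightarrow> nat \<Rightarrow> nat list list \<Rightarrow> bool" where
  "is_multipartition r n lam \<longleftrightarrow> length lam = r \<and> (\<forall>p \<in> set lam. is_partition p)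
     \<and> sum_list (map sum_list lam) = n"

text \<open>A box is a triple (component, row, column).\<close>
type_synonym box = "nat \<times> nat \<times> nat"
type_synonym tableau = "nat \<Rightarrow> box"

fun beta :: "box \<Rightarrow> nat" where "beta (l, p, q) = l"
fun row :: "box \<Rightarrow> nat" where "row (l, p, q) = p"
fun column :: "box \<Rightarrow> nat" where "column (l, p, q) = q"

definition ct :: "box \<Rightarrow> int" where
  "ct b = int (column b) - int (row b)"

definition boxes :: "nat list list \<Rightarrow> box set" where
  "boxes lam = {(l, p, q). l < length lam \<and> 1 \<le> p \<and> p \<le> length (lam ! l)
     \<and> 1 \<le> q \<and> q \<le> lam ! l ! (p - 1)}"

text \<open>Tableaux are extensional (\<open>undefined\<close> off \<open>{1..n}\<close>), so that equality of functions
  is equality of tableaux.\<close>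
definition SYT :: "nat \<Rightarrow> nat list list \<Rightarrow> tableau set" where
  "SYT n lam = {T \<in> extensional {1..n}. bij_betw T {1..n} (boxes lam) \<and>
     (\<forall>i \<in> {1..n}. \<forall>j \<in> {1..n}. beta (T i) = beta (T j) \<and> row (T i) = row (T j)
        \<and> column (T i) < column (T j) \<longrightarrow> i < j) \<and>
     (\<forall>i \<in> {1..n}. \<forall>j \<in> {1..n}. beta (T i) = beta (T j) \<and> column (T i) = column (T j)
        \<and> row (T i) < row (T j) \<longrightarrow> i < j)}"

definition swap_entries :: "nat \<Rightarrow> tableau \<Rightarrow> tableau" where
  "swap_entries i T = T \<circ> transpose i (i + 1)"

section \<open>The module $S^\lambda$\<close>

text \<open>\<open>rho w S T\<close> is the coefficient of $v_S$ in $t_w v_T$. A term $v_{s_i.T}$ with $s_i.T$ not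
  standard contributes nothing because only rows \<open>S \<in> SYT n lam\<close> are considered.\<close>
definition is_S_lambda ::
  "nat \<Rightarrow> nat \<Rightarrow> nat list list \<Rightarrow> (complex mat \<Rightarrow> tableau \<Rightarrow> tableau \<Rightarrow> complex) \<Rightarrow> bool" where
  "is_S_lambda r n lam rho \<longleftrightarrow>
     (\<forall>S \<in> SYT n lam. \<forall>T \<in> SYT n lam. rho (1\<^sub>m n) S T = (if S = T then 1 else 0)) \<and>
     (\<forall>u \<in> carrier (G_r1n r n). \<forall>w \<in> carrier (G_r1n r n). \<forall>S \<in> SYT n lam. \<forall>T \<in> SYT n lam.
        rho (u * w) S T = (\<Sum>R \<in> SYT n lam. rho u S R * rho w R T)) \<and>
     (\<forall>i \<in> {1..n}. \<forall>S \<in> SYT n lam. \<forall>T \<in> SYT n lam.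
        rho (zeta_mat r n i) S T = (if S = T then zeta r ^ beta (T i) else 0)) \<and>
     (\<forall>i \<in> {1..<n}. \<forall>S \<in> SYT n lam. \<forall>T \<in> SYT n lam.
        rho (s_mat n i (i + 1)) S T =
          (if beta (T i) \<noteq> beta (T (i + 1)) then (if S = swap_entries i T then 1 else 0)
           else let a = real_of_int (ct (T (i + 1)) - ct (T i)) in
             (if S = T then complex_of_real (1 / a) else 0) +
             (if S = swap_entries i T then complex_of_real (sqrt (1 - 1 / a\<^sup>2)) else 0)))"

text \<open>Extension of scalars of $S^\lambda$ along \<open>emb :: complex \<Rightarrow> 'f\<close>:
  the basis vector $v_T$ is \<open>Poly_Mapping.single T 1\<close>.\<close>
definition S_space :: "nat \<Rightarrow> nat list list \<Rightarrow> (tableau \<Rightarrow>\<^sub>0 'f::field) set" where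
  "S_space n lam = {v. Poly_Mapping.keys v \<subseteq> SYT n lam}"

definition S_act :: "(complex \<Rightarrow> 'f::field) \<Rightarrow> nat \<Rightarrow> nat list list \<Rightarrow>
    (complex mat \<Rightarrow> tableau \<Rightarrow> tableau \<Rightarrow> complex) \<Rightarrow> complex mat \<Rightarrow>
    (tableau \<Rightarrow>\<^sub>0 'f) \<Rightarrow> (tableau \<Rightarrow>\<^sub>0 'f)" where
  "S_act emb n lam rho w v = (\<Sum>S \<in> SYT n lam. \<Sum>T \<in> SYT n lam.
     Poly_Mapping.single S (emb (rho w S T) * Poly_Mapping.lookup v T))"

section \<open>Compositions and their partial order\<close>

definition compositions :: "nat \<Rightarrow> (nat \<Rightarrow> nat) set" where
  "compositions n = {mu. \<forall>i. i \<notin> {1..n} \<longrightarrow> mu i = 0}"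

definition comp_plus :: "nat \<Rightarrow> (nat \<Rightarrow> nat) \<Rightarrow> (nat \<Rightarrow> nat)" where
  "comp_plus n mu = (\<lambda>i. if i \<in> {1..n} then rev (sort (map mu [1..<n + 1])) ! (i - 1) else 0)"

definition w_comp :: "nat \<Rightarrow> (nat \<Rightarrow> nat) \<Rightarrow> (nat \<Rightarrow> nat)" where
  "w_comp n mu = (\<lambda>i. if i \<in> {1..n}
     then card {j \<in> {1..<i}. mu j < mu i} + card {j \<in> {i..n}. mu j \<le> mu i} else i)"

text \<open>\<open>dom_less n nu mu\<close> is $\nu <_d \mu$; the sum is the $i$-th coordinate of
  $\sum_m k_m(\epsilon_m - \epsilon_{m+1})$.\<close>
definition dom_less :: "nat \<Rightarrow> (nat \<Rightarrow> nat) \<Rightarrow> (nat \<Rightarrow> nat) \<Rightarrow> bool" where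
  "dom_less n nu mu \<longleftrightarrow> mu \<noteq> nu \<and>
     (\<exists>k :: nat \<Rightarrow> int. (\<forall>m. k m \<ge> 0) \<and>
        (\<forall>i \<in> {1..n}. int (mu i) - int (nu i) =
           (\<Sum>m \<in> {1..<n}. k m * ((if i = m then 1 else 0) - (if i = m + 1 then 1 else 0)))))"

definition perm_length :: "nat \<Rightarrow> (nat \<Rightarrow> nat) \<Rightarrow> nat" where
  "perm_length n w = card {(i, j). 1 \<le> i \<and> i < j \<and> j \<le> n \<and> w i > w j}"

definition bruhat_step :: "nat \<Rightarrow> (nat \<Rightarrow> nat) \<Rightarrow> (nat \<Rightarrow> nat) \<Rightarrow> bool" where
  "bruhat_step n u w \<longleftrightarrow> (\<exists>i \<in> {1..n}. \<exists>j \<in> {1..n}. i \<noteq> j \<and> w = u \<circ> transpose i j)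
     \<and> perm_length n u < perm_length n w"

text \<open>Strict Bruhat order on the permutations of \<open>{1..n}\<close>.\<close>
definition bruhat_less :: "nat \<Rightarrow> (nat \<Rightarrow> nat) \<Rightarrow> (nat \<Rightarrow> nat) \<Rightarrow> bool" where
  "bruhat_less n = (bruhat_step n)\<^sup>+\<^sup>+"

definition comp_less :: "nat \<Rightarrow> (nat \<Rightarrow> nat) \<Rightarrow> (nat \<Rightarrow> nat) \<Rightarrow> bool" where
  "comp_less n mu nu \<longleftrightarrow> dom_less n (comp_plus n mu) (comp_plus n nu) \<or>
     (comp_plus n mu = comp_plus n nu \<and> bruhat_less n (w_comp n mu) (w_comp n nu))"

text \<open>The pairs $(\nu,S) < (\mu,T)$; the relation does not depend on $T$.\<close>
definition lower_pairs :: "nat \<Rightarrow> nat list list \<Rightarrow> (nat \<Rightarrow> nat) \<Rightarrow> ((nat \<Rightarrow> nat) \<times> tableau) set" where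
  "lower_pairs n lam mu = {(nu, S). nu \<in> compositions n \<and> S \<in> SYT n lam \<and> comp_less n nu mu}"

section \<open>Free algebras\<close>

text \<open>The free algebra is the monoid algebra \<open>word \<Rightarrow>\<^sub>0 'f\<close> of the free monoid on the
  letters \<open>GX i\<close>, \<open>GY i\<close>, \<open>GT w\<close> (for $x_i$, $y_i$, $t_w$); its product is the convolution
  product of \<open>Poly_Mapping\<close>, which needs concatenation of words to be written additively.\<close>

datatype gen = GX nat | GY nat | GT "complex mat"

datatype word = Word (letters: "gen list")

instantiation word :: monoid_add
begin

definition zero_word :: word where "zero_word = Word []"

definition plus_word :: "word \<Rightarrow> word \<Rightarrow> word" where
  "plus_word u v = Word (letters u @ letters v)"

instance
  by standard (simp_all add: zero_word_def plus_word_def)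

end

type_synonym 'f free_alg = "word \<Rightarrow>\<^sub>0 'f"

definition scal :: "'f::field \<Rightarrow> 'f free_alg" where
  "scal a = Poly_Mapping.single 0 a"

definition xg :: "nat \<Rightarrow> 'f::field free_alg" where
  "xg i = Poly_Mapping.single (Word [GX i]) 1"

definition yg :: "nat \<Rightarrow> 'f::field free_alg" where
  "yg i = Poly_Mapping.single (Word [GY i]) 1"

definition tg :: "complex mat \<Rightarrow> 'f::field free_alg" where
  "tg w = Poly_Mapping.single (Word [GT w]) 1"

definition gens :: "nat \<Rightarrow> nat \<Rightarrow> gen set" where
  "gens r n = GX ` {1..n} \<union> GY ` {1..n} \<union> GT ` carrier (G_r1n r n)"

definition free_algebra :: "nat \<Rightarrow> nat \<Rightarrow> 'f::field free_alg ring" where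
  "free_algebra r n = \<lparr>carrier = {p. \<forall>u \<in> Poly_Mapping.keys p. set (letters u) \<subseteq> gens r n},
     monoid.mult = (*), monoid.one = 1, ring.zero = 0, ring.add = (+)\<rparr>"

section \<open>The rational Cherednik algebra\<close>

text \<open>\<open>d_ext r d k\<close> is $d_k$ for $k \in \mathbb{Z}$; only the values \<open>d 1, \<dots>, d (r - 1)\<close> are used.\<close>
definition d_ext :: "nat \<Rightarrow> (nat \<Rightarrow> 'f::field) \<Rightarrow> int \<Rightarrow> 'f" where
  "d_ext r d k = (if k mod int r = 0 then - (\<Sum>j \<in> {1..<r}. d j) else d (nat (k mod int r)))"

text \<open>$\sum_{l=0}^{r-1} t_{\zeta_i^l s_{ij} \zeta_i^{-l}}$\<close>
definition refl_sum :: "nat \<Rightarrow> nat \<Rightarrow> nat \<Rightarrow> nat \<Rightarrow> 'f::field free_alg" where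
  "refl_sum r n i j = (\<Sum>l<r. tg (refl_mat r n i j l))"

definition idem :: "(complex \<Rightarrow> 'f::field) \<Rightarrow> nat \<Rightarrow> nat \<Rightarrow> nat \<Rightarrow> nat \<Rightarrow> 'f free_alg" where
  "idem emb r n i j = scal (emb (1 / of_nat r)) *
     (\<Sum>l<r. scal (emb (zeta r powi (- int l * int j))) * tg (zeta_mat r n i [^]\<^bsub>G_r1n r n\<^esub> l))"

text \<open>A relation \<open>a = b\<close> is encoded by \<open>a - b\<close>. The group acts on $\mathfrak{h}$ by
  $w y_j = \sum_k w_{kj} y_k$ and contragrediently on $\mathfrak{h}^*$, that is
  $w x_j = \sum_k (w^{-1})_{jk} x_k$.\<close>
definition relations :: "(complex \<Rightarrow> 'f::field) \<Rightarrow> nat \<Rightarrow> nat \<Rightarrow> 'f \<Rightarrow> 'f \<Rightarrow> (nat \<Rightarrow> 'f) \<Rightarrow> 'f free_alg set" where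
  "relations emb r n kappa c0 d =
     {xg i * xg j - xg j * xg i | i j. i \<in> {1..n} \<and> j \<in> {1..n}} \<union>
     {yg i * yg j - yg j * yg i | i j. i \<in> {1..n} \<and> j \<in> {1..n}} \<union>
     {tg (1\<^sub>m n) - 1} \<union>
     {tg u * tg w - tg (u * w) | u w. u \<in> carrier (G_r1n r n) \<and> w \<in> carrier (G_r1n r n)} \<union>
     {tg w * xg j - (\<Sum>k \<in> {1..n}. scal (emb ((inv\<^bsub>G_r1n r n\<^esub> w) $$ (j - 1, k - 1))) * xg k) * tg w
        | w j. w \<in> carrier (G_r1n r n) \<and> j \<in> {1..n}} \<union>
     {tg w * yg j - (\<Sum>k \<in> {1..n}. scal (emb (w $$ (k - 1, j - 1))) * yg k) * tg w
        | w j. w \<in> carrier (G_r1n r n) \<and> j \<in> {1..n}} \<union>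
     {yg i * xg j - (xg j * yg i
          + scal c0 * (\<Sum>l<r. scal (emb (zeta r powi (- int l))) * tg (refl_mat r n i j l)))
        | i j. i \<in> {1..n} \<and> j \<in> {1..n} \<and> i \<noteq> j} \<union>
     {yg i * xg i - (xg i * yg i + scal kappa
          - (\<Sum>j<r. scal (d_ext r d (int j) - d_ext r d (int j - 1)) * idem emb r n i j)
          - scal c0 * (\<Sum>j \<in> {1..n} - {i}. refl_sum r n i j))
        | i. i \<in> {1..n}}"

definition rel_ideal :: "(complex \<Rightarrow> 'f::field) \<Rightarrow> nat \<Rightarrow> nat \<Rightarrow> 'f \<Rightarrow> 'f \<Rightarrow> (nat \<Rightarrow> 'f) \<Rightarrow> 'f free_alg set" where
  "rel_ideal emb r n kappa c0 d = Idl\<^bsub>free_algebra r n\<^esub> (relations emb r n kappa c0 d)"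

definition cherednik :: "(complex \<Rightarrow> 'f::field) \<Rightarrow> nat \<Rightarrow> nat \<Rightarrow> 'f \<Rightarrow> 'f \<Rightarrow> (nat \<Rightarrow> 'f) \<Rightarrow> 'f free_alg set ring" where
  "cherednik emb r n kappa c0 d = free_algebra r n Quot rel_ideal emb r n kappa c0 d"

text \<open>The element of the algebra represented by a noncommutative polynomial.\<close>
definition cls :: "(complex \<Rightarrow> 'f::field) \<Rightarrow> nat \<Rightarrow> nat \<Rightarrow> 'f \<Rightarrow> 'f \<Rightarrow> (nat \<Rightarrow> 'f) \<Rightarrow> 'f free_alg \<Rightarrow> 'f free_alg set" where
  "cls emb r n kappa c0 d a = rel_ideal emb r n kappa c0 d +>\<^bsub>free_algebra r n\<^esub> a"

definition phi :: "nat \<Rightarrow> nat \<Rightarrow> nat \<Rightarrow> 'f::field free_alg" where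
  "phi r n i = (\<Sum>j \<in> {1..<i}. refl_sum r n i j)"

definition zg :: "nat \<Rightarrow> nat \<Rightarrow> 'f::field \<Rightarrow> nat \<Rightarrow> 'f free_alg" where
  "zg r n c0 i = yg i * xg i + scal c0 * phi r n i"

text \<open>The subalgebra $\mathfrak{t}$. Including the scalars makes the generated subring
  an \<open>'f\<close>-subalgebra.\<close>
definition t_alg :: "(complex \<Rightarrow> 'f::field) \<Rightarrow> nat \<Rightarrow> nat \<Rightarrow> 'f \<Rightarrow> 'f \<Rightarrow> (nat \<Rightarrow> 'f) \<Rightarrow> 'f free_alg set set" where
  "t_alg emb r n kappa c0 d = generate_ring (cherednik emb r n kappa c0 d)
     (cls emb r n kappa c0 d `
        (range scal \<union> zg r n c0 ` {1..n} \<union> (\<lambda>i. tg (zeta_mat r n i)) ` {1..n}))"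

section \<open>Induced modules\<close>

text \<open>The induced module $A \otimes_B V$ for a ring \<open>A\<close> and a module $V$ over a subring $B$ of \<open>A\<close>,
  where $B$ is given by a set \<open>Bact\<close> of pairs (generator of $B$, its action on $V$).
  It is the free abelian group on \<open>carrier A \<times> V\<close> modulo biadditivity and
  $ab \otimes v = a \otimes bv$; balancing over generators of $B$ implies it for all of $B$.\<close>

definition tensor_group :: "('a, 'k) ring_scheme \<Rightarrow> 'v set \<Rightarrow> ('a \<times> 'v \<Rightarrow>\<^sub>0 int) monoid" where
  "tensor_group A V = free_Abelian_group (carrier A \<times> V)"

definition tensor_relations ::
  "('a, 'k) ring_scheme \<Rightarrow> ('a \<times> ('v \<Rightarrow> 'v)) set \<Rightarrow> 'v::ab_group_add set \<Rightarrow> ('a \<times> 'v \<Rightarrow>\<^sub>0 int) set" where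
  "tensor_relations A Bact V =
     {frag_of (a \<oplus>\<^bsub>A\<^esub> a', v) - (frag_of (a, v) + frag_of (a', v))
        | a a' v. a \<in> carrier A \<and> a' \<in> carrier A \<and> v \<in> V} \<union>
     {frag_of (a, v + v') - (frag_of (a, v) + frag_of (a, v'))
        | a v v'. a \<in> carrier A \<and> v \<in> V \<and> v' \<in> V} \<union>
     {frag_of (a \<otimes>\<^bsub>A\<^esub> b, v) - frag_of (a, act v)
        | a b act v. a \<in> carrier A \<and> (b, act) \<in> Bact \<and> v \<in> V}"

definition tensor_kernel ::
  "('a, 'k) ring_scheme \<Rightarrow> ('a \<times> ('v \<Rightarrow> 'v)) set \<Rightarrow> 'v::ab_group_add set \<Rightarrow> ('a \<times> 'v \<Rightarrow>\<^sub>0 int) set" where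
  "tensor_kernel A Bact V = generate (tensor_group A V) (tensor_relations A Bact V)"

definition tensor ::
  "('a, 'k) ring_scheme \<Rightarrow> ('a \<times> ('v \<Rightarrow> 'v)) set \<Rightarrow> 'v::ab_group_add set \<Rightarrow> 'a \<Rightarrow> 'v \<Rightarrow> ('a \<times> 'v \<Rightarrow>\<^sub>0 int) set" where
  "tensor A Bact V a v = tensor_kernel A Bact V #>\<^bsub>tensor_group A V\<^esub> frag_of (a, v)"

text \<open>The record type \<open>module\<close> is used for a left module over a noncommutative ring, so its fields
  \<open>mult\<close> and \<open>one\<close> are irrelevant. The action is $a \cdot (a' \otimes v) = aa' \otimes v$.\<close>
definition induced_module ::
  "('a, 'k) ring_scheme \<Rightarrow> ('a \<times> ('v \<Rightarrow> 'v)) set \<Rightarrow> 'v::ab_group_add set \<Rightarrow> ('a, ('a \<times> 'v \<Rightarrow>\<^sub>0 int) set) module" where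
  "induced_module A Bact V =
     (let G = tensor_group A V; N = tensor_kernel A Bact V in
      \<lparr>carrier = carrier (G Mod N), monoid.mult = undefined, monoid.one = undefined,
       ring.zero = \<one>\<^bsub>G Mod N\<^esub>, ring.add = (\<otimes>\<^bsub>G Mod N\<^esub>),
       module.smult = (\<lambda>a m. \<Union>x \<in> m. N #>\<^bsub>G\<^esub> frag_extend (\<lambda>(a', v). frag_of (a \<otimes>\<^bsub>A\<^esub> a', v)) x)\<rparr>)"

section \<open>The standard module $M(\lambda)$\<close>

type_synonym 'f std_elem = "('f free_alg set \<times> (tableau \<Rightarrow>\<^sub>0 'f) \<Rightarrow>\<^sub>0 int) set"

text \<open>The subalgebra generated by $F$, $W$ and the $y_i$, with its action on $S^\lambda$.\<close>
definition B_act :: "(complex \<Rightarrow> 'f::field) \<Rightarrow> nat \<Rightarrow> nat \<Rightarrow> 'f \<Rightarrow> 'f \<Rightarrow> (nat \<Rightarrow> 'f) \<Rightarrow> nat list list \<Rightarrow>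
    (complex mat \<Rightarrow> tableau \<Rightarrow> tableau \<Rightarrow> complex) \<Rightarrow>
    ('f free_alg set \<times> ((tableau \<Rightarrow>\<^sub>0 'f) \<Rightarrow> (tableau \<Rightarrow>\<^sub>0 'f))) set" where
  "B_act emb r n kappa c0 d lam rho =
     {(cls emb r n kappa c0 d (scal a), Poly_Mapping.map ((*) a)) | a. True} \<union>
     {(cls emb r n kappa c0 d (tg w), S_act emb n lam rho w) | w. w \<in> carrier (G_r1n r n)} \<union>
     {(cls emb r n kappa c0 d (yg i), \<lambda>_. 0) | i. i \<in> {1..n}}"

definition standard_module :: "(complex \<Rightarrow> 'f::field) \<Rightarrow> nat \<Rightarrow> nat \<Rightarrow> 'f \<Rightarrow> 'f \<Rightarrow> (nat \<Rightarrow> 'f) \<Rightarrow> nat list list \<Rightarrow>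
    (complex mat \<Rightarrow> tableau \<Rightarrow> tableau \<Rightarrow> complex) \<Rightarrow> ('f free_alg set, 'f std_elem) module" where
  "standard_module emb r n kappa c0 d lam rho =
     induced_module (cherednik emb r n kappa c0 d) (B_act emb r n kappa c0 d lam rho) (S_space n lam)"

definition x_pow :: "nat \<Rightarrow> (nat \<Rightarrow> nat) \<Rightarrow> 'f::field free_alg" where
  "x_pow n mu = prod_list (map (\<lambda>i. xg i ^ mu i) [1..<n + 1])"

definition v_mu :: "(complex \<Rightarrow> 'f::field) \<Rightarrow> nat \<Rightarrow> nat \<Rightarrow> nat list list \<Rightarrow>
    (complex mat \<Rightarrow> tableau \<Rightarrow> tableau \<Rightarrow> complex) \<Rightarrow> (nat \<Rightarrow> nat) \<Rightarrow> tableau \<Rightarrow> (tableau \<Rightarrow>\<^sub>0 'f)" where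
  "v_mu emb r n lam rho mu T =
     S_act emb n lam rho (inv\<^bsub>G_r1n r n\<^esub> (perm_mat n (w_comp n mu))) (Poly_Mapping.single T 1)"

text \<open>The element $x^\mu v_T^\mu = x^\mu \otimes v_T^\mu$ of $M(\lambda)$.\<close>
definition xv :: "(complex \<Rightarrow> 'f::field) \<Rightarrow> nat \<Rightarrow> nat \<Rightarrow> 'f \<Rightarrow> 'f \<Rightarrow> (nat \<Rightarrow> 'f) \<Rightarrow> nat list list \<Rightarrow>
    (complex mat \<Rightarrow> tableau \<Rightarrow> tableau \<Rightarrow> complex) \<Rightarrow> (nat \<Rightarrow> nat) \<Rightarrow> tableau \<Rightarrow> 'f std_elem" where
  "xv emb r n kappa c0 d lam rho mu T =
     tensor (cherednik emb r n kappa c0 d) (B_act emb r n kappa c0 d lam rho) (S_space n lam)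
       (cls emb r n kappa c0 d (x_pow n mu)) (v_mu emb r n lam rho mu T)"

definition t_eigenvector :: "(complex \<Rightarrow> 'f::field) \<Rightarrow> nat \<Rightarrow> nat \<Rightarrow> 'f \<Rightarrow> 'f \<Rightarrow> (nat \<Rightarrow> 'f) \<Rightarrow> nat list list \<Rightarrow>
    (complex mat \<Rightarrow> tableau \<Rightarrow> tableau \<Rightarrow> complex) \<Rightarrow> 'f std_elem \<Rightarrow> bool" where
  "t_eigenvector emb r n kappa c0 d lam rho f \<longleftrightarrow>
     (let M = standard_module emb r n kappa c0 d lam rho in
      f \<in> carrier M \<and> f \<noteq> \<zero>\<^bsub>M\<^esub> \<and>
      (\<forall>a \<in> t_alg emb r n kappa c0 d. \<exists>c.
         a \<odot>\<^bsub>M\<^esub> f = cls emb r n kappa c0 d (scal c) \<odot>\<^bsub>M\<^esub> f))"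

section \<open>Generic parameters\<close>

text \<open>The list $\kappa, c_0, d_1, \dots, d_{r-1}$, indexed by \<open>{0..r}\<close>.\<close>
definition param :: "'f \<Rightarrow> 'f \<Rightarrow> (nat \<Rightarrow> 'f) \<Rightarrow> nat \<Rightarrow> 'f" where
  "param kappa c0 d k = (if k = 0 then kappa else if k = 1 then c0 else d (k - 1))"

text \<open>Algebraic independence of \<open>a 0, \<dots>, a m\<close> over $\mathbb{C}$: a polynomial is a finitely
  supported function on exponent vectors.\<close>
definition alg_independent :: "(complex \<Rightarrow> 'f::field) \<Rightarrow> nat \<Rightarrow> (nat \<Rightarrow> 'f) \<Rightarrow> bool" where
  "alg_independent emb m a \<longleftrightarrow>
     (\<forall>P :: (nat \<Rightarrow>\<^sub>0 nat) \<Rightarrow>\<^sub>0 complex.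
        (\<forall>e \<in> Poly_Mapping.keys P. Poly_Mapping.keys e \<subseteq> {0..m}) \<longrightarrow>
        (\<Sum>e \<in> Poly_Mapping.keys P. emb (Poly_Mapping.lookup P e)
           * (\<Prod>k \<in> {0..m}. a k ^ Poly_Mapping.lookup e k)) = 0 \<longrightarrow>
        P = 0)"

definition is_subfield :: "'f::field set \<Rightarrow> bool" where
  "is_subfield K \<longleftrightarrow> 1 \<in> K \<and> (\<forall>a \<in> K. \<forall>b \<in> K. a - b \<in> K \<and> a * b \<in> K) \<and> (\<forall>a \<in> K. inverse a \<in> K)"

text \<open>\<open>'f\<close> is the field $\mathbb{C}(\kappa,c_0,d_1,\dots,d_{r-1})$ of rational functions
  in the parameters.\<close>
definition generic :: "(complex \<Rightarrow> 'f::field) \<Rightarrow> nat \<Rightarrow> 'f \<Rightarrow> 'f \<Rightarrow> (nat \<Rightarrow> 'f) \<Rightarrow> bool" where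
  "generic emb r kappa c0 d \<longleftrightarrow> alg_independent emb r (param kappa c0 d) \<and>
     (\<forall>K. is_subfield K \<and> range emb \<subseteq> K \<and> param kappa c0 d ` {0..r} \<subseteq> K \<longrightarrow> K = UNIV)"

end

theory Submission
  imports Defs
begin

text \<open>
  The standard module is the space \<open>F[x\<^sub>1, \<dots>, x\<^sub>n] \<otimes> S\<^sup>\<lambda>\<close>, on which \<open>x\<^sub>i\<close> multiplies,
  \<open>W\<close> acts diagonally and \<open>y\<^sub>i\<close> acts by a Dunkl operator. The theorem is proved on this space and
  carried over.

  \<^emph>\<open>The space of polynomials.\<close> The Dunkl operator is defined on monomials by an explicit divided
  difference, and its commutator with \<open>x\<^sub>k\<close> is a direct computation (\<open>Y_X\<close>). The other relations of the
  algebra then follow by induction on the degree: an operator vanishes if it kills the polynomials of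
  degree 0 and if its vanishing at \<open>P\<close> always implies its vanishing at \<open>x\<^sub>k P\<close> (\<open>degree_induct\<close>). This
  yields equivariance under \<open>W\<close> (\<open>T_Y\<close>) and, from it, commutativity of the Dunkl operators
  (\<open>Y_commute\<close>). So the algebra acts (\<open>act_relations\<close>), and \<open>a \<otimes> v \<mapsto> a (1 \<otimes> v)\<close> is defined on the
  induced module. Moving all \<open>x\<^sub>i\<close> to the left shows that the \<open>x\<^sup>\<mu> \<otimes> v\<close> span that module
  (\<open>compat_all\<close>); hence the map is an isomorphism, with inverse \<open>of_model\<close>. In particular the
  \<open>x\<^sup>\<mu> v\<^sub>T\<^sup>\<mu>\<close> are linearly independent, without which no eigenvector could be shown to be nonzero.

  \<^emph>\<open>Part (a).\<close> In \<open>y\<^sub>i x\<^sub>i x\<^sup>\<mu>\<close> the reflections in the coordinates \<open>i\<close> and \<open>j\<close> produce monomials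
  whose exponents at \<open>i\<close> and \<open>j\<close> lie strictly between \<open>\<mu>\<^sub>i\<close> and \<open>\<mu>\<^sub>j\<close>, which are smaller in the dominance
  order, the monomial with \<open>\<mu>\<^sub>i\<close> and \<open>\<mu>\<^sub>j\<close> exchanged, and \<open>x\<^sup>\<mu>\<close> itself. The summand \<open>c\<^sub>0 \<phi>\<^sub>i\<close> of
  \<open>z\<^sub>i\<close> is made so that it cancels the exchanged monomials that are not smaller in the Bruhat order
  (\<open>nabla_triangular\<close>). The monomial \<open>x\<^sup>\<mu>\<close> survives exactly for the \<open>j\<close> with \<open>w\<^sub>\<mu>(j) < w\<^sub>\<mu>(i)\<close>;
  conjugation with \<open>w\<^sub>\<mu>\<close> turns the sum of these reflections into \<open>\<phi>\<close> at the index \<open>w\<^sub>\<mu>(i)\<close>, a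
  Jucys-Murphy element, which acts on \<open>v\<^sub>T\<close> by \<open>r\<close> times a content (\<open>jucys_murphy\<close>).

  \<^emph>\<open>Part (b).\<close> The \<open>z\<^sub>i\<close> commute with each other and with the \<open>t\<close> of diagonal matrices
  (\<open>zop_commute\<close>, \<open>Td_zop\<close>). A commuting family of operators that is triangular for a partial order with
  finite lower sets, and that separates an index from all smaller ones, has exactly one joint eigenvector
  with that leading term (locale \<open>commuting_triangular\<close>). Here the coefficient \<open>\<mu>\<^sub>i + 1\<close> of \<open>\<kappa>\<close>
  already separates, because \<open>(\<nu>, S) < (\<mu>, T)\<close> forces \<open>\<nu> \<noteq> \<mu>\<close> (\<open>zval_separates\<close>).
\<close>

alias single = Poly_Mapping.single
alias lookup = Poly_Mapping.lookup
alias keys = Poly_Mapping.keys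

section \<open>Monomial matrices and roots of unity\<close>

abbreviation pinv :: "('a \<Rightarrow> 'b) \<Rightarrow> 'b \<Rightarrow> 'a" where
  "pinv \<equiv> inv_into UNIV"

text \<open>The data \<open>(s, c)\<close> of an element of \<open>G(r, 1, n)\<close>: it sends the basis vector \<open>y\<^sub>j\<close> to \<open>c\<^sub>j y\<^bsub>s(j)\<^esub>\<close>.
  Computing with these pairs replaces computing with matrices.\<close>
definition adm :: "nat \<Rightarrow> nat \<Rightarrow> (nat \<Rightarrow> nat) \<Rightarrow> (nat \<Rightarrow> complex) \<Rightarrow> bool" where
  "adm r n s c \<longleftrightarrow> s permutes {1..n} \<and> (\<forall>j\<in>{1..n}. c j ^ r = 1)"

definition mono_mat :: "nat \<Rightarrow> (nat \<Rightarrow> nat) \<Rightarrow> (nat \<Rightarrow> complex) \<Rightarrow> complex mat" where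
  "mono_mat n s c = mat n n (\<lambda>(a, b). if s (b + 1) = a + 1 then c (b + 1) else 0)"

lemma mono_mat_dim [simp]: "dim_row (mono_mat n s c) = n" "dim_col (mono_mat n s c) = n"
  by (simp_all add: mono_mat_def)

lemma mono_mat_index:
  "a < n \<Longrightarrow> b < n \<Longrightarrow> mono_mat n s c $$ (a, b) = (if s (b + 1) = a + 1 then c (b + 1) else 0)"
  by (simp add: mono_mat_def)

lemma mono_mat_cong:
  assumes "\<And>j. j \<in> {1..n} \<Longrightarrow> s j = t j" "\<And>j. j \<in> {1..n} \<Longrightarrow> c j = e j"
  shows "mono_mat n s c = mono_mat n t e"
  by (rule eq_matI) (simp_all add: mono_mat_index assms)

lemma mono_mat_mult:
  assumes "t permutes {1..n}"
  shows "mono_mat n s c * mono_mat n t e = mono_mat n (s \<circ> t) (\<lambda>j. c (t j) * e j)"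
proof (rule eq_matI)
  fix a b assume "a < dim_row (mono_mat n (s \<circ> t) (\<lambda>j. c (t j) * e j))"
    "b < dim_col (mono_mat n (s \<circ> t) (\<lambda>j. c (t j) * e j))"
  then have ab: "a < n" "b < n" by simp_all
  then have tb: "t (b + 1) \<in> {1..n}" using permutes_in_image[OF assms, of "b + 1"] by simp
  define k where "k = t (b + 1) - 1"
  have k: "k < n" "t (b + 1) = k + 1" using tb by (auto simp: k_def)
  have "(mono_mat n s c * mono_mat n t e) $$ (a, b)
      = (\<Sum>m<n. mono_mat n s c $$ (a, m) * mono_mat n t e $$ (m, b))"
    using ab by (simp add: scalar_prod_def atLeast0LessThan)
  also have "\<dots> = (\<Sum>m<n. if m = k then mono_mat n s c $$ (a, k) * e (b + 1) else 0)"
    using ab k by (intro sum.cong) (auto simp: mono_mat_index)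
  also have "\<dots> = mono_mat n (s \<circ> t) (\<lambda>j. c (t j) * e j) $$ (a, b)"
    using ab k by (auto simp: mono_mat_index)
  finally show "(mono_mat n s c * mono_mat n t e) $$ (a, b)
      = mono_mat n (s \<circ> t) (\<lambda>j. c (t j) * e j) $$ (a, b)" .
qed simp_all

lemma adm_nonzero: "adm r n s c \<Longrightarrow> r \<ge> 1 \<Longrightarrow> j \<in> {1..n} \<Longrightarrow> c j \<noteq> 0"
  by (cases "c j = 0") (auto simp: adm_def power_0_left dest!: bspec[of _ _ j])

lemma adm_permutes: "adm r n s c \<Longrightarrow> s permutes {1..n}"
  by (simp add: adm_def)

lemma adm_comp: "adm r n s c \<Longrightarrow> adm r n t e \<Longrightarrow> adm r n (s \<circ> t) (\<lambda>j. c (t j) * e j)"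
  by (auto simp: adm_def permutes_compose power_mult_distrib dest: permutes_in_image)

lemma adm_inv: "adm r n s c \<Longrightarrow> adm r n (pinv s) (\<lambda>j. inverse (c (pinv s j)))"
proof -
  assume a: "adm r n s c"
  have "pinv s j \<in> {1..n}" if "j \<in> {1..n}" for j
    using a that permutes_in_image[OF permutes_inv, of s "{1..n}" j] by (simp add: adm_def)
  then show ?thesis using a by (simp add: adm_def permutes_inv power_inverse)
qed

lemma adm_id: "(\<And>j. j \<in> {1..n} \<Longrightarrow> c j ^ r = 1) \<Longrightarrow> adm r n id c"
  by (simp add: adm_def permutes_id)

lemma mono_mat_one: "mono_mat n id (\<lambda>_. 1) = 1\<^sub>m n"
  by (rule eq_matI) (auto simp: mono_mat_index)

lemma mono_mat_inj:
  assumes "adm r n s c" "adm r n t e" "r \<ge> 1" "mono_mat n s c = mono_mat n t e"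
  shows "s = t" "\<And>j. j \<in> {1..n} \<Longrightarrow> c j = e j"
proof -
  have *: "s j = t j \<and> c j = e j" if "j \<in> {1..n}" for j
  proof -
    have sj: "s j \<in> {1..n}" using that assms(1) permutes_in_image[of s "{1..n}" j] by (simp add: adm_def)
    have "mono_mat n s c $$ (s j - 1, j - 1) = mono_mat n t e $$ (s j - 1, j - 1)"
      using assms(4) by simp
    then have "c j = (if t j = s j then e j else 0)"
      using that sj by (auto simp: mono_mat_index)
    then show ?thesis using adm_nonzero[OF assms(1,3) that] by (auto split: if_splits)
  qed
  show "s = t"
  proof
    fix j show "s j = t j"
      using * assms(1,2) by (cases "j \<in> {1..n}") (auto simp: adm_def permutes_not_in)
  qed
  show "\<And>j. j \<in> {1..n} \<Longrightarrow> c j = e j" using * by blast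
qed

lemma mono_mat_in_G:
  assumes "adm r n s c" "r \<ge> 1"
  shows "mono_mat n s c \<in> carrier (G_r1n r n)"
proof -
  have p: "s permutes {1..n}" using assms by (simp add: adm_def)
  have nz: "c (b + 1) \<noteq> 0" if "b < n" for b using adm_nonzero[OF assms, of "b+1"] that by simp
  have iff: "mono_mat n s c $$ (a, b) \<noteq> 0 \<longleftrightarrow> s (b + 1) = a + 1" if "a < n" "b < n" for a b
    using that nz by (simp add: mono_mat_index)
  have 1: "\<exists>!j. j < n \<and> mono_mat n s c $$ (i, j) \<noteq> 0" if "i < n" for i
  proof
    have "pinv s (i + 1) \<in> {1..n}" using permutes_in_image[OF permutes_inv[OF p], of "i+1"] that by simp
    then have "pinv s (i + 1) - 1 < n" "s ((pinv s (i + 1) - 1) + 1) = i + 1"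
      using permutes_inverses[OF p] by auto
    then show "pinv s (i + 1) - 1 < n \<and> mono_mat n s c $$ (i, pinv s (i + 1) - 1) \<noteq> 0"
      using iff[of i "pinv s (i + 1) - 1"] that by simp
    fix j assume "j < n \<and> mono_mat n s c $$ (i, j) \<noteq> 0"
    then have "s (j + 1) = i + 1" using iff[of i j] that by simp
    then have "pinv s (i + 1) = j + 1" using permutes_inverses[OF p] by metis
    then show "j = pinv s (i + 1) - 1" by simp
  qed
  have 2: "\<exists>!i. i < n \<and> mono_mat n s c $$ (i, j) \<noteq> 0" if "j < n" for j
  proof
    have "s (j + 1) \<in> {1..n}" using permutes_in_image[OF p, of "j+1"] that by simp
    then have "s (j + 1) - 1 < n" "s (j + 1) = (s (j + 1) - 1) + 1" by auto
    then show "s (j + 1) - 1 < n \<and> mono_mat n s c $$ (s (j + 1) - 1, j) \<noteq> 0"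
      using that iff[of "s (j + 1) - 1" j] by simp
    fix i assume "i < n \<and> mono_mat n s c $$ (i, j) \<noteq> 0"
    then show "i = s (j + 1) - 1" using iff[of i j] that by auto
  qed
  have 3: "mono_mat n s c $$ (i, j) ^ r = 1" if "i < n" "j < n" "mono_mat n s c $$ (i, j) \<noteq> 0" for i j
    using that assms(1) by (simp add: mono_mat_index adm_def split: if_splits)
  have 4: "mono_mat n s c \<in> carrier_mat n n" by (simp add: mono_mat_def)
  show ?thesis
    unfolding G_r1n_def using 1 2 3 4 by simp
qed

lemma G_mono_mat:
  assumes "A \<in> carrier (G_r1n r n)"
  obtains s c where "adm r n s c" "A = mono_mat n s c"
proof -
  have A: "A \<in> carrier_mat n n" "\<And>i. i < n \<Longrightarrow> \<exists>!j. j < n \<and> A $$ (i, j) \<noteq> 0"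
    "\<And>j. j < n \<Longrightarrow> \<exists>!i. i < n \<and> A $$ (i, j) \<noteq> 0"
    "\<And>i j. i < n \<Longrightarrow> j < n \<Longrightarrow> A $$ (i, j) \<noteq> 0 \<Longrightarrow> A $$ (i, j) ^ r = 1"
    using assms by (auto simp: G_r1n_def)
  define f where "f j = (THE i. i < n \<and> A $$ (i, j) \<noteq> 0)" for j
  have f: "f j < n \<and> A $$ (f j, j) \<noteq> 0" if "j < n" for j
    unfolding f_def by (rule theI') (rule A(3)[OF that])
  have f': "i = f j" if "j < n" "i < n" "A $$ (i, j) \<noteq> 0" for i j
    using A(3)[OF that(1)] f[OF that(1)] that by blast
  define s where "s j = (if j \<in> {1..n} then f (j - 1) + 1 else j)" for j
  define c where "c j = A $$ (f (j - 1), j - 1)" for j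
  have inj: "inj_on s {1..n}"
  proof (rule inj_onI)
    fix x y assume xy: "x \<in> {1..n}" "y \<in> {1..n}" "s x = s y"
    then have "f (x - 1) = f (y - 1)" by (simp add: s_def)
    moreover have "x - 1 < n" "y - 1 < n" using xy by auto
    ultimately have "x - 1 = y - 1" using A(2)[of "f (x - 1)"] f by metis
    then show "x = y" using xy by auto
  qed
  have "s ` {1..n} \<subseteq> {1..n}"
  proof
    fix y assume "y \<in> s ` {1..n}"
    then obtain x where "x \<in> {1..n}" "y = f (x - 1) + 1" by (auto simp: s_def)
    moreover then have "f (x - 1) < n" using f[of "x - 1"] by auto
    ultimately show "y \<in> {1..n}" by auto
  qed
  then have "bij_betw s {1..n} {1..n}"
    using inj by (simp add: bij_betw_def endo_inj_surj)
  then have "s permutes {1..n}" by (intro bij_imp_permutes) (auto simp: s_def)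
  moreover have "c j ^ r = 1" if "j \<in> {1..n}" for j
  proof -
    have "j - 1 < n" using that by auto
    then show ?thesis unfolding c_def using A(4) f by blast
  qed
  moreover have "A = mono_mat n s c"
    using A(1) f' by (intro eq_matI) (auto simp: mono_mat_index s_def c_def)
  ultimately show ?thesis by (intro that[of s c]) (auto simp: adm_def)
qed

lemma G_mult [simp]: "x \<otimes>\<^bsub>G_r1n r n\<^esub> y = x * y"
  and G_one [simp]: "\<one>\<^bsub>G_r1n r n\<^esub> = 1\<^sub>m n"
  by (simp_all add: G_r1n_def)

lemma mono_mat_inverse:
  assumes "adm r n s c" "r \<ge> 1"
  shows "mono_mat n (pinv s) (\<lambda>j. inverse (c (pinv s j))) * mono_mat n s c = 1\<^sub>m n"
proof -
  have p: "s permutes {1..n}" using assms by (simp add: adm_def)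
  show ?thesis
    unfolding mono_mat_mult[OF p] mono_mat_one[symmetric]
    by (rule mono_mat_cong)
      (simp_all add: permutes_inverses[OF p] adm_nonzero[OF assms] del: One_nat_def)
qed

lemma group_G:
  assumes "r \<ge> 1"
  shows "group (G_r1n r n)"
proof (rule groupI)
  fix x y assume "x \<in> carrier (G_r1n r n)" "y \<in> carrier (G_r1n r n)"
  then obtain s c t e where "adm r n s c" "x = mono_mat n s c" "adm r n t e" "y = mono_mat n t e"
    by (metis G_mono_mat)
  then show "x \<otimes>\<^bsub>G_r1n r n\<^esub> y \<in> carrier (G_r1n r n)"
    using mono_mat_in_G[OF adm_comp assms] mono_mat_mult[OF adm_permutes] by simp
next
  show "\<one>\<^bsub>G_r1n r n\<^esub> \<in> carrier (G_r1n r n)"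
    using mono_mat_in_G[OF adm_id assms, of n "\<lambda>_. 1"] by (simp add: mono_mat_one)
next
  fix x y z assume "x \<in> carrier (G_r1n r n)" "y \<in> carrier (G_r1n r n)" "z \<in> carrier (G_r1n r n)"
  then show "x \<otimes>\<^bsub>G_r1n r n\<^esub> y \<otimes>\<^bsub>G_r1n r n\<^esub> z = x \<otimes>\<^bsub>G_r1n r n\<^esub> (y \<otimes>\<^bsub>G_r1n r n\<^esub> z)"
    by (simp add: G_r1n_def assoc_mult_mat[of _ n n _ n _ n])
next
  fix x assume "x \<in> carrier (G_r1n r n)"
  then show "\<one>\<^bsub>G_r1n r n\<^esub> \<otimes>\<^bsub>G_r1n r n\<^esub> x = x"
    by (auto simp: G_r1n_def intro: left_mult_one_mat)
  from \<open>x \<in> carrier (G_r1n r n)\<close> obtain s c where sc: "adm r n s c" "x = mono_mat n s c"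
    by (rule G_mono_mat)
  show "\<exists>y\<in>carrier (G_r1n r n). y \<otimes>\<^bsub>G_r1n r n\<^esub> x = \<one>\<^bsub>G_r1n r n\<^esub>"
    unfolding G_mult G_one sc(2)
    by (intro bexI[of _ "mono_mat n (pinv s) (\<lambda>j. inverse (c (pinv s j)))"]
        mono_mat_inverse[OF sc(1) assms] mono_mat_in_G[OF adm_inv[OF sc(1)] assms])
qed

lemma inv_mono_mat:
  assumes "adm r n s c" "r \<ge> 1"
  shows "inv\<^bsub>G_r1n r n\<^esub> (mono_mat n s c) = mono_mat n (pinv s) (\<lambda>j. inverse (c (pinv s j)))"
  using assms by (intro group.inv_equality group_G)
    (simp_all add: mono_mat_inverse mono_mat_in_G adm_inv)

lemma zeta_pow_r: "r \<ge> 1 \<Longrightarrow> zeta r ^ r = 1"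
  by (simp add: zeta_def DeMoivre)

lemma zeta_nonzero [simp]: "zeta r \<noteq> 0"
  by (simp add: zeta_def)

text \<open>With the identity permutation, the diagonal matrix with \<open>x\<close> in position \<open>i\<close>.\<close>
definition diag_fun :: "nat \<Rightarrow> complex \<Rightarrow> nat \<Rightarrow> complex" where
  "diag_fun i x = (\<lambda>_. 1)(i := x)"

text \<open>With the transposition of \<open>i\<close> and \<open>j\<close>, the reflection \<open>y\<^sub>j \<mapsto> x y\<^sub>i\<close>, \<open>y\<^sub>i \<mapsto> x\<^sup>-\<^sup>1 y\<^sub>j\<close>. For
  \<open>x = \<zeta>\<^sup>l\<close> this is \<open>\<zeta>\<^sub>i\<^sup>l s\<^sub>i\<^sub>j \<zeta>\<^sub>i\<^sup>-\<^sup>l\<close>.\<close>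
definition refl_fun :: "nat \<Rightarrow> nat \<Rightarrow> complex \<Rightarrow> nat \<Rightarrow> complex" where
  "refl_fun i j x = (\<lambda>_. 1)(i := inverse x, j := x)"

lemma zeta_mat_mono: "zeta_mat r n i = mono_mat n id (diag_fun i (zeta r))"
  by (rule eq_matI) (auto simp: zeta_mat_def mono_mat_index diag_fun_def)

lemma zeta_mat_pow:
  assumes "r \<ge> 1"
  shows "zeta_mat r n i [^]\<^bsub>G_r1n r n\<^esub> (l::nat) = mono_mat n id (diag_fun i (zeta r ^ l))"
proof (induction l)
  case 0
  have "diag_fun i (zeta r ^ 0) = (\<lambda>_. 1)" by (auto simp: diag_fun_def)
  then show ?case by (simp add: mono_mat_one[symmetric] id_def)
next
  case (Suc l)
  then show ?case
    by (simp add: nat_pow_def zeta_mat_mono mono_mat_mult permutes_id[unfolded id_def] permutes_id)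
       (intro mono_mat_cong, auto simp: diag_fun_def)
qed

lemma perm_mat_mono: "perm_mat n w = mono_mat n w (\<lambda>_. 1)"
  by (rule eq_matI) (auto simp: perm_mat_def mono_mat_index)

lemma adm_perm: "w permutes {1..n} \<Longrightarrow> adm r n w (\<lambda>_. 1)"
  by (simp add: adm_def)

lemma adm_diag: "x ^ r = 1 \<Longrightarrow> adm r n id (diag_fun i x)"
  by (auto simp: adm_def permutes_id diag_fun_def)

lemma adm_refl: "i \<in> {1..n} \<Longrightarrow> j \<in> {1..n} \<Longrightarrow> x ^ r = 1 \<Longrightarrow> adm r n (transpose i j) (refl_fun i j x)"
  by (auto simp: adm_def permutes_swap_id refl_fun_def power_inverse)

lemma refl_mat_mono:
  assumes "r \<ge> 1" "i \<in> {1..n}" "j \<in> {1..n}" "i \<noteq> j"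
  shows "refl_mat r n i j l = mono_mat n (transpose i j) (refl_fun i j (zeta r ^ l))"
proof -
  have z: "(zeta r ^ l) ^ r = 1"
    using zeta_pow_r[OF assms(1)] by (metis power_mult mult.commute power_one)
  have p: "id permutes {1..n}" "transpose i j permutes {1..n}"
    using assms by (simp_all add: permutes_id permutes_swap_id)
  show ?thesis
    unfolding refl_mat_def zeta_mat_pow[OF assms(1)] s_mat_def perm_mat_mono
      inv_mono_mat[OF adm_diag[OF z] assms(1)]
    using p assms by (simp add: mono_mat_mult)
      (intro mono_mat_cong, auto simp: diag_fun_def refl_fun_def transpose_def)
qed

definition perm_of :: "nat \<Rightarrow> nat \<Rightarrow> complex mat \<Rightarrow> nat \<Rightarrow> nat" where
  "perm_of r n w = fst (SOME p. adm r n (fst p) (snd p) \<and> w = mono_mat n (fst p) (snd p))"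

definition coef_of :: "nat \<Rightarrow> nat \<Rightarrow> complex mat \<Rightarrow> nat \<Rightarrow> complex" where
  "coef_of r n w = snd (SOME p. adm r n (fst p) (snd p) \<and> w = mono_mat n (fst p) (snd p))"

lemma perm_coef_of:
  assumes "w \<in> carrier (G_r1n r n)"
  shows "adm r n (perm_of r n w) (coef_of r n w)" "w = mono_mat n (perm_of r n w) (coef_of r n w)"
proof -
  have "\<exists>p. adm r n (fst p) (snd p) \<and> w = mono_mat n (fst p) (snd p)"
    using G_mono_mat[OF assms] by (metis fst_conv snd_conv)
  from someI_ex[OF this]
  show "adm r n (perm_of r n w) (coef_of r n w)" "w = mono_mat n (perm_of r n w) (coef_of r n w)"
    by (simp_all add: perm_of_def coef_of_def)
qed

lemma perm_of_mono:
  assumes "adm r n s c" "r \<ge> 1"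
  shows "perm_of r n (mono_mat n s c) = s"
    "\<And>j. j \<in> {1..n} \<Longrightarrow> coef_of r n (mono_mat n s c) j = c j"
  using mono_mat_inj[OF _ assms(1,2)] perm_coef_of[OF mono_mat_in_G[OF assms]] by metis+

text \<open>The reflections are summed over roots of unity rather than over exponents \<open>l < r\<close>, because
  conjugation by a monomial matrix then only translates the index of summation.\<close>
definition unity_roots :: "nat \<Rightarrow> complex set" where
  "unity_roots r = {z. z ^ r = 1}"

lemma bij_betw_zeta:
  assumes "r \<ge> 1"
  shows "bij_betw (\<lambda>l. zeta r ^ l) {..<r} (unity_roots r)"
proof -
  have "zeta r ^ l = cis (2 * pi * real l / real r)" for l
    by (simp add: zeta_def DeMoivre mult_ac)
  then show ?thesis using bij_betw_roots_unity[of r] assms by (simp add: unity_roots_def)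
qed

lemma sum_zeta: "r \<ge> 1 \<Longrightarrow> (\<Sum>l<r. f (zeta r ^ l)) = (\<Sum>x\<in>unity_roots r. f x)"
  by (rule sum.reindex_bij_betw[OF bij_betw_zeta])

lemma unity_roots_nonzero: "r \<ge> 1 \<Longrightarrow> x \<in> unity_roots r \<Longrightarrow> x \<noteq> 0"
  by (auto simp: unity_roots_def power_0_left)

text \<open>Multiplication by a root of unity permutes the roots. Equivariance of the sums of
  reflections reduces to this.\<close>
lemma sum_unity_roots_shift:
  assumes "r \<ge> 1" "c \<in> unity_roots r"
  shows "(\<Sum>x\<in>unity_roots r. f (x * c)) = (\<Sum>x\<in>unity_roots r. f x)"
proof (rule sum.reindex_bij_witness[where i = "\<lambda>x. x / c" and j = "\<lambda>x. x * c"])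
  have "c \<noteq> 0" using unity_roots_nonzero[OF assms] .
  then show "\<And>a. a \<in> unity_roots r \<Longrightarrow> a * c / c = a" "\<And>a. a \<in> unity_roots r \<Longrightarrow> a / c * c = a" by simp_all
  show "\<And>a. a \<in> unity_roots r \<Longrightarrow> a * c \<in> unity_roots r" "\<And>a. a \<in> unity_roots r \<Longrightarrow> a / c \<in> unity_roots r"
    using assms(2) by (simp_all add: unity_roots_def power_mult_distrib power_divide)
qed simp

lemma sum_unity_roots_inverse:
  "(\<Sum>x\<in>unity_roots r. f (inverse x)) = (\<Sum>x\<in>unity_roots r. f x)"
  by (rule sum.reindex_bij_witness[where i = inverse and j = inverse])
     (simp_all add: unity_roots_def power_inverse)

section \<open>Polynomials with coefficients in a representation\<close>

text \<open>The additive extension to finitely supported functions of a family of additive maps.\<close>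
definition ext :: "('k \<Rightarrow> 's::ab_group_add \<Rightarrow> 'v::ab_group_add) \<Rightarrow> ('k \<Rightarrow>\<^sub>0 's) \<Rightarrow> 'v" where
  "ext f P = (\<Sum>k\<in>keys P. f k (lookup P k))"

lemma ext_superset:
  assumes "finite A" "keys P \<subseteq> A" "\<And>k. f k 0 = 0"
  shows "ext f P = (\<Sum>k\<in>A. f k (lookup P k))"
  unfolding ext_def using assms
  by (intro sum.mono_neutral_left) (auto simp: in_keys_iff)

lemma ext_single:
  assumes "\<And>k. f k 0 = 0"
  shows "ext f (single k v) = f k v"
  by (subst ext_superset[of "{k}"]) (auto simp: assms)

lemma ext_add:
  assumes "\<And>k u v. f k (u + v) = f k u + f k v"
  shows "ext f (P + Q) = ext f P + ext f Q"
proof -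
  have z: "f k 0 = 0" for k using assms[of k 0 0] by simp
  let ?A = "keys P \<union> keys Q"
  have "ext f (P + Q) = (\<Sum>k\<in>?A. f k (lookup (P + Q) k))"
    by (rule ext_superset) (use z Poly_Mapping.keys_add[of P Q] in auto)
  also have "\<dots> = (\<Sum>k\<in>?A. f k (lookup P k)) + (\<Sum>k\<in>?A. f k (lookup Q k))"
    by (simp add: lookup_add assms sum.distrib)
  also have "\<dots> = ext f P + ext f Q"
    by (subst (1 2) ext_superset[of ?A]) (auto simp: z)
  finally show ?thesis .
qed

lemma poly_mapping_expand: "P = (\<Sum>k\<in>keys P. single k (lookup P k))"
  by (rule poly_mapping_eqI)
     (auto simp: lookup_sum lookup_single when_def in_keys_iff sum.delta')

lemma single_sum: "single k (sum f A) = (\<Sum>x\<in>A. single k (f x))"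
  by (induction A rule: infinite_finite_induct) (simp_all add: single_add)

locale cherednik_setup = field_hom emb
  for emb :: "complex \<Rightarrow> 'f::field" +
  fixes r n :: nat and kappa c0 :: 'f and d :: "nat \<Rightarrow> 'f"
  assumes r_pos: "r \<ge> 1"

text \<open>Any representation \<open>R\<close> of \<open>G(r, 1, n)\<close>: the Dunkl operators exist and commute on polynomials with
  coefficients in it. The group law is only assumed on the group, while linearity is assumed of every
  matrix, so that operators indexed by matrices are linear without side conditions.\<close>
locale W_rep = cherednik_setup emb r n kappa c0 d + vector_space scale
  for emb :: "complex \<Rightarrow> 'f::field" and r n :: nat and kappa c0 :: 'f and d :: "nat \<Rightarrow> 'f"
    and scale :: "'f \<Rightarrow> 's::ab_group_add \<Rightarrow> 's" +
  fixes R :: "complex mat \<Rightarrow> 's \<Rightarrow> 's"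
  assumes R_add: "R w (v + v') = R w v + R w v'"
    and R_scale: "R w (scale a v) = scale a (R w v)"
    and R_one: "R (1\<^sub>m n) v = v"
    and R_mult: "u \<in> carrier (G_r1n r n) \<Longrightarrow> w \<in> carrier (G_r1n r n) \<Longrightarrow> R (u * w) v = R u (R w v)"

type_synonym 's pol = "(nat \<Rightarrow> nat) \<Rightarrow>\<^sub>0 's"

context W_rep begin

lemma R_0 [simp]: "R w 0 = 0"
  using R_add[of w 0 0] by simp

definition scaleV :: "'f \<Rightarrow> 's pol \<Rightarrow> 's pol" where
  "scaleV a P = Poly_Mapping.map (scale a) P"

lemma lookup_scaleV [simp]: "lookup (scaleV a P) k = scale a (lookup P k)"
  by (simp add: scaleV_def map.rep_eq when_def)

lemma scaleV_single [simp]: "scaleV a (single k v) = single k (scale a v)"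
  by (rule poly_mapping_eqI) (simp add: lookup_single when_def)

sublocale V: vector_space scaleV
  by unfold_locales
    (auto intro!: poly_mapping_eqI simp: lookup_add scale_right_distrib scale_left_distrib)

definition linop :: "('s pol \<Rightarrow> 's pol) \<Rightarrow> bool" where
  "linop F \<longleftrightarrow> (\<forall>P Q. F (P + Q) = F P + F Q) \<and> (\<forall>a P. F (scaleV a P) = scaleV a (F P))"

lemma linop_addD: "linop F \<Longrightarrow> F (P + Q) = F P + F Q"
  and linop_scaleD: "linop F \<Longrightarrow> F (scaleV a P) = scaleV a (F P)"
  by (simp_all add: linop_def)

lemma linop_additive: "linop F \<Longrightarrow> Modules.additive F"
  by (simp add: linop_def Modules.additive_def)

lemmas linop_0 = Modules.additive.zero[OF linop_additive]
lemmas linop_diffD = Modules.additive.diff[OF linop_additive]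
lemmas linop_sumD = Modules.additive.sum[OF linop_additive]

lemma linop_id: "linop (\<lambda>P. P)"
  by (simp add: linop_def)

lemma linop_zero: "linop (\<lambda>P. 0)"
  by (simp add: linop_def)

lemma linop_compose: "linop F \<Longrightarrow> linop G \<Longrightarrow> linop (\<lambda>P. F (G P))"
  by (simp add: linop_def)

lemma linop_plus: "linop F \<Longrightarrow> linop G \<Longrightarrow> linop (\<lambda>P. F P + G P)"
  by (simp add: linop_def V.scale_right_distrib)

lemma linop_minus: "linop F \<Longrightarrow> linop G \<Longrightarrow> linop (\<lambda>P. F P - G P)"
  by (simp add: linop_def V.scale_right_diff_distrib)

lemma linop_scaleV: "linop F \<Longrightarrow> linop (\<lambda>P. scaleV a (F P))"
  by (simp add: linop_def V.scale_right_distrib mult.commute)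

lemma linop_sum: "(\<And>x. x \<in> A \<Longrightarrow> linop (F x)) \<Longrightarrow> linop (\<lambda>P. \<Sum>x\<in>A. F x P)"
  by (simp add: linop_def sum.distrib V.scale_sum_right)

text \<open>Linear operators are compared on the elements \<open>x\<^sup>m \<otimes> v\<close>; all operator identities below start here.\<close>
lemma linop_eqI:
  assumes "linop F" "linop G" "\<And>m v. F (single m v) = G (single m v)"
  shows "F P = G P"
proof -
  have "F P = (\<Sum>k\<in>keys P. F (single k (lookup P k)))"
    by (subst poly_mapping_expand[of P]) (rule linop_sumD[OF assms(1)])
  also have "\<dots> = (\<Sum>k\<in>keys P. G (single k (lookup P k)))"
    by (simp add: assms)
  also have "\<dots> = G P"
    by (subst (3) poly_mapping_expand[of P]) (rule linop_sumD[OF assms(2), symmetric])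
  finally show ?thesis .
qed

lemma linop_ext:
  assumes "\<And>k u v. f k (u + v) = f k u + f k v" "\<And>k a v. f k (scale a v) = scaleV a (f k v)"
  shows "linop (ext f)"
proof -
  have z: "f k 0 = 0" for k using assms(1)[of k 0 0] by simp
  have "ext f (scaleV a P) = scaleV a (ext f P)" for a P
  proof -
    have "keys (scaleV a P) \<subseteq> keys P" by (auto simp: in_keys_iff)
    then have "ext f (scaleV a P) = (\<Sum>k\<in>keys P. f k (lookup (scaleV a P) k))"
      by (intro ext_superset) (auto simp: z)
    then show ?thesis by (simp add: assms(2) V.scale_sum_right ext_def)
  qed
  then show ?thesis by (simp add: linop_def ext_add[OF assms(1)])
qed

section \<open>Dunkl operators\<close>

definition Xop :: "nat \<Rightarrow> 's pol \<Rightarrow> 's pol" where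
  "Xop k = ext (\<lambda>m v. single (m(k := m k + 1)) v)"

lemma X_single [simp]: "Xop k (single m v) = single (m(k := m k + 1)) v"
  by (simp add: Xop_def ext_single)

lemma linop_X': "linop (Xop k)"
  unfolding Xop_def by (rule linop_ext) (simp_all add: single_add)

definition Tw :: "(nat \<Rightarrow> nat) \<Rightarrow> (nat \<Rightarrow> complex) \<Rightarrow> 's pol \<Rightarrow> 's pol" where
  "Tw s c = ext (\<lambda>m v. single (m \<circ> pinv s)
     (scale (\<Prod>j\<in>{1..n}. inverse (emb (c j)) ^ m j) (R (mono_mat n s c) v)))"

lemma T_single: "Tw s c (single m v) = single (m \<circ> pinv s)
     (scale (\<Prod>j\<in>{1..n}. inverse (emb (c j)) ^ m j) (R (mono_mat n s c) v))"
  by (simp add: Tw_def ext_single)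

lemma linop_T': "linop (Tw s c)"
  unfolding Tw_def by (rule linop_ext)
    (simp_all add: single_add R_add R_scale scale_right_distrib mult.commute)

lemmas linop_X = linop_compose[OF linop_X']
lemmas linop_T = linop_compose[OF linop_T']

lemmas linop_intros = linop_id linop_zero linop_plus linop_minus linop_scaleV linop_sum linop_X linop_T
  linop_X' linop_T'

abbreviation Rf :: "nat \<Rightarrow> nat \<Rightarrow> complex \<Rightarrow> 's \<Rightarrow> 's" where
  "Rf i j x \<equiv> R (mono_mat n (transpose i j) (refl_fun i j x))"

abbreviation Rd :: "nat \<Rightarrow> complex \<Rightarrow> 's \<Rightarrow> 's" where
  "Rd i x \<equiv> R (mono_mat n id (diag_fun i x))"

abbreviation Tf :: "nat \<Rightarrow> nat \<Rightarrow> complex \<Rightarrow> 's pol \<Rightarrow> 's pol" where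
  "Tf i j x \<equiv> Tw (transpose i j) (refl_fun i j x)"

abbreviation Td :: "nat \<Rightarrow> complex \<Rightarrow> 's pol \<Rightarrow> 's pol" where
  "Td i x \<equiv> Tw id (diag_fun i x)"

text \<open>The coefficient at the diagonal matrix with entry \<open>x\<close> in \<open>\<Sum>\<^sub>j (d\<^sub>j - d\<^bsub>j-1\<^esub>) e\<^sub>i\<^sub>j\<close>.\<close>
definition dcoef :: "complex \<Rightarrow> 'f" where
  "dcoef x = emb (1 / of_nat r) *
     (\<Sum>j<r. (d_ext r d (int j) - d_ext r d (int j - 1)) * inverse (emb x) ^ j)"

definition nabla_term :: "nat \<Rightarrow> nat \<Rightarrow> complex \<Rightarrow> (nat \<Rightarrow> nat) \<Rightarrow> 's \<Rightarrow> nat \<Rightarrow> 's pol" where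
  "nabla_term i j x m u e = single (m(i := e, j := m i + m j - 1 - e))
     (scale (emb x powi (int (m i) - 1 - int e)) u)"

text \<open>The divided difference \<open>(x\<^sup>m - s x\<^sup>m) / (x\<^sub>i - \<xi> x\<^sub>j)\<close> tensored with \<open>u\<close>, for the reflection \<open>s\<close>
  in \<open>i\<close>, \<open>j\<close> with root of unity \<open>\<xi>\<close> (the argument \<open>x\<close>). It is a geometric sum, running over the exponents \<open>e\<close> of \<open>x\<^sub>i\<close> with
  \<open>m\<^sub>j \<le> e < m\<^sub>i\<close>, or with the opposite sign over \<open>m\<^sub>i \<le> e < m\<^sub>j\<close>. Written as a difference of two sums from
  0 it needs no case distinction, and multiplication by a variable shifts the summation.\<close>
definition nabla :: "nat \<Rightarrow> nat \<Rightarrow> complex \<Rightarrow> (nat \<Rightarrow> nat) \<Rightarrow> 's \<Rightarrow> 's pol" where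
  "nabla i j x m u = (\<Sum>e<m i. nabla_term i j x m u e) - (\<Sum>e<m j. nabla_term i j x m u e)"

text \<open>The Dunkl operator on a monomial: a derivative, a part that comes from the diagonal matrices, and the divided differences of all reflections. At \<open>m\<^sub>i = 0\<close> the first two parts vanish through
  their coefficients, so the truncated exponent is harmless.\<close>
definition Y_mono :: "nat \<Rightarrow> (nat \<Rightarrow> nat) \<Rightarrow> 's \<Rightarrow> 's pol" where
  "Y_mono i m v =
     single (m(i := m i - 1)) (scale (kappa * of_nat (m i)) v)
     - single (m(i := m i - 1))
         (\<Sum>x\<in>unity_roots r. scale (dcoef x * (\<Sum>p<m i. inverse (emb x) ^ p)) (Rd i x v))
     - scaleV c0 (\<Sum>j\<in>{1..n}-{i}. \<Sum>x\<in>unity_roots r. nabla i j x m (Rf i j x v))"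

definition Yop :: "nat \<Rightarrow> 's pol \<Rightarrow> 's pol" where
  "Yop i = ext (Y_mono i)"

lemma nabla_add: "nabla i j x m (u + v) = nabla i j x m u + nabla i j x m v"
  by (simp add: nabla_def nabla_term_def scale_right_distrib single_add sum.distrib)

lemma nabla_scale: "nabla i j x m (scale a v) = scaleV a (nabla i j x m v)"
  by (simp add: nabla_def nabla_term_def V.scale_sum_right V.scale_right_diff_distrib mult.commute)

lemma linop_Y': "linop (Yop i)"
  unfolding Yop_def
proof (rule linop_ext)
  show "Y_mono i m (u + v) = Y_mono i m u + Y_mono i m v" for m u v
    by (simp add: Y_mono_def R_add nabla_add scale_right_distrib V.scale_right_distrib single_add sum.distrib)
  show "Y_mono i m (scale a v) = scaleV a (Y_mono i m v)" for m a v
    by (simp add: Y_mono_def R_scale nabla_scale scale_sum_right V.scale_sum_right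
        V.scale_right_diff_distrib mult.commute mult.left_commute)
qed

lemmas linop_Y = linop_compose[OF linop_Y']
lemmas linop_intros2 = linop_intros linop_Y linop_Y'

lemma Y_single: "Yop i (single m v) = Y_mono i m v"
  unfolding Yop_def
  by (rule ext_single) (simp add: Y_mono_def nabla_def nabla_term_def)

lemma X_commute: "Xop i (Xop j P) = Xop j (Xop i P)"
  by (rule linop_eqI) (auto intro!: linop_intros simp: fun_upd_twist)

lemma T_cong:
  assumes "\<And>j. j \<in> {1..n} \<Longrightarrow> c j = e j"
  shows "Tw s c = Tw s e"
proof -
  have "mono_mat n s c = mono_mat n s e" using assms by (intro mono_mat_cong) auto
  moreover have "(\<Prod>j\<in>{1..n}. inverse (emb (c j)) ^ m j) = (\<Prod>j\<in>{1..n}. inverse (emb (e j)) ^ m j)" for m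
    using assms by (intro prod.cong) auto
  ultimately show ?thesis unfolding Tw_def by presburger
qed

lemma T_one: "Tw id (\<lambda>_. 1) P = P"
  by (rule linop_eqI) (auto intro!: linop_intros simp: T_single mono_mat_one[unfolded id_def] R_one comp_def)

lemma T_mult:
  assumes "adm r n s c" "adm r n t e"
  shows "Tw s c (Tw t e P) = Tw (s \<circ> t) (\<lambda>j. c (t j) * e j) P"
proof (rule linop_eqI[where F = "\<lambda>P. Tw s c (Tw t e P)"])
  fix m :: "nat \<Rightarrow> nat" and v :: 's
  have p: "s permutes {1..n}" "t permutes {1..n}" using assms by (auto simp: adm_def)
  have 1: "R (mono_mat n s c) (R (mono_mat n t e) v) = R (mono_mat n (s \<circ> t) (\<lambda>j. c (t j) * e j)) v"
    using R_mult[OF mono_mat_in_G[OF assms(1) r_pos] mono_mat_in_G[OF assms(2) r_pos]]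
    by (simp add: mono_mat_mult[OF p(2)])
  have 2: "m \<circ> pinv t \<circ> pinv s = m \<circ> pinv (s \<circ> t)"
    using o_inv_distrib[OF permutes_bij[OF p(1)] permutes_bij[OF p(2)]] by (simp add: comp_assoc)
  have "(\<Prod>j\<in>{1..n}. inverse (emb (c j)) ^ (m \<circ> pinv t) j)
      = (\<Prod>j\<in>{1..n}. inverse (emb (c (t j))) ^ m j)"
    by (subst prod.reindex_bij_betw[OF permutes_imp_bij[OF p(2)], symmetric])
       (simp add: permutes_inverses[OF p(2)])
  then have 3: "(\<Prod>j\<in>{1..n}. inverse (emb (c j)) ^ (m \<circ> pinv t) j) * (\<Prod>j\<in>{1..n}. inverse (emb (e j)) ^ m j)
      = (\<Prod>j\<in>{1..n}. inverse (emb (c (t j) * e j)) ^ m j)"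
    by (simp add: prod.distrib[symmetric] power_mult_distrib hom_mult)
  show "Tw s c (Tw t e (single m v))
      = Tw (s \<circ> t) (\<lambda>j. c (t j) * e j) (single m v)"
    unfolding T_single R_scale scale_scale 1 2[symmetric] 3[symmetric] by (simp add: mult.commute)
qed (intro linop_intros)+

lemma T_X:
  assumes "adm r n s c" "k \<in> {1..n}"
  shows "Tw s c (Xop k P) = scaleV (inverse (emb (c k))) (Xop (s k) (Tw s c P))"
proof (rule linop_eqI[where F = "\<lambda>P. Tw s c (Xop k P)"])
  fix m :: "nat \<Rightarrow> nat" and v :: 's
  have p: "s permutes {1..n}" using assms by (auto simp: adm_def)
  have 1: "m(k := m k + 1) \<circ> pinv s = (m \<circ> pinv s)(s k := (m \<circ> pinv s) (s k) + 1)"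
    using permutes_inverses[OF p] by (auto simp: fun_eq_iff)
  have "(\<Prod>j\<in>{1..n}. inverse (emb (c j)) ^ (m(k := m k + 1)) j)
     = (\<Prod>j\<in>{1..n}. inverse (emb (c j)) ^ m j * (if j = k then inverse (emb (c k)) else 1))"
    by (intro prod.cong) auto
  also have "\<dots> = (\<Prod>j\<in>{1..n}. inverse (emb (c j)) ^ m j) * inverse (emb (c k))"
    using assms(2) by (simp add: prod.distrib)
  finally show "Tw s c (Xop k (single m v))
      = scaleV (inverse (emb (c k))) (Xop (s k) (Tw s c (single m v)))"
    unfolding X_single T_single 1 scaleV_single scale_scale by (simp add: mult.commute)
qed (intro linop_intros)+

lemma Tf_single:
  assumes "i \<in> {1..n}" "j \<in> {1..n}" "i \<noteq> j" "x \<in> unity_roots r"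
  shows "Tf i j x (single m v) = single (m(i := m j, j := m i))
     (scale (emb x powi (int (m i) - int (m j))) (Rf i j x v))"
proof -
  have x: "emb x \<noteq> 0" using unity_roots_nonzero[OF r_pos assms(4)] by simp
  have 1: "m \<circ> pinv (transpose i j) = m(i := m j, j := m i)"
    using assms(3) by (auto simp: fun_eq_iff transpose_def)
  have "(\<Prod>k\<in>{1..n}. inverse (emb (refl_fun i j x k)) ^ m k)
     = (\<Prod>k\<in>{1..n}. (if k = i then emb x ^ m i else 1) * (if k = j then inverse (emb x) ^ m j else 1))"
    using assms(3) by (intro prod.cong) (auto simp: refl_fun_def hom_inverse)
  also have "\<dots> = emb x ^ m i * inverse (emb x) ^ m j"
    using assms by (simp add: prod.distrib)
  also have "\<dots> = emb x powi (int (m i) - int (m j))"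
    using x by (simp add: power_int_diff power_inverse divide_inverse)
  finally show ?thesis unfolding T_single 1 by simp
qed

lemma Td_single:
  assumes "i \<in> {1..n}"
  shows "Td i x (single m v) = single m (scale (inverse (emb x) ^ m i) (Rd i x v))"
proof -
  have "(\<Prod>k\<in>{1..n}. inverse (emb (diag_fun i x k)) ^ m k)
     = (\<Prod>k\<in>{1..n}. (if k = i then inverse (emb x) ^ m i else 1))"
    by (intro prod.cong) (auto simp: diag_fun_def)
  then show ?thesis unfolding T_single using assms by simp
qed

text \<open>Its sum over \<open>j < i\<close> is the element \<open>\<phi>\<^sub>i\<close>.\<close>
definition psi :: "nat \<Rightarrow> nat \<Rightarrow> 's pol \<Rightarrow> 's pol" where
  "psi i j P = (\<Sum>x\<in>unity_roots r. Tf i j x P)"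

definition Dop :: "nat \<Rightarrow> 's pol \<Rightarrow> 's pol" where
  "Dop i P = (\<Sum>x\<in>unity_roots r. scaleV (dcoef x) (Td i x P))"

text \<open>The element of the group algebra that the defining relations prescribe for \<open>y\<^sub>i x\<^sub>k - x\<^sub>k y\<^sub>i\<close>.\<close>
definition Comm :: "nat \<Rightarrow> nat \<Rightarrow> 's pol \<Rightarrow> 's pol" where
  "Comm i k P = (if i = k then scaleV kappa P - Dop i P - scaleV c0 (\<Sum>j\<in>{1..n}-{i}. psi i j P)
     else scaleV c0 (\<Sum>x\<in>unity_roots r. scaleV (inverse (emb x)) (Tf i k x P)))"

lemma linop_psi': "linop (psi i j)"
  unfolding psi_def by (intro linop_intros)

lemma linop_Dop': "linop (Dop i)"
  unfolding Dop_def by (intro linop_intros)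

lemma linop_Comm': "linop (Comm i k)"
  unfolding Comm_def
  by (cases "i = k") (auto intro!: linop_intros linop_Dop' linop_psi')

lemmas linop_intros3 = linop_intros2 linop_psi' linop_compose[OF linop_psi'] linop_Dop'
  linop_compose[OF linop_Dop'] linop_Comm' linop_compose[OF linop_Comm']

text \<open>Twisted Leibniz rule: \<open>(x\<^sub>i f - s (x\<^sub>i f)) / (x\<^sub>i - \<xi> x\<^sub>j)\<close> exceeds \<open>x\<^sub>i\<close> times the divided difference of
  \<open>f\<close> by \<open>s f\<close>. In terms of geometric sums, shifting both sums by one leaves a single boundary term.\<close>
lemma nabla_X_same:
  assumes "i \<noteq> j"
  shows "nabla i j x (m(i := m i + 1)) u
    = Xop i (nabla i j x m u) + single (m(i := m j, j := m i))
        (scale (emb x powi (int (m i) - int (m j))) u)"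
proof -
  define G where "G e = single (m(i := e, j := m i + m j - e))
     (scale (emb x powi (int (m i) - int e)) u)" for e
  have 1: "nabla_term i j x (m(i := m i + 1)) u e = G e" for e
    using assms by (simp add: nabla_term_def G_def fun_upd_twist)
  have 2: "Xop i (nabla_term i j x m u e) = G (Suc e)" for e
    using assms by (simp add: nabla_term_def G_def fun_upd_twist algebra_simps)
  have 3: "G (m j) = single (m(i := m j, j := m i))
        (scale (emb x powi (int (m i) - int (m j))) u)"
    by (simp add: G_def)
  have "nabla_term i j x (m(i := m i + 1)) u = G" using 1 by blast
  then have "nabla i j x (m(i := m i + 1)) u = sum G {..<Suc (m i)} - sum G {..<m j}"
    using assms by (simp add: nabla_def)
  then have "nabla i j x (m(i := m i + 1)) u = G 0 + (\<Sum>e<m i. G (Suc e)) - sum G {..<m j}"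
    by (simp only: sum.lessThan_Suc_shift)
  moreover have "Xop i (nabla i j x m u) = (\<Sum>e<m i. G (Suc e)) - (\<Sum>e<m j. G (Suc e))"
    by (simp add: nabla_def linop_diffD[OF linop_X'] linop_sumD[OF linop_X'] 2)
  moreover have "G 0 + (\<Sum>e<m j. G (Suc e)) = sum G {..<m j} + G (m j)"
    by (simp only: sum.lessThan_Suc_shift[symmetric] sum.lessThan_Suc)
  then have "G (m j) = G 0 + (\<Sum>e<m j. G (Suc e)) - sum G {..<m j}"
    by (metis add_diff_cancel_left')
  ultimately show ?thesis unfolding 3[symmetric] by simp
qed

text \<open>Twisted Leibniz rule for \<open>x\<^sub>j\<close>, whose own divided difference is \<open>- \<xi>\<^sup>-\<^sup>1\<close>.\<close>
lemma nabla_X_other: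
  assumes "i \<noteq> j" "x \<in> unity_roots r"
  shows "nabla i j x (m(j := m j + 1)) u
    = Xop j (nabla i j x m u) - single (m(i := m j, j := m i))
        (scale (inverse (emb x) * emb x powi (int (m i) - int (m j))) u)"
proof -
  have x: "emb x \<noteq> 0" using unity_roots_nonzero[OF r_pos assms(2)] by simp
  define G where "G e = single (m(i := e, j := m i + m j - e))
     (scale (emb x powi (int (m i) - 1 - int e)) u)" for e
  have 1: "nabla_term i j x (m(j := m j + 1)) u e = G e" for e
    using assms by (simp add: nabla_term_def G_def fun_upd_twist)
  have 2: "Xop j (nabla_term i j x m u e) = G e" if "e < m i \<or> e < m j" for e
  proof -
    have "m i + m j - 1 - e + 1 = m i + m j - e" using that by linarith
    then show ?thesis using assms by (simp add: nabla_term_def G_def)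
  qed
  have "int (m i) - 1 - int (m j) = (int (m i) - int (m j)) - 1" by simp
  then have 3: "G (m j) = single (m(i := m j, j := m i))
        (scale (inverse (emb x) * emb x powi (int (m i) - int (m j))) u)"
    using x by (simp add: G_def power_int_diff divide_inverse mult_ac)
  have "nabla_term i j x (m(j := m j + 1)) u = G" using 1 by blast
  then have "nabla i j x (m(j := m j + 1)) u = sum G {..<m i} - sum G {..<Suc (m j)}"
    using assms by (simp add: nabla_def)
  moreover have "Xop j (nabla i j x m u) = sum G {..<m i} - sum G {..<m j}"
    by (simp add: nabla_def linop_diffD[OF linop_X'] linop_sumD[OF linop_X'] 2)
  ultimately show ?thesis unfolding 3[symmetric] by simp
qed

lemma nabla_X_distinct:
  assumes "k \<noteq> i" "k \<noteq> j"
  shows "nabla i j x (m(k := m k + 1)) u = Xop k (nabla i j x m u)"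
proof -
  have 2: "Xop k (nabla_term i j x m u e) = nabla_term i j x (m(k := m k + 1)) u e" for e
    using assms by (simp add: nabla_term_def fun_upd_twist)
  show ?thesis
    using assms by (simp add: nabla_def linop_diffD[OF linop_X'] linop_sumD[OF linop_X'] 2)
qed

text \<open>The two relations between \<open>y\<close> and \<open>x\<close>. Each of the three parts of the Dunkl operator
  contributes one summand of the commutator.\<close>
lemma Y_X:
  assumes "i \<in> {1..n}" "k \<in> {1..n}"
  shows "Yop i (Xop k P) = Xop k (Yop i P) + Comm i k P"
proof (rule linop_eqI[where F = "\<lambda>P. Yop i (Xop k P)"])
  fix m :: "nat \<Rightarrow> nat" and v :: 's
  let ?s = "single m v"
  let ?m = "m(k := m k + 1)"
  let ?x = "unity_roots r"
  let ?N = "\<lambda>j m. \<Sum>x\<in>?x. nabla i j x m (Rf i j x v)"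
  let ?D = "\<lambda>q. \<Sum>x\<in>?x. scale (dcoef x * (\<Sum>p<q. inverse (emb x) ^ p)) (Rd i x v)"
  have L: "Yop i (Xop k ?s) = single (?m(i := ?m i - 1)) (scale (kappa * of_nat (?m i)) v)
     - single (?m(i := ?m i - 1)) (?D (?m i))
     - scaleV c0 (\<Sum>j\<in>{1..n}-{i}. ?N j ?m)"
    by (simp only: X_single Y_single Y_mono_def)
  have Rt: "Xop k (Yop i ?s) = Xop k (single (m(i := m i - 1)) (scale (kappa * of_nat (m i)) v))
     - Xop k (single (m(i := m i - 1)) (?D (m i)))
     - scaleV c0 (\<Sum>j\<in>{1..n}-{i}. Xop k (?N j m))"
    by (simp only: Y_single Y_mono_def linop_diffD[OF linop_X'] linop_scaleD[OF linop_X'] linop_sumD[OF linop_X'])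
  show "Yop i (Xop k ?s) = Xop k (Yop i ?s) + Comm i k ?s"
  proof (cases "i = k")
    case True
    have mm: "?m(i := ?m i - 1) = m" "?m i = Suc (m k)" "m(i := m i - 1) = m(k := m k - 1)" "m i = m k"
      using True by auto
    have key: "Xop k (single (m(k := m k - 1)) w) = single m w"
      if "m k = 0 \<Longrightarrow> w = 0" for w
    proof (cases "m k = 0")
      case False
      then have "m(k := m k - 1, k := (m(k := m k - 1)) k + 1) = m" by (auto simp: fun_eq_iff)
      then show ?thesis by (simp only: X_single)
    qed (simp add: that linop_0[OF linop_X'])
    have k0: "single (?m(i := ?m i - 1)) (scale (kappa * of_nat (?m i)) v)
      = Xop k (single (m(i := m i - 1)) (scale (kappa * of_nat (m i)) v)) + scaleV kappa ?s"
    proof -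
      have "scale (kappa * of_nat (Suc (m k))) v = scale (kappa * of_nat (m k)) v + scale kappa v"
        unfolding scale_left_distrib[symmetric] by (simp add: distrib_left add.commute)
      then show ?thesis unfolding mm(1) unfolding mm(3) unfolding mm(2,4) by (subst key) (simp_all add: single_add)
    qed
    have d0: "single (?m(i := ?m i - 1)) (?D (?m i))
      = Xop k (single (m(i := m i - 1)) (?D (m i))) + Dop i ?s"
    proof -
      have 1: "Dop i ?s = single m (\<Sum>x\<in>?x. scale (dcoef x * inverse (emb x) ^ m k) (Rd i x v))"
        unfolding Dop_def Td_single[OF assms(1)] mm
        by (simp add: single_sum)
      have 2: "?D (Suc (m k)) = ?D (m k) + (\<Sum>x\<in>?x. scale (dcoef x * inverse (emb x) ^ m k) (Rd i x v))"
        unfolding sum.distrib[symmetric] scale_left_distrib[symmetric] by (simp add: distrib_left)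
      show ?thesis
        unfolding mm(1) unfolding mm(3) unfolding mm(2,4) 1 2 by (subst key) (simp_all add: single_add)
    qed
    have n0: "?N j ?m = Xop k (?N j m) + psi i j ?s" if "j \<in> {1..n} - {i}" for j
    proof -
      have j: "j \<in> {1..n}" "i \<noteq> j" using that by auto
      have "?N j ?m = (\<Sum>x\<in>?x. Xop k (nabla i j x m (Rf i j x v)) + Tf i j x ?s)"
        using nabla_X_same[OF j(2)] Tf_single[OF assms(1) j] True by (intro sum.cong) auto
      then show ?thesis by (simp add: sum.distrib psi_def linop_sumD[OF linop_X'])
    qed
    have "(\<Sum>j\<in>{1..n}-{i}. ?N j ?m) = (\<Sum>j\<in>{1..n}-{i}. Xop k (?N j m)) + (\<Sum>j\<in>{1..n}-{i}. psi i j ?s)"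
      unfolding sum.distrib[symmetric] using n0 by (intro sum.cong) auto
    then show ?thesis
      unfolding L Rt k0 d0 Comm_def using True by (simp add: V.scale_right_distrib algebra_simps del: X_single scaleV_single)
  next
    case False
    have mm: "?m i = m i" "\<And>a. ?m(i := a) = (m(i := a))(k := (m(i := a)) k + 1)"
      using False by (auto simp: fun_upd_twist)
    have n1: "?N j ?m = Xop k (?N j m)" if "j \<noteq> k" for j
      using nabla_X_distinct[of k i j] that False by (simp add: linop_sumD[OF linop_X'])
    have n2: "?N k ?m = Xop k (?N k m) - (\<Sum>x\<in>?x. scaleV (inverse (emb x)) (Tf i k x ?s))"
    proof -
      have "?N k ?m = (\<Sum>x\<in>?x. Xop k (nabla i k x m (Rf i k x v)) - scaleV (inverse (emb x)) (Tf i k x ?s))"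
        using nabla_X_other[OF False] Tf_single[OF assms False] by (intro sum.cong) auto
      then show ?thesis by (simp add: sum_subtractf linop_sumD[OF linop_X'])
    qed
    have "(\<Sum>j\<in>{1..n}-{i}. ?N j ?m) = ?N k ?m + (\<Sum>j\<in>{1..n}-{i}-{k}. ?N j ?m)"
      using assms False by (intro sum.remove) auto
    also have "(\<Sum>j\<in>{1..n}-{i}-{k}. ?N j ?m) = (\<Sum>j\<in>{1..n}-{i}-{k}. Xop k (?N j m))"
      using n1 by (intro sum.cong) auto
    also have "?N k ?m + (\<Sum>j\<in>{1..n}-{i}-{k}. Xop k (?N j m))
        = (Xop k (?N k m) + (\<Sum>j\<in>{1..n}-{i}-{k}. Xop k (?N j m)))
          - (\<Sum>x\<in>?x. scaleV (inverse (emb x)) (Tf i k x ?s))"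
      unfolding n2 by simp
    also have "Xop k (?N k m) + (\<Sum>j\<in>{1..n}-{i}-{k}. Xop k (?N j m)) = (\<Sum>j\<in>{1..n}-{i}. Xop k (?N j m))"
      using assms False by (intro sum.remove[symmetric]) auto
    finally have n: "(\<Sum>j\<in>{1..n}-{i}. ?N j ?m) = (\<Sum>j\<in>{1..n}-{i}. Xop k (?N j m))
          - (\<Sum>x\<in>?x. scaleV (inverse (emb x)) (Tf i k x ?s))" .
    show ?thesis
      unfolding L Rt n unfolding Comm_def mm X_single using False
      by (simp add: V.scale_right_diff_distrib algebra_simps del: scaleV_single)
  qed
qed (intro linop_intros3)+

end

section \<open>Equivariance and commutativity of the Dunkl operators\<close>

lemma comp_transpose_perm:
  assumes "s permutes {1..n}"
  shows "s \<circ> transpose j k = transpose (s j) (s k) \<circ> s"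
proof
  fix m
  have "s m = s j \<longleftrightarrow> m = j" "s m = s k \<longleftrightarrow> m = k" using permutes_inj[OF assms] by (auto dest: injD)
  then show "(s \<circ> transpose j k) m = (transpose (s j) (s k) \<circ> s) m"
    by (auto simp: transpose_def)
qed

lemma adm_root: "adm r n s c \<Longrightarrow> j \<in> {1..n} \<Longrightarrow> c j \<in> unity_roots r"
  by (simp add: adm_def unity_roots_def)

lemma root_divide: "a \<in> unity_roots r \<Longrightarrow> b \<in> unity_roots r \<Longrightarrow> a / b \<in> unity_roots r"
  by (simp add: unity_roots_def power_divide)

lemma root_mult: "a \<in> unity_roots r \<Longrightarrow> b \<in> unity_roots r \<Longrightarrow> a * b \<in> unity_roots r"
  by (simp add: unity_roots_def power_mult_distrib)

lemma root_inverse: "a \<in> unity_roots r \<Longrightarrow> inverse a \<in> unity_roots r"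
  by (simp add: unity_roots_def power_inverse)

context W_rep begin

lemma adm_refl': "i \<in> {1..n} \<Longrightarrow> j \<in> {1..n} \<Longrightarrow> x \<in> unity_roots r \<Longrightarrow> adm r n (transpose i j) (refl_fun i j x)"
  by (rule adm_refl) (simp_all add: unity_roots_def)

lemma adm_diag': "x \<in> unity_roots r \<Longrightarrow> adm r n id (diag_fun i x)"
  by (rule adm_diag) (simp_all add: unity_roots_def)

lemma perm_in: "adm r n s c \<Longrightarrow> s j \<in> {1..n} \<longleftrightarrow> j \<in> {1..n}"
  using permutes_in_image[of s "{1..n}"] by (simp add: adm_def)

lemma perm_eq: "adm r n s c \<Longrightarrow> s j = s k \<longleftrightarrow> j = k"
  using permutes_inj[of s "{1..n}"] by (auto simp: adm_def dest: injD)

lemma Tf_swap: "i \<noteq> j \<Longrightarrow> Tf i j x = Tf j i (inverse x)"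
proof -
  assume "i \<noteq> j"
  then have "refl_fun i j x = refl_fun j i (inverse x)" by (auto simp: refl_fun_def)
  then show ?thesis by (simp add: transpose_commute)
qed

lemma psi_swap: "i \<noteq> j \<Longrightarrow> psi i j P = psi j i P"
  unfolding psi_def using sum_unity_roots_inverse[where f = "\<lambda>x. Tf j i x P" and r = r]
  by (simp add: Tf_swap[of i j])

text \<open>Conjugating the reflection in \<open>j\<close>, \<open>k\<close> by a monomial matrix gives the reflection in the images of
  \<open>j\<close>, \<open>k\<close>, with the root of unity rescaled.\<close>
lemma T_Tf:
  assumes "adm r n s c" "j \<in> {1..n}" "k \<in> {1..n}" "j \<noteq> k" "x \<in> unity_roots r"
  shows "Tw s c (Tf j k x P) = Tf (s j) (s k) (x * (c j / c k)) (Tw s c P)"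
proof -
  have p: "s permutes {1..n}" using assms(1) by (simp add: adm_def)
  have sj: "s j \<in> {1..n}" "s k \<in> {1..n}" "s j \<noteq> s k"
    using assms perm_in[OF assms(1)] perm_eq[OF assms(1)] by simp_all
  have x': "x * (c j / c k) \<in> unity_roots r"
    using assms adm_root[OF assms(1)] by (intro root_mult root_divide) auto
  have nz: "c j \<noteq> 0" "c k \<noteq> 0" "x \<noteq> 0"
    using assms adm_nonzero[OF assms(1) r_pos] unity_roots_nonzero[OF r_pos] by auto
  have eq: "c (transpose j k m) * refl_fun j k x m = refl_fun (s j) (s k) (x * (c j / c k)) (s m) * c m" for m
    using assms(4) nz perm_eq[OF assms(1)] by (auto simp: refl_fun_def transpose_def field_simps)
  show ?thesis
    unfolding T_mult[OF assms(1) adm_refl'[OF assms(2,3,5)]] T_mult[OF adm_refl'[OF sj(1,2) x'] assms(1)]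
      comp_transpose_perm[OF p] eq ..
qed

lemma T_Td:
  assumes "adm r n s c" "x \<in> unity_roots r"
  shows "Tw s c (Td i x P) = Td (s i) x (Tw s c P)"
proof -
  have eq: "c (id m) * diag_fun i x m = diag_fun (s i) x (s m) * c m" for m
    using perm_eq[OF assms(1)] by (auto simp: diag_fun_def)
  show ?thesis
    unfolding T_mult[OF assms(1) adm_diag'[OF assms(2)]] T_mult[OF adm_diag'[OF assms(2)] assms(1)] eq
    by simp
qed

lemma T_psi:
  assumes "adm r n s c" "j \<in> {1..n}" "k \<in> {1..n}" "j \<noteq> k"
  shows "Tw s c (psi j k P) = psi (s j) (s k) (Tw s c P)"
proof -
  have "Tw s c (psi j k P) = (\<Sum>x\<in>unity_roots r. Tf (s j) (s k) (x * (c j / c k)) (Tw s c P))"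
    unfolding psi_def linop_sumD[OF linop_T'] using T_Tf[OF assms] by (intro sum.cong) auto
  also have "\<dots> = psi (s j) (s k) (Tw s c P)"
    unfolding psi_def
    by (rule sum_unity_roots_shift[OF r_pos, where f = "\<lambda>x. Tf (s j) (s k) x (Tw s c P)"])
       (rule root_divide[OF adm_root[OF assms(1,2)] adm_root[OF assms(1,3)]])
  finally show ?thesis .
qed

lemma T_Dop:
  assumes "adm r n s c"
  shows "Tw s c (Dop i P) = Dop (s i) (Tw s c P)"
  unfolding Dop_def linop_sumD[OF linop_T'] linop_scaleD[OF linop_T']
  using T_Td[OF assms] by (intro sum.cong) auto

lemma T_sum_psi:
  assumes "adm r n s c" "j \<in> {1..n}"
  shows "Tw s c (\<Sum>k\<in>{1..n}-{j}. psi j k P) = (\<Sum>k\<in>{1..n}-{s j}. psi (s j) k (Tw s c P))"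
proof -
  have p: "s permutes {1..n}" using assms(1) by (simp add: adm_def)
  have "Tw s c (\<Sum>k\<in>{1..n}-{j}. psi j k P) = (\<Sum>k\<in>{1..n}-{j}. psi (s j) (s k) (Tw s c P))"
    unfolding linop_sumD[OF linop_T'] using T_psi[OF assms(1)] assms(2) by (intro sum.cong) auto
  also have "\<dots> = (\<Sum>k\<in>{1..n}-{s j}. psi (s j) k (Tw s c P))"
  proof (rule sum.reindex_bij_betw)
    have "bij_betw s ({1..n} - {j}) (s ` ({1..n} - {j}))"
      using permutes_inj_on[OF p] by (auto simp: bij_betw_def)
    moreover have "s ` ({1..n} - {j}) = {1..n} - {s j}"
      using permutes_image[OF p] perm_eq[OF assms(1)] by auto
    ultimately show "bij_betw s ({1..n} - {j}) ({1..n} - {s j})" by simp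
  qed
  finally show ?thesis .
qed

text \<open>The commutators transform like \<open>y\<^sub>j \<otimes> x\<^sub>k\<close>. This is what allows the induction on the degree
  in \<open>T_Y\<close>.\<close>
lemma T_Comm:
  assumes "adm r n s c" "j \<in> {1..n}" "k \<in> {1..n}"
  shows "Tw s c (Comm j k P) = scaleV (emb (c j / c k)) (Comm (s j) (s k) (Tw s c P))"
proof (cases "j = k")
  case True
  have "c k \<noteq> 0" using adm_nonzero[OF assms(1) r_pos assms(3)] .
  then show ?thesis
    using True unfolding Comm_def
    by (simp add: linop_diffD[OF linop_T'] linop_scaleD[OF linop_T'] T_Dop[OF assms(1)]
        T_sum_psi[OF assms(1,3)] del: One_nat_def)
next
  case False
  let ?q = "c j / c k"
  have q: "?q \<in> unity_roots r" using assms by (intro root_divide adm_root) auto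
  have q0: "?q \<noteq> 0" using unity_roots_nonzero[OF r_pos q] .
  have "Tw s c (\<Sum>x\<in>unity_roots r. scaleV (inverse (emb x)) (Tf j k x P))
      = (\<Sum>x\<in>unity_roots r. scaleV (emb ?q) (scaleV (inverse (emb (x * ?q))) (Tf (s j) (s k) (x * ?q) (Tw s c P))))"
    unfolding linop_sumD[OF linop_T'] linop_scaleD[OF linop_T']
  proof (intro sum.cong refl)
    fix x assume x: "x \<in> unity_roots r"
    have "inverse (emb x) = emb ?q * inverse (emb (x * ?q))"
      unfolding hom_inverse[symmetric] hom_mult[symmetric]
      using q0 by (simp add: field_simps)
    then show "scaleV (inverse (emb x)) (Tw s c (Tf j k x P))
       = scaleV (emb ?q) (scaleV (inverse (emb (x * ?q))) (Tf (s j) (s k) (x * ?q) (Tw s c P)))"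
      by (simp only: T_Tf[OF assms False x] V.scale_scale)
  qed
  also have "\<dots> = (\<Sum>x\<in>unity_roots r. scaleV (emb ?q) (scaleV (inverse (emb x)) (Tf (s j) (s k) x (Tw s c P))))"
    by (rule sum_unity_roots_shift[OF r_pos q, where f = "\<lambda>x. scaleV (emb ?q) (scaleV (inverse (emb x)) (Tf (s j) (s k) x (Tw s c P)))"])
  finally have F: "Tw s c (\<Sum>x\<in>unity_roots r. scaleV (inverse (emb x)) (Tf j k x P))
      = scaleV (emb ?q) (\<Sum>x\<in>unity_roots r. scaleV (inverse (emb x)) (Tf (s j) (s k) x (Tw s c P)))"
    by (simp only: V.scale_sum_right)
  have "s j \<noteq> s k" using False perm_eq[OF assms(1)] by simp
  then show ?thesis
    using False by (simp only: Comm_def if_False linop_scaleD[OF linop_T'] F V.scale_left_commute)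
qed

text \<open>Every \<open>x\<^sup>m \<otimes> v\<close> is reached from degree 0 by multiplying with variables.\<close>
lemma degree_induct:
  assumes F: "linop F"
    and base: "\<And>m v. (\<And>k. k \<in> {1..n} \<Longrightarrow> m k = 0) \<Longrightarrow> F (single m v) = 0"
    and step: "\<And>k P. k \<in> {1..n} \<Longrightarrow> F P = 0 \<Longrightarrow> F (Xop k P) = 0"
  shows "F P = 0"
proof (rule linop_eqI[OF F linop_zero])
  fix m and v :: 's
  show "F (single m v) = 0"
  proof (induction "\<Sum>k\<in>{1..n}. m k" arbitrary: m)
    case 0
    then show ?case by (intro base) auto
  next
    case (Suc q)
    then obtain k where k: "k \<in> {1..n}" "m k \<noteq> 0"
      by (metis sum.neutral nat.distinct(1))
    let ?m = "m(k := m k - 1)"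
    have m: "?m(k := ?m k + 1) = m" using k by (auto simp: fun_eq_iff)
    have "(\<Sum>k\<in>{1..n}. m k) = m k + (\<Sum>k\<in>{1..n}-{k}. m k)"
      using k by (intro sum.remove) auto
    moreover have "(\<Sum>k\<in>{1..n}. ?m k) = ?m k + (\<Sum>j\<in>{1..n}-{k}. ?m j)"
      using k by (intro sum.remove) auto
    moreover have "(\<Sum>j\<in>{1..n}-{k}. ?m j) = (\<Sum>k\<in>{1..n}-{k}. m k)"
      by (intro sum.cong) auto
    ultimately have "q = (\<Sum>k\<in>{1..n}. ?m k)" using Suc(2) k by simp
    from Suc(1)[OF this] have "F (Xop k (single ?m v)) = 0" by (rule step[OF k(1)])
    then show ?case by (simp only: X_single m)
  qed
qed

lemma Y_base:
  assumes "\<And>k. k \<in> {1..n} \<Longrightarrow> m k = 0" "i \<in> {1..n}"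
  shows "Yop i (single m v) = 0"
  unfolding Y_single Y_mono_def using assms by (simp add: nabla_def)

lemma T_Y:
  assumes "adm r n s c" "j \<in> {1..n}"
  shows "Tw s c (Yop j P) = scaleV (emb (c j)) (Yop (s j) (Tw s c P))"
proof -
  have p: "s permutes {1..n}" using assms(1) by (simp add: adm_def)
  have sj: "s j \<in> {1..n}" using assms perm_in by blast
  define F where "F = (\<lambda>P. Tw s c (Yop j P) - scaleV (emb (c j)) (Yop (s j) (Tw s c P)))"
  have "F P = 0"
  proof (rule degree_induct[where F = F])
    show "linop F" unfolding F_def by (intro linop_intros3)
  next
    fix m and v :: 's assume m: "\<And>k. k \<in> {1..n} \<Longrightarrow> m k = (0::nat)"
    have "(m \<circ> pinv s) k = 0" if "k \<in> {1..n}" for k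
      using m permutes_in_image[OF permutes_inv[OF p]] that by simp
    then show "F (single m v) = 0"
      unfolding F_def T_single using Y_base[of "m \<circ> pinv s"] Y_base[of m] m sj assms(2)
      by (simp add: linop_0[OF linop_T'])
  next
    fix k P assume k: "k \<in> {1..n}" and 0: "F P = 0"
    then have IH: "Tw s c (Yop j P) = scaleV (emb (c j)) (Yop (s j) (Tw s c P))" by (simp add: F_def)
    have sk: "s k \<in> {1..n}" using k perm_in[OF assms(1)] by blast
    have "Tw s c (Yop j (Xop k P)) = Tw s c (Xop k (Yop j P)) + Tw s c (Comm j k P)"
      by (simp add: Y_X[OF assms(2) k] linop_addD[OF linop_T'])
    also have "\<dots> = scaleV (emb (c j) * inverse (emb (c k))) (Xop (s k) (Yop (s j) (Tw s c P)) + Comm (s j) (s k) (Tw s c P))"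
      by (simp add: T_X[OF assms(1) k] IH linop_scaleD[OF linop_X'] T_Comm[OF assms k] V.scale_right_distrib
          hom_div divide_inverse mult.commute hom_mult hom_inverse)
    also have "\<dots> = scaleV (emb (c j)) (Yop (s j) (Tw s c (Xop k P)))"
      by (simp add: T_X[OF assms(1) k] linop_scaleD[OF linop_Y'] Y_X[OF sj sk])
    finally show "F (Xop k P) = 0" by (simp add: F_def)
  qed
  then show ?thesis by (simp add: F_def)
qed

lemma Tf_Y:
  assumes "a \<in> {1..n}" "b \<in> {1..n}" "a \<noteq> b" "x \<in> unity_roots r" "j \<in> {1..n}"
  shows "j \<noteq> a \<Longrightarrow> j \<noteq> b \<Longrightarrow> Tf a b x (Yop j P) = Yop j (Tf a b x P)"
    and "Tf a b x (Yop b P) = scaleV (emb x) (Yop a (Tf a b x P))"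
    and "Tf a b x (Yop a P) = scaleV (inverse (emb x)) (Yop b (Tf a b x P))"
  using T_Y[OF adm_refl'[OF assms(1,2,4)]] assms
  by (simp_all add: refl_fun_def hom_inverse)

lemma Td_Y:
  assumes "x \<in> unity_roots r" "i \<noteq> j" "j \<in> {1..n}"
  shows "Td i x (Yop j P) = Yop j (Td i x P)"
  using T_Y[OF adm_diag'[OF assms(1)] assms(3), of i P] assms(2) by (simp add: diag_fun_def)

text \<open>The two contributions to the commutator of \<open>y\<^sub>i y\<^sub>j - y\<^sub>j y\<^sub>i\<close> with \<open>x\<^sub>k\<close> cancel: if \<open>k\<close>
  differs from both, nothing moves; if \<open>k = j\<close>, only the reflections in \<open>i\<close> and \<open>j\<close> contribute, and both
  sides are the same sum over roots of unity up to \<open>x \<mapsto> x\<^sup>-\<^sup>1\<close>.\<close>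
lemma Comm_Y:
  assumes i: "i \<in> {1..n}" and j: "j \<in> {1..n}" and k: "k \<in> {1..n}" and ij: "i \<noteq> j"
  shows "Comm i k (Yop j P) - Yop j (Comm i k P) = Comm j k (Yop i P) - Yop i (Comm j k P)"
proof -
  have neither: "Comm i k (Yop j P) = Yop j (Comm i k P)"
    if "i \<in> {1..n}" "j \<in> {1..n}" "i \<noteq> j" "k \<noteq> i" "k \<noteq> j" for i j
    using that k Tf_Y(1)[of i k _ j]
    by (simp add: Comm_def linop_scaleD[OF linop_Y'] linop_sumD[OF linop_Y'])
  have one: "Comm i j (Yop j P) - Yop j (Comm i j P) = Comm j j (Yop i P) - Yop i (Comm j j P)"
    if i: "i \<in> {1..n}" and j: "j \<in> {1..n}" and ij: "i \<noteq> j" for i j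
  proof -
    let ?U = "unity_roots r"
    define E where "E x = Yop i (Tf i j x P) - scaleV (inverse (emb x)) (Yop j (Tf i j x P))" for x
    have xne: "emb x \<noteq> 0" if "x \<in> ?U" for x using unity_roots_nonzero[OF r_pos that] by simp
    have "Comm i j (Yop j P) - Yop j (Comm i j P)
       = scaleV c0 (\<Sum>x\<in>?U. scaleV (inverse (emb x)) (Tf i j x (Yop j P))
            - scaleV (inverse (emb x)) (Yop j (Tf i j x P)))"
      using ij by (simp add: Comm_def linop_scaleD[OF linop_Y'] linop_sumD[OF linop_Y'] sum_subtractf
          V.scale_right_diff_distrib)
    also have "\<dots> = scaleV c0 (\<Sum>x\<in>?U. E x)"
      using Tf_Y(2)[OF i j ij _ j] xne by (intro arg_cong[where f = "scaleV c0"] sum.cong) (auto simp: E_def)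
    finally have L: "Comm i j (Yop j P) - Yop j (Comm i j P) = scaleV c0 (\<Sum>x\<in>?U. E x)" .
    have D: "Dop j (Yop i P) = Yop i (Dop j P)"
      using Td_Y[of _ j i] ij i
      by (simp add: Dop_def linop_scaleD[OF linop_Y'] linop_sumD[OF linop_Y'])
    have m1: "psi j m (Yop i P) = Yop i (psi j m P)" if "m \<in> {1..n}" "m \<noteq> i" "m \<noteq> j" for m
      using Tf_Y(1)[of j m _ i] that ij i j by (simp add: psi_def linop_sumD[OF linop_Y'])
    have m2: "psi j i (Yop i P) - Yop i (psi j i P) = - (\<Sum>x\<in>?U. E x)"
    proof -
      have "psi i j (Yop i P) - Yop i (psi i j P)
          = (\<Sum>x\<in>?U. scaleV (inverse (emb x)) (Yop j (Tf i j x P)) - Yop i (Tf i j x P))"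
        using Tf_Y(3)[OF i j ij _ i] by (simp add: psi_def linop_sumD[OF linop_Y'] sum_subtractf)
      then show ?thesis
        by (simp add: psi_swap[OF ij, symmetric] E_def sum_negf[symmetric])
    qed
    have "Comm j j (Yop i P) - Yop i (Comm j j P)
      = - scaleV c0 (\<Sum>m\<in>{1..n}-{j}. psi j m (Yop i P) - Yop i (psi j m P))"
      by (simp add: Comm_def linop_scaleD[OF linop_Y'] linop_sumD[OF linop_Y'] linop_diffD[OF linop_Y'] D
           sum_subtractf V.scale_right_diff_distrib)
    also have "(\<Sum>m\<in>{1..n}-{j}. psi j m (Yop i P) - Yop i (psi j m P))
        = (\<Sum>m\<in>{1..n}-{j}. if m = i then - (\<Sum>x\<in>?U. E x) else 0)"
      using m1 m2 by (intro sum.cong) auto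
    also have "\<dots> = - (\<Sum>x\<in>?U. E x)" using i ij by simp
    finally show ?thesis unfolding L by simp
  qed
  consider "k = i" | "k = j" | "k \<noteq> i" "k \<noteq> j" by blast
  then show ?thesis
  proof cases
    case 1
    then show ?thesis using one[OF j i] ij by simp
  next
    case 2
    then show ?thesis using one[OF i j ij] by simp
  next
    case 3
    then show ?thesis using neither[OF i j ij] neither[OF j i] ij by simp
  qed
qed

text \<open>The commutator of two Dunkl operators kills degree 0, and by \<open>Comm_Y\<close> it commutes with every \<open>x\<^sub>k\<close>.\<close>
lemma Y_commute:
  assumes i: "i \<in> {1..n}" and j: "j \<in> {1..n}"
  shows "Yop i (Yop j P) = Yop j (Yop i P)"
proof (cases "i = j")
  case False
  define F where "F = (\<lambda>P. Yop i (Yop j P) - Yop j (Yop i P))"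
  have "F P = 0"
  proof (rule degree_induct[where F = F])
    show "linop F" unfolding F_def by (intro linop_intros3)
  next
    fix m and v :: 's assume m: "\<And>k. k \<in> {1..n} \<Longrightarrow> m k = (0::nat)"
    then show "F (single m v) = 0"
      unfolding F_def using Y_base[of m] i j by (simp add: linop_0[OF linop_Y'])
  next
    fix k P assume k: "k \<in> {1..n}" and 0: "F P = 0"
    have "F (Xop k P) = Xop k (F P) + (Comm i k (Yop j P) - Yop j (Comm i k P))
       - (Comm j k (Yop i P) - Yop i (Comm j k P))"
      by (simp add: F_def Y_X[OF i k] Y_X[OF j k] linop_addD[OF linop_Y'] linop_diffD[OF linop_X'])
    then show "F (Xop k P) = 0"
      using 0 Comm_Y[OF i j k False] by (simp add: linop_0[OF linop_X'])
  qed
  then show ?thesis by (simp add: F_def)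
qed simp

section \<open>The commuting operators z\<close>

definition yx :: "nat \<Rightarrow> 's pol \<Rightarrow> 's pol" where
  "yx i P = Yop i (Xop i P)"

text \<open>The operator of \<open>\<phi>\<^sub>i\<close>.\<close>
definition jm :: "nat \<Rightarrow> 's pol \<Rightarrow> 's pol" where
  "jm i P = (\<Sum>j\<in>{1..<i}. psi i j P)"

definition zop :: "nat \<Rightarrow> 's pol \<Rightarrow> 's pol" where
  "zop i P = yx i P + scaleV c0 (jm i P)"

lemma linop_yx': "linop (yx i)"
  unfolding yx_def by (intro linop_intros3)

lemma linop_jm': "linop (jm i)"
  unfolding jm_def by (intro linop_intros3)

lemma linop_zop': "linop (zop i)"
  unfolding zop_def by (intro linop_intros3 linop_yx' linop_jm')

lemma T_yx:
  assumes "adm r n s c" "k \<in> {1..n}"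
  shows "Tw s c (yx k P) = yx (s k) (Tw s c P)"
  using adm_nonzero[OF assms(1) r_pos assms(2)]
  by (simp add: yx_def T_Y[OF assms] T_X[OF assms] linop_scaleD[OF linop_Y'])

lemma psi_yx:
  assumes "i \<in> {1..n}" "j \<in> {1..n}" "i \<noteq> j" "k \<in> {1..n}"
  shows "psi i j (yx k P) = yx (transpose i j k) (psi i j P)"
  unfolding psi_def linop_sumD[OF linop_yx']
  by (intro sum.cong refl T_yx adm_refl' assms)

lemma jm_T:
  assumes "adm r n s c" "j \<in> {1..n}" "s j = j" "s ` {1..<j} = {1..<j}"
  shows "Tw s c (jm j P) = jm j (Tw s c P)"
proof -
  have p: "s permutes {1..n}" using assms(1) by (simp add: adm_def)
  have "Tw s c (jm j P) = (\<Sum>k\<in>{1..<j}. psi j (s k) (Tw s c P))"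
    unfolding jm_def linop_sumD[OF linop_T']
    by (intro sum.cong refl, subst T_psi[OF assms(1)]) (use assms in auto)
  also have "\<dots> = jm j (Tw s c P)"
    unfolding jm_def
    by (rule sum.reindex_bij_betw) (use assms(4) permutes_inj_on[OF p] in \<open>auto simp: bij_betw_def\<close>)
  finally show ?thesis .
qed

text \<open>\<open>\<phi>\<^sub>j\<close> is invariant under the monomial matrices in the first \<open>j - 1\<close> coordinates, and for \<open>i < j\<close>
  the element \<open>\<phi>\<^sub>i\<close> is a sum of such matrices.\<close>
lemma jm_commute:
  assumes "i \<in> {1..n}" "j \<in> {1..n}" "i < j"
  shows "jm i (jm j P) = jm j (jm i P)"
proof -
  have "psi i k (jm j P) = jm j (psi i k P)" if "k \<in> {1..<i}" for k
    unfolding psi_def linop_sumD[OF linop_jm']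
  proof (intro sum.cong refl jm_T)
    show "adm r n (transpose i k) (refl_fun i k x)" if "x \<in> unity_roots r" for x
      using that assms \<open>k \<in> {1..<i}\<close> by (intro adm_refl') auto
    show "transpose i k ` {1..<j} = {1..<j}"
      using assms \<open>k \<in> {1..<i}\<close> by (intro permutes_image permutes_swap_id) auto
    show "transpose i k j = j" using assms \<open>k \<in> {1..<i}\<close> by (auto simp: transpose_def)
  qed (rule assms)
  then show ?thesis by (simp add: jm_def[of i] linop_sumD[OF linop_jm'])
qed

text \<open>Exchanging \<open>x\<^sub>i\<close> with \<open>y\<^sub>j\<close> in \<open>y\<^sub>i x\<^sub>i y\<^sub>j x\<^sub>j\<close> costs a commutator, and the commutator times \<open>x\<^sub>j\<close>
  is \<open>c\<^sub>0 x\<^sub>i\<close> times the sum of the reflections; what remains is symmetric in \<open>i\<close> and \<open>j\<close>.\<close>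
lemma yx_commutator:
  assumes i: "i \<in> {1..n}" and j: "j \<in> {1..n}" and ij: "i \<noteq> j"
  shows "yx i (yx j P) - yx j (yx i P) = scaleV c0 (yx j (psi i j P) - yx i (psi i j P))"
proof -
  have C: "Comm j i (Xop j P) = scaleV c0 (Xop i (psi i j P))"
    if i: "i \<in> {1..n}" and j: "j \<in> {1..n}" and ij: "i \<noteq> j" for i j
  proof -
    have "scaleV (inverse (emb x)) (Tf j i x (Xop j P)) = Xop i (Tf j i x P)" if x: "x \<in> unity_roots r" for x
    proof -
      have "Tf j i x (Xop j P) = scaleV (inverse (emb (refl_fun j i x j))) (Xop (transpose j i j) (Tf j i x P))"
        by (rule T_X[OF adm_refl'[OF j i x] j])
      moreover have "refl_fun j i x j = inverse x" using ij by (simp add: refl_fun_def)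
      ultimately show ?thesis
        using unity_roots_nonzero[OF r_pos x] by (simp add: hom_inverse)
    qed
    then show ?thesis
      using ij by (simp add: Comm_def psi_swap[OF ij] psi_def[of j i] linop_sumD[OF linop_X'])
  qed
  have E: "yx i (yx j P) = Yop i (Yop j (Xop i (Xop j P))) - scaleV c0 (yx i (psi i j P))"
    if i: "i \<in> {1..n}" and j: "j \<in> {1..n}" and ij: "i \<noteq> j" for i j
  proof -
    have "Xop i (Yop j (Xop j P)) = Yop j (Xop i (Xop j P)) - Comm j i (Xop j P)"
      by (simp add: Y_X[OF j i])
    then show ?thesis
      by (simp add: yx_def C[OF i j ij] linop_diffD[OF linop_Y'] linop_scaleD[OF linop_Y'])
  qed
  show ?thesis
    unfolding E[OF i j ij] E[OF j i ij[symmetric]] X_commute[of j i] Y_commute[OF j i]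
      psi_swap[OF ij[symmetric]]
    by (simp add: V.scale_right_diff_distrib)
qed

text \<open>The \<open>y\<^sub>i x\<^sub>i\<close> do not commute. For \<open>i < j\<close> the correction \<open>c\<^sub>0 \<phi>\<^sub>j\<close> repairs this, because only its
  summand with the reflections in \<open>i\<close> and \<open>j\<close> fails to commute with \<open>y\<^sub>i x\<^sub>i\<close>, and it fails by the negative
  of \<open>yx_commutator\<close>.\<close>
lemma zop_commute_less:
  assumes i: "i \<in> {1..n}" and j: "j \<in> {1..n}" and ij: "i < j"
  shows "zop i (zop j P) = zop j (zop i P)"
proof -
  have 1: "jm i (yx j P) = yx j (jm i P)"
  proof -
    have "psi i k (yx j P) = yx j (psi i k P)" if "k \<in> {1..<i}" for k
      using psi_yx[of i k j P] that i j ij by (auto simp: transpose_def)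
    then show ?thesis by (simp add: jm_def linop_sumD[OF linop_yx'])
  qed
  have 2: "jm j (yx i P) - yx i (jm j P) = yx j (psi i j P) - yx i (psi i j P)"
  proof -
    have "jm j (yx i P) - yx i (jm j P) = (\<Sum>k\<in>{1..<j}. psi j k (yx i P) - yx i (psi j k P))"
      by (simp add: jm_def linop_sumD[OF linop_yx'] sum_subtractf)
    also have "\<dots> = (\<Sum>k\<in>{1..<j}. if k = i then yx j (psi i j P) - yx i (psi i j P) else 0)"
    proof (intro sum.cong refl)
      fix k assume k: "k \<in> {1..<j}"
      show "psi j k (yx i P) - yx i (psi j k P) = (if k = i then yx j (psi i j P) - yx i (psi i j P) else 0)"
        using psi_yx[of j k i P] k i j ij psi_swap[of i j P] by (auto simp: transpose_def)
    qed
    also have "\<dots> = yx j (psi i j P) - yx i (psi i j P)"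
      using i ij by simp
    finally show ?thesis .
  qed
  have 3: "yx i (yx j P) - yx j (yx i P) = scaleV c0 (yx j (psi i j P) - yx i (psi i j P))"
    using yx_commutator[OF i j] ij by simp
  have "zop i (zop j P) - zop j (zop i P)
    = (yx i (yx j P) - yx j (yx i P)) - scaleV c0 (jm j (yx i P) - yx i (jm j P))"
    by (simp add: zop_def linop_addD[OF linop_yx'] linop_addD[OF linop_jm'] linop_scaleD[OF linop_yx']
        linop_scaleD[OF linop_jm'] V.scale_right_distrib V.scale_right_diff_distrib 1 jm_commute[OF i j ij])
  then show ?thesis unfolding 2 3 by simp
qed

lemma zop_commute:
  assumes i: "i \<in> {1..n}" and j: "j \<in> {1..n}"
  shows "zop i (zop j P) = zop j (zop i P)"
  using zop_commute_less[OF i j] zop_commute_less[OF j i] by (cases i j rule: linorder_cases) auto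

lemma Td_zop:
  assumes "x \<in> unity_roots r" "i \<in> {1..n}"
  shows "Td k x (zop i P) = zop i (Td k x P)"
  using T_yx[OF adm_diag'[OF assms(1)] assms(2), of k P] jm_T[OF adm_diag'[OF assms(1)] assms(2), of k P]
  by (simp add: zop_def linop_addD[OF linop_T'] linop_scaleD[OF linop_T'])

end

section \<open>The action of the generators and the defining relations\<close>

context W_rep begin

definition Tm :: "complex mat \<Rightarrow> 's pol \<Rightarrow> 's pol" where
  "Tm w = Tw (perm_of r n w) (coef_of r n w)"

lemma Tm_mono: "adm r n s c \<Longrightarrow> Tm (mono_mat n s c) = Tw s c"
  unfolding Tm_def using perm_of_mono[OF _ r_pos] T_cong by metis

lemma linop_Tm': "linop (Tm w)"
  unfolding Tm_def by (rule linop_T')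

primrec gen_act :: "gen \<Rightarrow> 's pol \<Rightarrow> 's pol" where
  "gen_act (GX i) = Xop i"
| "gen_act (GY i) = Yop i"
| "gen_act (GT w) = Tm w"

primrec word_act :: "gen list \<Rightarrow> 's pol \<Rightarrow> 's pol" where
  "word_act [] P = P"
| "word_act (g # gs) P = gen_act g (word_act gs P)"

lemma linop_gen_act': "linop (gen_act g)"
  by (cases g) (simp_all add: linop_X' linop_Y' linop_Tm')

lemma linop_word_act': "linop (word_act gs)"
proof (induction gs)
  case Nil
  show ?case by (simp add: linop_def)
next
  case (Cons g gs)
  then show ?case using linop_compose[OF linop_gen_act'[of g] Cons] by (simp add: linop_def)
qed

lemma word_act_append: "word_act (gs @ hs) P = word_act gs (word_act hs P)"
  by (induction gs) simp_all

text \<open>The action of the free algebra. Letters outside the generating set act by some linear map, so that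
  multiplicativity holds on the whole type.\<close>
definition act :: "'f free_alg \<Rightarrow> 's pol \<Rightarrow> 's pol" where
  "act p P = ext (\<lambda>u a. scaleV a (word_act (letters u) P)) p"

lemma act_single: "act (single u a) P = scaleV a (word_act (letters u) P)"
  unfolding act_def by (rule ext_single) simp

lemma act_add: "act (p + q) P = act p P + act q P"
  unfolding act_def by (rule ext_add) (simp add: V.scale_left_distrib)

lemma additive_act: "Modules.additive (\<lambda>p. act p P)"
  by unfold_locales (rule act_add)

lemmas act_0 = Modules.additive.zero[OF additive_act]
lemmas act_diff = Modules.additive.diff[OF additive_act]
lemmas act_minus = Modules.additive.minus[OF additive_act]
lemmas act_sum = Modules.additive.sum[OF additive_act]

lemma linop_act': "linop (act p)"
  unfolding act_def ext_def
  by (intro linop_sum linop_scaleV linop_word_act')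

lemma act_mult: "act (p * q) P = act p (act q P)"
proof -
  have 1: "act (single u a * single w b) P
      = act (single u a) (act (single w b) P)" for u a w b
    by (simp add: mult_single act_single plus_word_def word_act_append linop_scaleD[OF linop_word_act'])
  have 2: "act (single u a * q) P = act (single u a) (act q P)" for u a
    by (subst (1 2) poly_mapping_expand[of q])
       (simp add: sum_distrib_left act_sum 1 linop_sumD[OF linop_act'])
  show ?thesis
    by (subst (1 2) poly_mapping_expand[of p]) (simp add: sum_distrib_right act_sum 2)
qed

lemma act_scal [simp]: "act (scal a) P = scaleV a P"
  by (simp add: scal_def act_single zero_word_def)

lemma act_one [simp]: "act 1 P = P"
  using act_scal[of 1 P] by (simp add: scal_def)

lemma act_xg [simp]: "act (xg i) P = Xop i P"
  and act_yg [simp]: "act (yg i) P = Yop i P"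
  and act_tg [simp]: "act (tg w) P = Tm w P"
  by (simp_all add: xg_def yg_def tg_def act_single)

lemma act_tg_refl:
  assumes "i \<in> {1..n}" "j \<in> {1..n}" "i \<noteq> j"
  shows "act (tg (refl_mat r n i j l)) P = Tf i j (zeta r ^ l) P"
  using bij_betwE[OF bij_betw_zeta[OF r_pos]] assms
  by (simp add: refl_mat_mono[OF r_pos] Tm_mono power_mult[symmetric]
      mult.commute[of l] power_mult zeta_pow_r[OF r_pos] adm_refl)

lemma zeta_power_root: "zeta r ^ l \<in> unity_roots r"
  by (simp add: unity_roots_def power_mult[symmetric] mult.commute[of l])
     (simp add: power_mult zeta_pow_r[OF r_pos])

lemma act_refl_sum:
  assumes "i \<in> {1..n}" "j \<in> {1..n}" "i \<noteq> j"
  shows "act (refl_sum r n i j) P = psi i j P"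
  unfolding refl_sum_def act_sum psi_def act_tg_refl[OF assms]
  by (rule sum_zeta[OF r_pos, where f = "\<lambda>x. Tf i j x P"])

lemma act_tg_zeta_pow:
  "act (tg (zeta_mat r n i [^]\<^bsub>G_r1n r n\<^esub> (l::nat))) P = Td i (zeta r ^ l) P"
  using zeta_power_root[of l]
  by (simp add: zeta_mat_pow[OF r_pos] Tm_mono[OF adm_diag'])

lemma act_tg_zeta: "act (tg (zeta_mat r n i)) P = Td i (zeta r) P"
  using zeta_power_root[of 1] by (simp add: zeta_mat_mono Tm_mono[OF adm_diag'])

lemma act_idem_sum:
  "act (\<Sum>j<r. scal (d_ext r d (int j) - d_ext r d (int j - 1)) * idem emb r n i j) P = Dop i P"
proof -
  let ?g = "\<lambda>j. d_ext r d (int j) - d_ext r d (int j - 1)"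
  have z: "emb (zeta r powi (- int l * int j)) = inverse (emb (zeta r ^ l)) ^ j" for l j
  proof -
    have "- int l * int j = - int (l * j)" by simp
    then have "zeta r powi (- int l * int j) = inverse (zeta r ^ l) ^ j"
      by (simp only: power_int_minus power_int_of_nat power_mult power_inverse)
    then show ?thesis by (simp only: hom_inverse hom_power)
  qed
  have "act (\<Sum>j<r. scal (?g j) * idem emb r n i j) P
    = (\<Sum>j<r. \<Sum>l<r. scaleV (?g j * emb (1 / of_nat r) * inverse (emb (zeta r ^ l)) ^ j) (Td i (zeta r ^ l) P))"
    unfolding idem_def
    by (simp only: act_sum act_mult act_scal z act_tg_zeta_pow V.scale_sum_right V.scale_scale mult.assoc)
  also have "\<dots> = (\<Sum>l<r. scaleV (dcoef (zeta r ^ l)) (Td i (zeta r ^ l) P))"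
    by (subst sum.swap) (simp add: dcoef_def V.scale_sum_left sum_distrib_left mult_ac)
  also have "\<dots> = Dop i P"
    unfolding Dop_def by (rule sum_zeta[OF r_pos, where f = "\<lambda>x. scaleV (dcoef x) (Td i x P)"])
  finally show ?thesis .
qed

lemma act_comm_offdiag:
  assumes "i \<in> {1..n}" "j \<in> {1..n}" "i \<noteq> j"
  shows "act (scal c0 * (\<Sum>l<r. scal (emb (zeta r powi (- int l))) * tg (refl_mat r n i j l))) P = Comm i j P"
proof -
  have z: "emb (zeta r powi (- int l)) = inverse (emb (zeta r ^ l))" for l
    by (simp add: hom_inverse[symmetric] power_int_minus)
  have "act (scal c0 * (\<Sum>l<r. scal (emb (zeta r powi (- int l))) * tg (refl_mat r n i j l))) P
    = scaleV c0 (\<Sum>l<r. scaleV (inverse (emb (zeta r ^ l))) (Tf i j (zeta r ^ l) P))"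
    by (simp only: act_sum act_mult act_scal z act_tg_refl[OF assms])
  also have "(\<Sum>l<r. scaleV (inverse (emb (zeta r ^ l))) (Tf i j (zeta r ^ l) P))
      = (\<Sum>x\<in>unity_roots r. scaleV (inverse (emb x)) (Tf i j x P))"
    by (rule sum_zeta[OF r_pos, where f = "\<lambda>x. scaleV (inverse (emb x)) (Tf i j x P)"])
  finally show ?thesis using assms by (simp add: Comm_def)
qed

lemma act_comm_diag:
  assumes "i \<in> {1..n}"
  shows "act (scal kappa - (\<Sum>j<r. scal (d_ext r d (int j) - d_ext r d (int j - 1)) * idem emb r n i j)
     - scal c0 * (\<Sum>j \<in> {1..n} - {i}. refl_sum r n i j)) P = Comm i i P"
proof -
  have "act (\<Sum>j \<in> {1..n} - {i}. refl_sum r n i j) P = (\<Sum>j \<in> {1..n} - {i}. psi i j P)"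
    unfolding act_sum using assms by (intro sum.cong act_refl_sum) auto
  then show ?thesis by (simp add: act_diff act_idem_sum act_mult Comm_def)
qed

lemma act_zg:
  assumes "i \<in> {1..n}"
  shows "act (zg r n c0 i) P = zop i P"
proof -
  have "act (phi r n i) P = jm i P"
    unfolding phi_def act_sum jm_def using assms by (intro sum.cong act_refl_sum) auto
  then show ?thesis by (simp add: zg_def act_add act_mult zop_def yx_def)
qed

lemma inv_entry:
  assumes "adm r n s c" "j \<in> {1..n}" "k \<in> {1..n}"
  shows "(inv\<^bsub>G_r1n r n\<^esub> (mono_mat n s c)) $$ (j - 1, k - 1) = (if k = s j then inverse (c j) else 0)"
proof -
  have p: "s permutes {1..n}" using assms(1) by (simp add: adm_def)
  have "k - 1 + 1 = k" "j - 1 + 1 = j" "j - 1 < n" "k - 1 < n" using assms by auto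
  moreover have "pinv s k = j \<longleftrightarrow> k = s j" using permutes_inverses[OF p] by metis
  ultimately show ?thesis
    by (simp only: inv_mono_mat[OF assms(1) r_pos] mono_mat_index) (auto simp: permutes_inverses[OF p])
qed

lemma T_x_sum:
  assumes "adm r n s c" "j \<in> {1..n}"
  shows "(\<Sum>k\<in>{1..n}. scal (emb ((inv\<^bsub>G_r1n r n\<^esub> (mono_mat n s c)) $$ (j - 1, k - 1))) * xg k)
     = scal (inverse (emb (c j))) * xg (s j)"
proof -
  have sj: "s j \<in> {1..n}" using assms perm_in by blast
  have "(\<Sum>k\<in>{1..n}. scal (emb ((inv\<^bsub>G_r1n r n\<^esub> (mono_mat n s c)) $$ (j - 1, k - 1))) * xg k)
     = (\<Sum>k\<in>{1..n}. if k = s j then scal (inverse (emb (c j))) * xg (s j) else 0)"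
    by (intro sum.cong refl, subst inv_entry[OF assms])
       (auto simp: hom_inverse scal_def)
  then show ?thesis using sj by simp
qed

lemma T_y_sum:
  assumes "adm r n s c" "j \<in> {1..n}"
  shows "(\<Sum>k\<in>{1..n}. scal (emb (mono_mat n s c $$ (k - 1, j - 1))) * yg k)
     = scal (emb (c j)) * yg (s j)"
proof -
  have sj: "s j \<in> {1..n}" using assms perm_in by blast
  have "mono_mat n s c $$ (k - 1, j - 1) = (if k = s j then c j else 0)" if "k \<in> {1..n}" for k
  proof -
    have "k - 1 + 1 = k" "j - 1 + 1 = j" "j - 1 < n" "k - 1 < n" using assms that by auto
    then show ?thesis by (simp only: mono_mat_index) auto
  qed
  then have "(\<Sum>k\<in>{1..n}. scal (emb (mono_mat n s c $$ (k - 1, j - 1))) * yg k)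
     = (\<Sum>k\<in>{1..n}. if k = s j then scal (emb (c j)) * yg (s j) else 0)"
    by (intro sum.cong refl) (auto simp: scal_def)
  then show ?thesis using sj by simp
qed

lemma Tm_one: "Tm (1\<^sub>m n) P = P"
proof -
  have "Tm (mono_mat n id (\<lambda>_. 1)) = Tw id (\<lambda>_. 1)" by (rule Tm_mono[OF adm_id]) simp
  then show ?thesis by (simp add: T_one mono_mat_one)
qed

lemma Tm_mult:
  assumes "u \<in> carrier (G_r1n r n)" "w \<in> carrier (G_r1n r n)"
  shows "Tm (u * w) P = Tm u (Tm w P)"
proof -
  obtain s c where u: "adm r n s c" "u = mono_mat n s c" using assms(1) by (rule G_mono_mat)
  obtain t e where w: "adm r n t e" "w = mono_mat n t e" using assms(2) by (rule G_mono_mat)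
  show ?thesis
    unfolding u(2) w(2) mono_mat_mult[OF adm_permutes[OF w(1)]] Tm_mono[OF adm_comp[OF u(1) w(1)]]
      Tm_mono[OF u(1)] Tm_mono[OF w(1)] T_mult[OF u(1) w(1)] ..
qed

text \<open>Since the relations act by 0, so does the ideal that they generate, and the Cherednik algebra acts on
  polynomials.\<close>
theorem act_relations:
  assumes "q \<in> relations emb r n kappa c0 d"
  shows "act q P = 0"
proof -
  let ?G = "carrier (G_r1n r n)"
  consider (xx) i j where "q = xg i * xg j - xg j * xg i" "i \<in> {1..n}" "j \<in> {1..n}"
    | (yy) i j where "q = yg i * yg j - yg j * yg i" "i \<in> {1..n}" "j \<in> {1..n}"
    | (one) "q = tg (1\<^sub>m n) - 1"
    | (tt) u w where "q = tg u * tg w - tg (u * w)" "u \<in> ?G" "w \<in> ?G"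
    | (tx) w j where "q = tg w * xg j - (\<Sum>k \<in> {1..n}. scal (emb ((inv\<^bsub>G_r1n r n\<^esub> w) $$ (j - 1, k - 1))) * xg k) * tg w"
        "w \<in> ?G" "j \<in> {1..n}"
    | (ty) w j where "q = tg w * yg j - (\<Sum>k \<in> {1..n}. scal (emb (w $$ (k - 1, j - 1))) * yg k) * tg w"
        "w \<in> ?G" "j \<in> {1..n}"
    | (yx) i j where "q = yg i * xg j - (xg j * yg i
          + scal c0 * (\<Sum>l<r. scal (emb (zeta r powi (- int l))) * tg (refl_mat r n i j l)))"
        "i \<in> {1..n}" "j \<in> {1..n}" "i \<noteq> j"
    | (yxd) i where "q = yg i * xg i - (xg i * yg i + scal kappa
          - (\<Sum>j<r. scal (d_ext r d (int j) - d_ext r d (int j - 1)) * idem emb r n i j)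
          - scal c0 * (\<Sum>j \<in> {1..n} - {i}. refl_sum r n i j))" "i \<in> {1..n}"
    using assms unfolding relations_def by blast
  then show ?thesis
  proof cases
    case xx
    then show ?thesis by (simp add: act_diff act_mult X_commute[of i j])
  next
    case yy
    then show ?thesis by (simp add: act_diff act_mult Y_commute[of i j])
  next
    case one
    then show ?thesis by (simp add: act_diff Tm_one)
  next
    case tt
    then show ?thesis by (simp add: act_diff act_mult Tm_mult)
  next
    case tx
    obtain s c where w: "adm r n s c" "w = mono_mat n s c" using tx(2) by (rule G_mono_mat)
    show ?thesis
      unfolding tx(1) w(2) T_x_sum[OF w(1) tx(3)]
      by (simp add: act_diff act_mult Tm_mono[OF w(1)] T_X[OF w(1) tx(3)])
  next
    case ty
    obtain s c where w: "adm r n s c" "w = mono_mat n s c" using ty(2) by (rule G_mono_mat)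
    show ?thesis
      unfolding ty(1) w(2) T_y_sum[OF w(1) ty(3)]
      by (simp add: act_diff act_mult Tm_mono[OF w(1)] T_Y[OF w(1) ty(3)])
  next
    case yx
    show ?thesis
      unfolding yx(1) by (simp only: act_diff act_add act_comm_offdiag[OF yx(2,3,4)])
        (simp add: act_mult Y_X[OF yx(2,3)])
  next
    case yxd
    have "q = yg i * xg i - (xg i * yg i + (scal kappa
          - (\<Sum>j<r. scal (d_ext r d (int j) - d_ext r d (int j - 1)) * idem emb r n i j)
          - scal c0 * (\<Sum>j \<in> {1..n} - {i}. refl_sum r n i j)))"
      unfolding yxd(1) by (simp add: algebra_simps)
    then show ?thesis
      by (simp only: act_diff[of "yg i * xg i"] act_add act_comm_diag[OF yxd(2)])
        (simp add: act_mult Y_X[OF yxd(2,2)])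
  qed
qed

end

section \<open>The free algebra and its quotient\<close>

lemma free_alg_sel [simp]:
  "x \<otimes>\<^bsub>free_algebra r n\<^esub> y = x * y" "x \<oplus>\<^bsub>free_algebra r n\<^esub> y = x + y"
  "\<one>\<^bsub>free_algebra r n\<^esub> = 1" "\<zero>\<^bsub>free_algebra r n\<^esub> = 0"
  by (simp_all add: free_algebra_def)

lemma free_alg_carrier:
  "p \<in> carrier (free_algebra r n) \<longleftrightarrow> (\<forall>u\<in>keys p. set (letters u) \<subseteq> gens r n)"
  by (simp add: free_algebra_def)

lemma FA_add: "p \<in> carrier (free_algebra r n) \<Longrightarrow> q \<in> carrier (free_algebra r n) \<Longrightarrow> p + q \<in> carrier (free_algebra r n)"
  unfolding free_alg_carrier using Poly_Mapping.keys_add[of p q] by blast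

lemma FA_mult:
  assumes "p \<in> carrier (free_algebra r n)" "q \<in> carrier (free_algebra r n)"
  shows "p * q \<in> carrier (free_algebra r n)"
  unfolding free_alg_carrier
proof
  fix u assume "u \<in> keys (p * q)"
  then obtain a b where "u = a + b" "a \<in> keys p" "b \<in> keys q"
    using keys_mult[of p q] by blast
  then show "set (letters u) \<subseteq> gens r n"
    using assms by (auto simp: plus_word_def free_alg_carrier)
qed

lemma FA_uminus: "p \<in> carrier (free_algebra r n) \<Longrightarrow> - p \<in> carrier (free_algebra r n)"
  by (simp add: free_alg_carrier in_keys_iff)

lemma FA_diff: "p \<in> carrier (free_algebra r n) \<Longrightarrow> q \<in> carrier (free_algebra r n) \<Longrightarrow> p - q \<in> carrier (free_algebra r n)"
  using FA_add[OF _ FA_uminus, of p r n q] by simp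

lemma FA_single: "set (letters u) \<subseteq> gens r n \<Longrightarrow> single u a \<in> carrier (free_algebra r n)"
  by (auto simp: free_alg_carrier in_keys_iff lookup_single when_def)

lemma FA_scal: "scal a \<in> carrier (free_algebra r n)"
  unfolding scal_def by (rule FA_single) (simp add: zero_word_def)

lemma FA_0: "0 \<in> carrier (free_algebra r n)"
  by (simp add: free_alg_carrier)

lemma FA_1: "1 \<in> carrier (free_algebra r n)"
  using FA_scal[of 1 r n] by (simp add: scal_def)

lemma FA_xg: "i \<in> {1..n} \<Longrightarrow> xg i \<in> carrier (free_algebra r n)"
  and FA_yg: "i \<in> {1..n} \<Longrightarrow> yg i \<in> carrier (free_algebra r n)"
  and FA_tg: "w \<in> carrier (G_r1n r n) \<Longrightarrow> tg w \<in> carrier (free_algebra r n)"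
  unfolding xg_def yg_def tg_def by (auto intro!: FA_single simp: gens_def)

lemma FA_sum: "(\<And>i. i \<in> A \<Longrightarrow> f i \<in> carrier (free_algebra r n)) \<Longrightarrow> sum f A \<in> carrier (free_algebra r n)"
  by (induction A rule: infinite_finite_induct) (auto simp: FA_0 FA_add)

lemma ring_free_algebra: "ring (free_algebra r n :: 'f::field free_alg ring)"
proof (rule ringI)
  show "abelian_group (free_algebra r n :: 'f free_alg ring)"
  proof (rule abelian_groupI)
    fix x :: "'f free_alg" assume "x \<in> carrier (free_algebra r n)"
    then show "\<exists>y\<in>carrier (free_algebra r n). y \<oplus>\<^bsub>free_algebra r n\<^esub> x = \<zero>\<^bsub>free_algebra r n\<^esub>"
      by (intro bexI[of _ "- x"]) (simp_all add: FA_uminus)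
  qed (simp_all add: FA_0 FA_add add_ac)
  show "monoid (free_algebra r n :: 'f free_alg ring)"
    by (rule monoidI) (simp_all add: FA_1 FA_mult mult.assoc)
qed (simp_all add: distrib_left distrib_right)

lemma FA_a_inv: "p \<in> carrier (free_algebra r n) \<Longrightarrow> \<ominus>\<^bsub>free_algebra r n\<^esub> p = - p"
proof -
  assume p: "p \<in> carrier (free_algebra r n)"
  interpret ring "free_algebra r n" by (rule ring_free_algebra)
  show ?thesis by (rule minus_equality) (simp_all add: p FA_uminus)
qed

lemma scal_commute: "scal a * p = p * scal a"
proof -
  have "scal a * single u b = single u b * scal a" for u b
    by (simp add: scal_def mult_single mult.commute)
  then show ?thesis
    by (subst (1 2) poly_mapping_expand[of p]) (simp add: sum_distrib_left sum_distrib_right)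
qed

context cherednik_setup begin

abbreviation FA :: "'f free_alg ring" where "FA \<equiv> free_algebra r n"
abbreviation rI :: "'f free_alg set" where "rI \<equiv> rel_ideal emb r n kappa c0 d"
abbreviation HH :: "'f free_alg set ring" where "HH \<equiv> cherednik emb r n kappa c0 d"
abbreviation h :: "'f free_alg \<Rightarrow> 'f free_alg set" where "h \<equiv> cls emb r n kappa c0 d"

lemma refl_mat_in_G:
  assumes "i \<in> {1..n}" "j \<in> {1..n}" "i \<noteq> j"
  shows "refl_mat r n i j l \<in> carrier (G_r1n r n)"
  unfolding refl_mat_mono[OF r_pos assms]
  by (intro mono_mat_in_G adm_refl assms r_pos)
     (simp add: power_mult[symmetric] mult.commute[of l], simp add: power_mult zeta_pow_r[OF r_pos])

lemma zeta_pow_in_G: "zeta_mat r n i [^]\<^bsub>G_r1n r n\<^esub> (l::nat) \<in> carrier (G_r1n r n)"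
  unfolding zeta_mat_pow[OF r_pos]
  by (intro mono_mat_in_G adm_diag r_pos)
     (simp add: power_mult[symmetric] mult.commute[of l], simp add: power_mult zeta_pow_r[OF r_pos])

lemma zeta_mat_in_G: "zeta_mat r n i \<in> carrier (G_r1n r n)"
  using zeta_mat_mono[of r n i] mono_mat_in_G[OF adm_diag[OF zeta_pow_r[OF r_pos]] r_pos] by simp

lemma G_mult_closed: "u \<in> carrier (G_r1n r n) \<Longrightarrow> w \<in> carrier (G_r1n r n) \<Longrightarrow> u * w \<in> carrier (G_r1n r n)"
  using monoid.m_closed[OF group.is_monoid[OF group_G[OF r_pos]], of u n w] by simp

lemma G_one_closed: "1\<^sub>m n \<in> carrier (G_r1n r n)"
  using monoid.one_closed[OF group.is_monoid[OF group_G[OF r_pos]], of n] by simp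

lemmas FA_intros = FA_add FA_diff FA_mult FA_scal FA_xg FA_yg FA_tg FA_sum FA_1 FA_0

lemma FA_refl_sum:
  assumes "i \<in> {1..n}" "j \<in> {1..n}" "i \<noteq> j"
  shows "refl_sum r n i j \<in> carrier FA"
  unfolding refl_sum_def by (intro FA_intros refl_mat_in_G assms)

lemma FA_idem: "idem emb r n i j \<in> carrier FA"
  unfolding idem_def by (intro FA_intros zeta_pow_in_G)

lemma FA_zg: "i \<in> {1..n} \<Longrightarrow> zg r n c0 i \<in> carrier FA"
  unfolding zg_def phi_def by (intro FA_intros FA_refl_sum) auto

lemma relations_carrier: "relations emb r n kappa c0 d \<subseteq> carrier FA"
  unfolding relations_def
  by (auto intro!: FA_intros refl_mat_in_G FA_idem FA_refl_sum G_mult_closed G_one_closed simp del: One_nat_def)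

lemma ideal_rI: "ideal rI FA"
  unfolding rel_ideal_def by (rule ring.genideal_ideal[OF ring_free_algebra relations_carrier])

lemma relations_rI: "q \<in> relations emb r n kappa c0 d \<Longrightarrow> q \<in> rI"
  unfolding rel_ideal_def using ring.genideal_self[OF ring_free_algebra relations_carrier] by blast

lemma h_hom: "h \<in> Ring.ring_hom FA HH"
  using ideal.rcos_ring_hom[OF ideal_rI] by (simp add: cls_def[abs_def] cherednik_def)

lemma ring_HH: "ring HH"
  unfolding cherednik_def by (rule ideal.quotient_is_ring[OF ideal_rI])

lemma carrier_HH: "carrier HH = h ` carrier FA"
  by (auto simp: cherednik_def cls_def FactRing_def A_RCOSETS_defs a_r_coset_defs)

lemma h_mult: "p \<in> carrier FA \<Longrightarrow> q \<in> carrier FA \<Longrightarrow> h p \<otimes>\<^bsub>HH\<^esub> h q = h (p * q)"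
  using ring_hom_mult[OF h_hom] by simp

lemma h_add: "p \<in> carrier FA \<Longrightarrow> q \<in> carrier FA \<Longrightarrow> h p \<oplus>\<^bsub>HH\<^esub> h q = h (p + q)"
  using ring_hom_add[OF h_hom] by simp

lemma h_one: "\<one>\<^bsub>HH\<^esub> = h 1"
  using ring_hom_one[OF h_hom] by simp

lemma h_in: "p \<in> carrier FA \<Longrightarrow> h p \<in> carrier HH"
  using carrier_HH by blast

lemma h_eq_iff:
  assumes "p \<in> carrier FA" "q \<in> carrier FA"
  shows "h p = h q \<longleftrightarrow> p - q \<in> rI"
proof -
  have "p \<ominus>\<^bsub>FA\<^esub> q = p - q"
    by (simp add: a_minus_def FA_a_inv assms)
  then show ?thesis
    using ring.quotient_eq_iff_same_a_r_cos[OF ring_free_algebra ideal_rI assms] by (simp add: cls_def)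
qed

lemma h_uminus:
  assumes "p \<in> carrier FA" shows "\<ominus>\<^bsub>HH\<^esub> h p = h (- p)"
proof -
  interpret ring HH by (rule ring_HH)
  have "h 0 = \<zero>\<^bsub>HH\<^esub>"
    using h_add[OF FA_0 FA_0] h_in[OF FA_0] add.l_cancel_one' by simp
  then show ?thesis
    using assms h_add[OF FA_uminus[OF assms] assms] by (intro minus_equality) (simp_all add: h_in FA_uminus)
qed

lemma rI_mult_left: "a \<in> rI \<Longrightarrow> q \<in> carrier FA \<Longrightarrow> q * a \<in> rI"
  using ideal.I_l_closed[OF ideal_rI] by simp

lemma rI_mult_right: "a \<in> rI \<Longrightarrow> q \<in> carrier FA \<Longrightarrow> a * q \<in> rI"
  using ideal.I_r_closed[OF ideal_rI] by simp

end

context W_rep begin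

lemma act_rI: "a \<in> rI \<Longrightarrow> act a P = 0"
proof -
  assume a: "a \<in> rI"
  let ?K = "{p \<in> carrier FA. \<forall>P. act p P = 0}"
  interpret F: ring FA by (rule ring_free_algebra)
  have "ideal ?K FA"
  proof (rule idealI)
    show "ring FA" by (rule ring_free_algebra)
    show "subgroup ?K (add_monoid FA)"
    proof
      fix x assume x: "x \<in> ?K"
      then have "inv\<^bsub>add_monoid FA\<^esub> x = - x" using FA_a_inv[of x r n] by (simp add: a_inv_def)
      then show "inv\<^bsub>add_monoid FA\<^esub> x \<in> ?K" using x by (simp add: FA_uminus act_minus)
    qed (auto simp: FA_0 FA_add act_add act_0)
  qed (auto simp: FA_mult act_mult linop_0[OF linop_act'])
  moreover have "relations emb r n kappa c0 d \<subseteq> ?K"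
    using relations_carrier act_relations by blast
  ultimately have "rI \<subseteq> ?K"
    unfolding rel_ideal_def by (rule F.genideal_minimal)
  then show ?thesis using a by blast
qed

text \<open>The action of a residue class; by \<open>act_rI\<close> the choice of the representative does not matter.\<close>
definition class_act :: "'f free_alg set \<Rightarrow> 's pol \<Rightarrow> 's pol" where
  "class_act a P = act (SOME p. p \<in> carrier FA \<and> h p = a) P"

lemma class_act_h:
  assumes "p \<in> carrier FA" shows "class_act (h p) P = act p P"
proof -
  let ?q = "SOME q. q \<in> carrier FA \<and> h q = h p"
  have q: "?q \<in> carrier FA \<and> h ?q = h p" by (rule someI[where x = p]) (simp add: assms)
  then have "?q - p \<in> rI" using h_eq_iff[of ?q p] assms by simp
  from act_rI[OF this] have "act ?q P = act p P" by (simp add: act_diff)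
  then show ?thesis by (simp add: class_act_def)
qed

end

text \<open>The situation of the standard module: a subrepresentation \<open>S0\<close> of \<open>R\<close>, and a description \<open>Bact\<close> of
  the action on it of the subalgebra generated by scalars, \<open>W\<close> and the \<open>y\<^sub>i\<close>. The maps in \<open>Bact\<close> are only
  known on \<open>S0\<close>, which is all that the balancing relations see.\<close>
locale induced_model = W_rep emb r n kappa c0 d scale R
  for emb :: "complex \<Rightarrow> 'f::field" and r n :: nat and kappa c0 :: 'f and d :: "nat \<Rightarrow> 'f"
    and scale :: "'f \<Rightarrow> 's::ab_group_add \<Rightarrow> 's" and R +
  fixes S0 :: "'s set" and Bact :: "('f free_alg set \<times> ('s \<Rightarrow> 's)) set"
  assumes S0_0: "0 \<in> S0" and S0_add: "u \<in> S0 \<Longrightarrow> v \<in> S0 \<Longrightarrow> u + v \<in> S0"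
    and S0_scale: "v \<in> S0 \<Longrightarrow> scale a v \<in> S0"
    and S0_R: "w \<in> carrier (G_r1n r n) \<Longrightarrow> v \<in> S0 \<Longrightarrow> R w v \<in> S0"
    and Bact_cases: "(b, f) \<in> Bact \<Longrightarrow>
        (\<exists>a. b = h (scal a) \<and> (\<forall>v\<in>S0. f v = scale a v)) \<or>
        (\<exists>w\<in>carrier (G_r1n r n). b = h (tg w) \<and> (\<forall>v\<in>S0. f v = R w v)) \<or>
        (\<exists>i\<in>{1..n}. b = h (yg i) \<and> (\<forall>v\<in>S0. f v = 0))"
    and Bact_scal: "\<exists>f. (h (scal a), f) \<in> Bact \<and> (\<forall>v\<in>S0. f v = scale a v)"
    and Bact_tg: "w \<in> carrier (G_r1n r n) \<Longrightarrow> \<exists>f. (h (tg w), f) \<in> Bact \<and> (\<forall>v\<in>S0. f v = R w v)"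
    and Bact_yg: "i \<in> {1..n} \<Longrightarrow> \<exists>f. (h (yg i), f) \<in> Bact \<and> (\<forall>v\<in>S0. f v = 0)"
begin

abbreviation TG where "TG \<equiv> tensor_group HH S0"
abbreviation TN where "TN \<equiv> tensor_kernel HH Bact S0"
abbreviation TR where "TR \<equiv> tensor_relations HH Bact S0"

definition \<tau> :: "'f free_alg \<Rightarrow> 's \<Rightarrow> ('f free_alg set \<times> 's \<Rightarrow>\<^sub>0 int)" where
  "\<tau> p v = frag_of (h p, v)"

lemma TG_carrier: "x \<in> carrier TG \<longleftrightarrow> keys x \<subseteq> carrier HH \<times> S0"
  by (simp add: tensor_group_def)

lemma TG_mult [simp]: "x \<otimes>\<^bsub>TG\<^esub> y = x + y" and TG_one [simp]: "\<one>\<^bsub>TG\<^esub> = 0"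
  by (simp_all add: tensor_group_def)

lemma TG_group: "group TG" by (simp add: tensor_group_def)

lemma TG_inv: "x \<in> carrier TG \<Longrightarrow> inv\<^bsub>TG\<^esub> x = - x"
  unfolding TG_carrier by (simp add: tensor_group_def)

lemma TG_add: "x \<in> carrier TG \<Longrightarrow> y \<in> carrier TG \<Longrightarrow> x + y \<in> carrier TG"
  using Poly_Mapping.keys_add[of x y] unfolding TG_carrier by blast

lemma TG_diff: "x \<in> carrier TG \<Longrightarrow> y \<in> carrier TG \<Longrightarrow> x - y \<in> carrier TG"
  using Poly_Mapping.keys_diff[of x y] unfolding TG_carrier by blast

lemma TG_of: "a \<in> carrier HH \<Longrightarrow> v \<in> S0 \<Longrightarrow> frag_of (a, v) \<in> carrier TG"
  by (simp add: TG_carrier)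

lemma TG_tau: "p \<in> carrier FA \<Longrightarrow> v \<in> S0 \<Longrightarrow> \<tau> p v \<in> carrier TG"
  unfolding \<tau>_def by (intro TG_of h_in)

lemma Bact_carrier: "(b, f) \<in> Bact \<Longrightarrow> v \<in> S0 \<Longrightarrow> b \<in> carrier HH \<and> f v \<in> S0"
proof -
  assume b: "(b, f) \<in> Bact" and v: "v \<in> S0"
  from Bact_cases[OF b] show ?thesis
  proof (elim disjE exE bexE conjE)
    fix a assume "b = h (scal a)" "\<forall>v\<in>S0. f v = scale a v"
    then show ?thesis using v h_in[OF FA_scal] S0_scale by simp
  next
    fix w assume "w \<in> carrier (G_r1n r n)" "b = h (tg w)" "\<forall>v\<in>S0. f v = R w v"
    then show ?thesis using v h_in[OF FA_tg] S0_R by simp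
  next
    fix i assume "i \<in> {1..n}" "b = h (yg i)" "\<forall>v\<in>S0. f v = 0"
    then show ?thesis using v h_in[OF FA_yg] S0_0 by simp
  qed
qed

lemma HH_closed:
  assumes "a \<in> carrier HH" "b \<in> carrier HH"
  shows "a \<oplus>\<^bsub>HH\<^esub> b \<in> carrier HH" "a \<otimes>\<^bsub>HH\<^esub> b \<in> carrier HH"
  using assms unfolding carrier_HH by (auto simp: h_add h_mult intro!: imageI FA_add FA_mult)

lemma TR_carrier: "TR \<subseteq> carrier TG"
  unfolding tensor_relations_def using Bact_carrier
  by (auto intro!: TG_diff TG_add TG_of S0_add HH_closed)

lemma TR_add: "a \<in> carrier HH \<Longrightarrow> b \<in> carrier HH \<Longrightarrow> v \<in> S0 \<Longrightarrow>
    frag_of (a \<oplus>\<^bsub>HH\<^esub> b, v) - (frag_of (a, v) + frag_of (b, v)) \<in> TR"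
  and TR_vadd: "a \<in> carrier HH \<Longrightarrow> u \<in> S0 \<Longrightarrow> v \<in> S0 \<Longrightarrow>
    frag_of (a, u + v) - (frag_of (a, u) + frag_of (a, v)) \<in> TR"
  and TR_Bact: "a \<in> carrier HH \<Longrightarrow> (b, f) \<in> Bact \<Longrightarrow> v \<in> S0 \<Longrightarrow>
    frag_of (a \<otimes>\<^bsub>HH\<^esub> b, v) - frag_of (a, f v) \<in> TR"
  unfolding tensor_relations_def by blast+

lemma TN_subgroup: "subgroup TN TG"
  unfolding tensor_kernel_def by (rule group.generate_is_subgroup[OF TG_group TR_carrier])

lemma TN_carrier: "x \<in> TN \<Longrightarrow> x \<in> carrier TG"
  using subgroup.mem_carrier[OF TN_subgroup] .

lemma TN_0: "0 \<in> TN" using subgroup.one_closed[OF TN_subgroup] by simp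
lemma TN_add: "x \<in> TN \<Longrightarrow> y \<in> TN \<Longrightarrow> x + y \<in> TN" using subgroup.m_closed[OF TN_subgroup] by simp
lemma TN_uminus: "x \<in> TN \<Longrightarrow> - x \<in> TN"
  using subgroup.m_inv_closed[OF TN_subgroup] TG_inv[OF TN_carrier] by metis
lemma TN_rel: "x \<in> TR \<Longrightarrow> x \<in> TN"
  unfolding tensor_kernel_def by (rule generate.incl)

text \<open>Equality in the tensor product, for representatives in the free abelian group.\<close>
definition eqv :: "('f free_alg set \<times> 's \<Rightarrow>\<^sub>0 int) \<Rightarrow> ('f free_alg set \<times> 's \<Rightarrow>\<^sub>0 int) \<Rightarrow> bool" (infix "\<doteq>" 50) where
  "x \<doteq> y \<longleftrightarrow> x - y \<in> TN"

lemma eqv_refl [simp]: "x \<doteq> x" by (simp add: eqv_def TN_0)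
lemma eqv_sym: "x \<doteq> y \<Longrightarrow> y \<doteq> x" unfolding eqv_def using TN_uminus[of "x - y"] by simp
lemma eqv_trans [trans]: "x \<doteq> y \<Longrightarrow> y \<doteq> z \<Longrightarrow> x \<doteq> z"
  unfolding eqv_def using TN_add[of "x - y" "y - z"] by simp
lemma eqv_add: "x \<doteq> y \<Longrightarrow> x' \<doteq> y' \<Longrightarrow> x + x' \<doteq> y + y'"
  unfolding eqv_def using TN_add[of "x - y" "x' - y'"] by (simp add: algebra_simps)
lemma eqv_diff: "x \<doteq> y \<Longrightarrow> x' \<doteq> y' \<Longrightarrow> x - x' \<doteq> y - y'"
  unfolding eqv_def using TN_add[of "x - y" "- (x' - y')"] TN_uminus[of "x' - y'"] by (simp add: algebra_simps)
lemma eqv_sum: "(\<And>i. i \<in> A \<Longrightarrow> f i \<doteq> g i) \<Longrightarrow> sum f A \<doteq> sum g A"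
  by (induction A rule: infinite_finite_induct) (auto intro: eqv_add)

lemma tau_add:
  assumes "p \<in> carrier FA" "q \<in> carrier FA" "v \<in> S0"
  shows "\<tau> (p + q) v \<doteq> \<tau> p v + \<tau> q v"
  unfolding eqv_def \<tau>_def h_add[OF assms(1,2), symmetric]
  by (intro TN_rel TR_add h_in assms)

lemma tau_vadd:
  assumes "p \<in> carrier FA" "u \<in> S0" "v \<in> S0"
  shows "\<tau> p (u + v) \<doteq> \<tau> p u + \<tau> p v"
  unfolding eqv_def \<tau>_def
  by (intro TN_rel TR_vadd h_in assms)

lemma tau_Bact:
  assumes "p \<in> carrier FA" "b \<in> carrier FA" "(h b, f) \<in> Bact" "v \<in> S0"
  shows "\<tau> (p * b) v \<doteq> \<tau> p (f v)"
  unfolding eqv_def \<tau>_def h_mult[OF assms(1,2), symmetric]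
  by (intro TN_rel TR_Bact h_in assms)

lemma tau_0: "p \<in> carrier FA \<Longrightarrow> \<tau> p 0 \<doteq> 0"
  using tau_vadd[of p 0 0] eqv_diff[of "\<tau> p 0 + \<tau> p 0" "\<tau> p 0" "\<tau> p 0" "\<tau> p 0"] S0_0
  by (simp add: eqv_sym)

lemma tau_scal: "p \<in> carrier FA \<Longrightarrow> v \<in> S0 \<Longrightarrow> \<tau> (p * scal a) v \<doteq> \<tau> p (scale a v)"
  using Bact_scal[of a] tau_Bact[OF _ FA_scal] by metis

lemma tau_tg: "p \<in> carrier FA \<Longrightarrow> v \<in> S0 \<Longrightarrow> w \<in> carrier (G_r1n r n) \<Longrightarrow> \<tau> (p * tg w) v \<doteq> \<tau> p (R w v)"
  using Bact_tg[of w] tau_Bact[OF _ FA_tg] by metis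

lemma tau_yg: "p \<in> carrier FA \<Longrightarrow> v \<in> S0 \<Longrightarrow> i \<in> {1..n} \<Longrightarrow> \<tau> (p * yg i) v \<doteq> 0"
  using Bact_yg[of i] tau_Bact[OF _ FA_yg] tau_0 eqv_trans by metis

lemma tau_eq: "h p = h q \<Longrightarrow> \<tau> p v = \<tau> q v"
  by (simp add: \<tau>_def)

section \<open>The polynomials that model the module\<close>

text \<open>The part of the polynomial space that corresponds to the induced module: the exponents are
  compositions, and the coefficients lie in \<open>S0\<close>.\<close>
definition V0 :: "'s pol set" where
  "V0 = {P. keys P \<subseteq> compositions n \<and> (\<forall>m. lookup P m \<in> S0)}"

lemma V0_0: "0 \<in> V0" by (simp add: V0_def S0_0)

lemma V0_add: "P \<in> V0 \<Longrightarrow> Q \<in> V0 \<Longrightarrow> P + Q \<in> V0"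
  using Poly_Mapping.keys_add[of P Q] unfolding V0_def by (auto simp: lookup_add S0_add)

lemma V0_scale: "P \<in> V0 \<Longrightarrow> scaleV a P \<in> V0"
  unfolding V0_def by (auto simp: S0_scale in_keys_iff)

lemma V0_uminus: "P \<in> V0 \<Longrightarrow> - P \<in> V0"
  using V0_scale[of P "-1"] by simp

lemma V0_diff: "P \<in> V0 \<Longrightarrow> Q \<in> V0 \<Longrightarrow> P - Q \<in> V0"
  using V0_add[OF _ V0_uminus, of P Q] by simp

lemma V0_sum: "(\<And>i. i \<in> A \<Longrightarrow> f i \<in> V0) \<Longrightarrow> sum f A \<in> V0"
  by (induction A rule: infinite_finite_induct) (auto simp: V0_0 V0_add)

lemma V0_single: "m \<in> compositions n \<Longrightarrow> v \<in> S0 \<Longrightarrow> single m v \<in> V0"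
  unfolding V0_def by (auto simp: lookup_single when_def S0_0)

lemma S0_sum: "(\<And>i. i \<in> A \<Longrightarrow> f i \<in> S0) \<Longrightarrow> sum f A \<in> S0"
  by (induction A rule: infinite_finite_induct) (auto simp: S0_0 S0_add)

lemma V0_linop:
  assumes F: "linop F" and "\<And>m v. m \<in> compositions n \<Longrightarrow> v \<in> S0 \<Longrightarrow> F (single m v) \<in> V0"
    and P: "P \<in> V0"
  shows "F P \<in> V0"
proof -
  have "F P = (\<Sum>k\<in>keys P. F (single k (lookup P k)))"
    by (subst poly_mapping_expand[of P]) (rule linop_sumD[OF F])
  then show ?thesis using P assms(2) unfolding V0_def[THEN eqset_imp_iff, of P]
    by (auto intro!: V0_sum)
qed

lemma V0_X: "k \<in> {1..n} \<Longrightarrow> P \<in> V0 \<Longrightarrow> Xop k P \<in> V0"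
  by (rule V0_linop[OF linop_X']) (auto intro!: V0_single simp: compositions_def)

lemma V0_T:
  assumes "adm r n s c" "P \<in> V0" shows "Tw s c P \<in> V0"
proof (rule V0_linop[OF linop_T' _ assms(2)])
  fix m v assume m: "m \<in> compositions n" and v: "v \<in> S0"
  have p: "s permutes {1..n}" using assms(1) by (simp add: adm_def)
  have "m \<circ> pinv s \<in> compositions n"
    using m permutes_in_image[OF permutes_inv[OF p]] by (auto simp: compositions_def)
  then show "Tw s c (single m v) \<in> V0"
    unfolding T_single by (intro V0_single S0_scale S0_R mono_mat_in_G assms v r_pos)
qed

lemma V0_Y:
  assumes "i \<in> {1..n}" "P \<in> V0" shows "Yop i P \<in> V0"
proof (rule V0_linop[OF linop_Y' _ assms(2)])
  fix m v assume m: "m \<in> compositions n" and v: "v \<in> S0"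
  have mi: "m(i := a) \<in> compositions n" for a using m assms(1) by (auto simp: compositions_def)
  have mij: "m(i := a, j := b) \<in> compositions n" if "j \<in> {1..n}" for a b j
    using m assms(1) that by (auto simp: compositions_def)
  have "nabla_term i j x m (Rf i j x v) e \<in> V0" if "j \<in> {1..n} - {i}" "x \<in> unity_roots r" for j x e
    unfolding nabla_term_def using that assms(1) v
    by (intro V0_single mij S0_scale S0_R mono_mat_in_G adm_refl' r_pos) auto
  then show "Yop i (single m v) \<in> V0"
    unfolding Y_single Y_mono_def nabla_def
    by (intro V0_diff V0_single mi S0_scale S0_sum S0_R V0_scale V0_sum mono_mat_in_G adm_diag' r_pos v) auto
qed

lemma V0_Tm: "w \<in> carrier (G_r1n r n) \<Longrightarrow> P \<in> V0 \<Longrightarrow> Tm w P \<in> V0"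
  unfolding Tm_def by (rule V0_T[OF perm_coef_of(1)])

lemma V0_word: "set gs \<subseteq> gens r n \<Longrightarrow> P \<in> V0 \<Longrightarrow> word_act gs P \<in> V0"
proof (induction gs)
  case (Cons g gs)
  then have "word_act gs P \<in> V0" "g \<in> gens r n" by auto
  then show ?case by (auto simp: gens_def V0_X V0_Y V0_Tm simp del: One_nat_def)
qed simp

lemma V0_act: "p \<in> carrier FA \<Longrightarrow> P \<in> V0 \<Longrightarrow> act p P \<in> V0"
proof -
  assume p: "p \<in> carrier FA" and P: "P \<in> V0"
  have "scaleV (lookup p u) (word_act (letters u) P) \<in> V0" if "u \<in> keys p" for u
    using p that unfolding free_alg_carrier by (intro V0_scale V0_word P) blast
  then show ?thesis unfolding act_def ext_def by (rule V0_sum)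
qed

end

section \<open>The standard module as a space of polynomials\<close>

context cherednik_setup begin

text \<open>Equality in the Cherednik algebra of two elements of the free algebra.\<close>
definition hcong :: "'f free_alg \<Rightarrow> 'f free_alg \<Rightarrow> bool" (infix "\<leadsto>" 50) where
  "a \<leadsto> b \<longleftrightarrow> a \<in> carrier FA \<and> b \<in> carrier FA \<and> a - b \<in> rI"

lemma rI_add: "a \<in> rI \<Longrightarrow> b \<in> rI \<Longrightarrow> a + b \<in> rI"
  using additive_subgroup.a_closed[OF ideal.axioms(1)[OF ideal_rI]] by simp

lemma rI_0: "0 \<in> rI"
  using additive_subgroup.zero_closed[OF ideal.axioms(1)[OF ideal_rI]] by simp

lemma hcong_refl: "a \<in> carrier FA \<Longrightarrow> a \<leadsto> a"
  by (simp add: hcong_def rI_0)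

lemma hcong_trans [trans]: "a \<leadsto> b \<Longrightarrow> b \<leadsto> c \<Longrightarrow> a \<leadsto> c"
  unfolding hcong_def using rI_add[of "a - b" "b - c"] by simp

lemma hcong_mult:
  assumes "a \<leadsto> a'" "b \<leadsto> b'" shows "a * b \<leadsto> a' * b'"
proof -
  have "a * b - a' * b' = (a - a') * b + a' * (b - b')" by (simp add: algebra_simps)
  moreover have "\<dots> \<in> rI"
    using assms unfolding hcong_def by (intro rI_add rI_mult_left rI_mult_right) auto
  ultimately show ?thesis using assms by (simp add: hcong_def FA_mult)
qed

lemma hcong_h: "a \<leadsto> b \<Longrightarrow> h a = h b"
  unfolding hcong_def using h_eq_iff by blast

lemma hcong_rel:
  "a - b \<in> relations emb r n kappa c0 d \<Longrightarrow> a \<in> carrier FA \<Longrightarrow> b \<in> carrier FA \<Longrightarrow> a \<leadsto> b"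
  unfolding hcong_def using relations_rI by blast

lemma FA_power: "p \<in> carrier FA \<Longrightarrow> p ^ e \<in> carrier FA"
  by (induction e) (auto simp: FA_1 FA_mult)

lemma FA_prod_list: "(\<And>p. p \<in> set ps \<Longrightarrow> p \<in> carrier FA) \<Longrightarrow> prod_list ps \<in> carrier FA"
  by (induction ps) (auto simp: FA_1 FA_mult)

lemma x_prod_FA: "set xs \<subseteq> {1..n} \<Longrightarrow> prod_list (map (\<lambda>i. xg i ^ m i) xs) \<in> carrier FA"
  by (intro FA_prod_list) (auto intro!: FA_power FA_xg)

lemma x_pow_FA: "x_pow n m \<in> carrier FA"
  unfolding x_pow_def by (rule x_prod_FA) auto

lemma x_comm:
  assumes "k \<in> {1..n}" "i \<in> {1..n}" shows "xg k * xg i \<leadsto> xg i * xg k"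
proof (rule hcong_rel)
  show "xg k * xg i - xg i * xg k \<in> relations emb r n kappa c0 d"
    unfolding relations_def using assms by blast
qed (use assms in \<open>simp_all add: FA_mult FA_xg del: One_nat_def\<close>)

lemma x_comm_power:
  assumes k: "k \<in> {1..n}" and i: "i \<in> {1..n}"
  shows "xg k * xg i ^ e \<leadsto> xg i ^ e * xg k"
proof (induction e)
  case 0
  then show ?case using hcong_refl[OF FA_xg[OF k]] by simp
next
  case (Suc e)
  have "xg k * xg i ^ Suc e = (xg k * xg i) * xg i ^ e" by (simp add: mult.assoc)
  also have "\<dots> \<leadsto> (xg i * xg k) * xg i ^ e"
    by (rule hcong_mult[OF x_comm[OF k i] hcong_refl[OF FA_power[OF FA_xg[OF i]]]])
  also have "(xg i * xg k) * xg i ^ e = xg i * (xg k * xg i ^ e)" by (simp add: mult.assoc)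
  also have "\<dots> \<leadsto> xg i * (xg i ^ e * xg k)"
    by (rule hcong_mult[OF hcong_refl[OF FA_xg[OF i]] Suc])
  finally show ?case by (simp add: mult.assoc)
qed

lemma x_comm_prod:
  assumes k: "k \<in> {1..n}"
  shows "set xs \<subseteq> {1..n} \<Longrightarrow> xg k * prod_list (map (\<lambda>i. xg i ^ m i) xs) \<leadsto> prod_list (map (\<lambda>i. xg i ^ m i) xs) * xg k"
proof (induction xs)
  case Nil
  then show ?case using hcong_refl[OF FA_xg[OF k]] by simp
next
  case (Cons i xs)
  let ?p = "prod_list (map (\<lambda>i. xg i ^ m i) xs)"
  have i: "i \<in> {1..n}" and xs: "set xs \<subseteq> {1..n}" using Cons(2) by auto
  have "xg k * (xg i ^ m i * ?p) = (xg k * xg i ^ m i) * ?p" by (simp add: mult.assoc)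
  also have "\<dots> \<leadsto> (xg i ^ m i * xg k) * ?p"
    by (rule hcong_mult[OF x_comm_power[OF k i] hcong_refl[OF x_prod_FA[OF xs]]])
  also have "(xg i ^ m i * xg k) * ?p = xg i ^ m i * (xg k * ?p)" by (simp add: mult.assoc)
  also have "\<dots> \<leadsto> xg i ^ m i * (?p * xg k)"
    by (rule hcong_mult[OF hcong_refl[OF FA_power[OF FA_xg[OF i]]] Cons(1)[OF xs]])
  finally show ?case by (simp add: mult.assoc)
qed

text \<open>The variables commute in the algebra, so \<open>x\<^sub>k\<close> can be moved to its place in the ordered monomial.\<close>
lemma x_pow_step:
  assumes k: "k \<in> {1..n}"
  shows "xg k * x_pow n m \<leadsto> x_pow n (m(k := m k + 1))"
proof -
  let ?f = "\<lambda>i. xg i ^ m i :: 'f free_alg"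
  let ?a = "prod_list (map ?f [1..<k])" and ?b = "prod_list (map ?f [k+1..<n+1])"
  have "[1..<n+1] = [1..<k] @ [k..<n+1]" using k upt_add_eq_append[of 1 k "n + 1 - k"] by auto
  moreover have "[k..<n+1] = k # [k+1..<n+1]" using upt_conv_Cons[of k "n + 1"] k by simp
  ultimately have l: "[1..<n+1] = [1..<k] @ k # [k+1..<n+1]" by simp
  have 1: "x_pow n m = ?a * (xg k ^ m k * ?b)" unfolding x_pow_def l by simp
  have 2: "x_pow n (m(k := m k + 1)) = ?a * (xg k * xg k ^ m k * ?b)"
  proof -
    have M: "map (\<lambda>i. xg i ^ (m(k := m k + 1)) i) [1..<k] = map ?f [1..<k]"
      "map (\<lambda>i. xg i ^ (m(k := m k + 1)) i) [k+1..<n+1] = map ?f [k+1..<n+1]"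
      by (auto intro!: map_cong)
    have "xg k ^ (m k + 1) = xg k * (xg k :: 'f free_alg) ^ m k" by simp
    then show ?thesis
      unfolding x_pow_def l by (simp only: map_append list.map M prod_list.append prod_list.Cons fun_upd_same mult.assoc)
  qed
  have s: "set [1..<k] \<subseteq> {1..n}" "set [k+1..<n+1] \<subseteq> {1..n}" using k by auto
  have "xg k * x_pow n m = (xg k * ?a) * (xg k ^ m k * ?b)" unfolding 1 by (simp add: mult.assoc)
  also have "\<dots> \<leadsto> (?a * xg k) * (xg k ^ m k * ?b)"
    by (rule hcong_mult[OF x_comm_prod[OF k s(1)]
          hcong_refl[OF FA_mult[OF FA_power[OF FA_xg[OF k]] x_prod_FA[OF s(2)]]]])
  also have "\<dots> = x_pow n (m(k := m k + 1))" unfolding 2 by (simp add: mult.assoc)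
  finally show ?thesis .
qed

end

context induced_model begin

text \<open>A representative of \<open>q \<cdot> P\<close> in the tensor product, where the polynomial \<open>P\<close> stands for
  \<open>\<Sum>\<^sub>m x\<^sup>m \<otimes> P\<^sub>m\<close>. The left factor \<open>q\<close> is carried along so that statements about it can be applied
  inside products.\<close>
definition expand :: "'f free_alg \<Rightarrow> 's pol \<Rightarrow> ('f free_alg set \<times> 's \<Rightarrow>\<^sub>0 int)" where
  "expand q P = (\<Sum>m\<in>keys P. \<tau> (q * x_pow n m) (lookup P m))"

lemma V0_lookup: "P \<in> V0 \<Longrightarrow> lookup P m \<in> S0"
  by (simp add: V0_def)

lemma expand_carrier: "q \<in> carrier FA \<Longrightarrow> P \<in> V0 \<Longrightarrow> expand q P \<in> carrier TG"
  unfolding expand_def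
  using sum_closed_free_Abelian_group[of "keys P" "\<lambda>m. \<tau> (q * x_pow n m) (lookup P m)" "carrier HH \<times> S0"]
    TG_tau[OF FA_mult[OF _ x_pow_FA]] V0_lookup
  by (simp add: tensor_group_def)

lemma expand_superset:
  assumes "finite A" "keys P \<subseteq> A" "q \<in> carrier FA"
  shows "expand q P \<doteq> (\<Sum>m\<in>A. \<tau> (q * x_pow n m) (lookup P m))"
proof -
  have "(\<Sum>m\<in>A - keys P. \<tau> (q * x_pow n m) (lookup P m))
      \<doteq> (\<Sum>m\<in>A - keys P. 0)"
    by (intro eqv_sum) (auto simp: in_keys_iff intro!: tau_0 FA_mult x_pow_FA assms)
  then have "expand q P + 0 \<doteq> expand q P + (\<Sum>m\<in>A - keys P. \<tau> (q * x_pow n m) (lookup P m))"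
    by (intro eqv_add eqv_refl) (auto intro: eqv_sym)
  also have "\<dots> = (\<Sum>m\<in>A. \<tau> (q * x_pow n m) (lookup P m))"
    unfolding expand_def
    using sum.subset_diff[OF assms(2,1), of "\<lambda>m. \<tau> (q * x_pow n m) (lookup P m)"]
    by (simp only: add.commute)
  finally show ?thesis by simp
qed

lemma expand_add:
  assumes q: "q \<in> carrier FA" and P: "P \<in> V0" and Q: "Q \<in> V0"
  shows "expand q (P + Q) \<doteq> expand q P + expand q Q"
proof -
  let ?A = "keys P \<union> keys Q"
  have "expand q (P + Q) \<doteq> (\<Sum>m\<in>?A. \<tau> (q * x_pow n m) (lookup (P + Q) m))"
    by (rule expand_superset) (use Poly_Mapping.keys_add[of P Q] q in auto)
  also have "\<dots> \<doteq> (\<Sum>m\<in>?A. \<tau> (q * x_pow n m) (lookup P m) + \<tau> (q * x_pow n m) (lookup Q m))"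
    unfolding lookup_add by (intro eqv_sum tau_vadd FA_mult x_pow_FA q V0_lookup P Q)
  also have "\<dots> = (\<Sum>m\<in>?A. \<tau> (q * x_pow n m) (lookup P m)) + (\<Sum>m\<in>?A. \<tau> (q * x_pow n m) (lookup Q m))"
    by (rule sum.distrib)
  also have "\<dots> \<doteq> expand q P + expand q Q"
    by (intro eqv_add eqv_sym[OF expand_superset] q) auto
  finally show ?thesis .
qed

lemma expand_0 [simp]: "expand q 0 = 0" by (simp add: expand_def)

lemma expand_diff:
  assumes q: "q \<in> carrier FA" and P: "P \<in> V0" and Q: "Q \<in> V0"
  shows "expand q (P - Q) \<doteq> expand q P - expand q Q"
proof -
  have "expand q (P - Q + Q) - expand q Q \<doteq> expand q (P - Q) + expand q Q - expand q Q"
    by (intro eqv_diff expand_add q V0_diff P Q eqv_refl)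
  then show ?thesis by (simp add: eqv_sym)
qed

lemma expand_sum:
  assumes "\<And>i. i \<in> A \<Longrightarrow> f i \<in> V0" "q \<in> carrier FA"
  shows "expand q (sum f A) \<doteq> (\<Sum>i\<in>A. expand q (f i))"
  using assms(1)
proof (induction A rule: infinite_finite_induct)
  case (insert i A)
  have "expand q (f i + sum f A) \<doteq> expand q (f i) + expand q (sum f A)"
    using insert by (intro expand_add assms(2) V0_sum) auto
  also have "\<dots> \<doteq> expand q (f i) + (\<Sum>i\<in>A. expand q (f i))"
    using insert by (intro eqv_add eqv_refl) auto
  finally show ?case using insert by simp
qed simp_all

lemma expand_single:
  assumes "q \<in> carrier FA"
  shows "expand q (single m v) \<doteq> \<tau> (q * x_pow n m) v"
  using expand_superset[of "{m}" "single m v" q] assms by simp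

lemma expand_qadd:
  assumes "q \<in> carrier FA" "q' \<in> carrier FA" "P \<in> V0"
  shows "expand (q + q') P \<doteq> expand q P + expand q' P"
  unfolding expand_def sum.distrib[symmetric] distrib_right
  by (intro eqv_sum tau_add FA_mult x_pow_FA V0_lookup assms)

lemma expand_scal:
  assumes q: "q \<in> carrier FA" and P: "P \<in> V0"
  shows "expand (q * scal a) P \<doteq> expand q (scaleV a P)"
proof -
  have "expand (q * scal a) P \<doteq> (\<Sum>m\<in>keys P. \<tau> (q * x_pow n m) (lookup (scaleV a P) m))"
    unfolding expand_def lookup_scaleV mult.assoc[of q "scal a"] scal_commute mult.assoc[symmetric]
    by (intro eqv_sum tau_scal FA_mult x_pow_FA V0_lookup assms)
  also have "\<dots> \<doteq> expand q (scaleV a P)"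
    by (rule eqv_sym[OF expand_superset]) (auto simp: in_keys_iff q)
  finally show ?thesis .
qed

lemma expand_hcong:
  assumes "q \<leadsto> q'" shows "expand q P = expand q' P"
  unfolding expand_def
  by (intro sum.cong refl tau_eq hcong_h hcong_mult[OF assms hcong_refl[OF x_pow_FA]])

text \<open>The action of \<open>p\<close> on polynomials agrees with multiplication by \<open>p\<close> in the tensor product.\<close>
definition compat :: "'f free_alg \<Rightarrow> bool" where
  "compat p \<longleftrightarrow> p \<in> carrier FA \<and> (\<forall>q\<in>carrier FA. \<forall>P\<in>V0. expand (q * p) P \<doteq> expand q (act p P))"

lemma compatD: "compat p \<Longrightarrow> q \<in> carrier FA \<Longrightarrow> P \<in> V0 \<Longrightarrow> expand (q * p) P \<doteq> expand q (act p P)"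
  and compat_FA: "compat p \<Longrightarrow> p \<in> carrier FA"
  by (simp_all add: compat_def)

lemma compat_scal: "compat (scal a)"
  unfolding compat_def by (simp add: FA_scal expand_scal)

lemma compat_mult:
  assumes "compat p" "compat p'" shows "compat (p * p')"
  unfolding compat_def
proof (intro conjI ballI)
  show "p * p' \<in> carrier FA" using assms compat_FA FA_mult by blast
  fix q P assume q: "q \<in> carrier FA" and P: "P \<in> V0"
  have "expand (q * (p * p')) P \<doteq> expand (q * p) (act p' P)"
    unfolding mult.assoc[symmetric] by (intro compatD assms FA_mult q compat_FA P)
  also have "\<dots> \<doteq> expand q (act p (act p' P))"
    by (intro compatD assms q V0_act compat_FA P)
  finally show "expand (q * (p * p')) P \<doteq> expand q (act (p * p') P)" by (simp add: act_mult)
qed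

lemma compat_add:
  assumes "compat p" "compat p'" shows "compat (p + p')"
  unfolding compat_def
proof (intro conjI ballI)
  show "p + p' \<in> carrier FA" using assms compat_FA FA_add by blast
  fix q P assume q: "q \<in> carrier FA" and P: "P \<in> V0"
  have "expand (q * (p + p')) P \<doteq> expand (q * p) P + expand (q * p') P"
    unfolding distrib_left by (intro expand_qadd FA_mult q compat_FA assms P)
  also have "\<dots> \<doteq> expand q (act p P) + expand q (act p' P)"
    by (intro eqv_add compatD assms q P)
  also have "\<dots> \<doteq> expand q (act p P + act p' P)"
    by (intro eqv_sym[OF expand_add] q V0_act compat_FA assms P)
  finally show "expand (q * (p + p')) P \<doteq> expand q (act (p + p') P)" by (simp add: act_add)
qed

lemma compat_0: "compat 0"
  using compat_scal[of 0] by (simp add: scal_def)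

lemma compat_diff: "compat p \<Longrightarrow> compat p' \<Longrightarrow> compat (p - p')"
proof -
  assume a: "compat p" "compat p'"
  have "scal (- 1) = - (1 :: 'f free_alg)"
    by (simp add: scal_def single_uminus)
  then show ?thesis using compat_add[OF a(1) compat_mult[OF compat_scal[of "-1"] a(2)]] by simp
qed

lemma compat_sum: "(\<And>i. i \<in> A \<Longrightarrow> compat (f i)) \<Longrightarrow> compat (sum f A)"
  by (induction A rule: infinite_finite_induct) (auto simp: compat_0 compat_add)

lemma compatI_single:
  assumes p: "p \<in> carrier FA"
    and *: "\<And>q m v. q \<in> carrier FA \<Longrightarrow> m \<in> compositions n \<Longrightarrow> v \<in> S0 \<Longrightarrow>
       expand (q * p) (single m v) \<doteq> expand q (act p (single m v))"
  shows "compat p"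
  unfolding compat_def
proof (intro conjI ballI p)
  fix q P assume q: "q \<in> carrier FA" and P: "P \<in> V0"
  let ?s = "\<lambda>m. single m (lookup P m)"
  let ?A = "keys P"
  have s: "?s m \<in> V0" and m: "m \<in> compositions n" if "m \<in> ?A" for m
    using that P V0_single[of m "lookup P m"] by (auto simp: V0_def)
  have PE: "P = sum ?s ?A" by (rule poly_mapping_expand)
  have "expand (q * p) (sum ?s ?A) \<doteq> (\<Sum>m\<in>?A. expand (q * p) (?s m))"
    by (intro expand_sum s FA_mult q p)
  also have "\<dots> \<doteq> (\<Sum>m\<in>?A. expand q (act p (?s m)))"
    by (intro eqv_sum * q m V0_lookup P)
  also have "\<dots> \<doteq> expand q (\<Sum>m\<in>?A. act p (?s m))"
    by (intro eqv_sym[OF expand_sum] V0_act p s q)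
  also have "(\<Sum>m\<in>?A. act p (?s m)) = act p (sum ?s ?A)"
    by (rule linop_sumD[OF linop_act', symmetric])
  finally show "expand (q * p) P \<doteq> expand q (act p P)" unfolding PE[symmetric] .
qed

lemma compat_xg:
  assumes k: "k \<in> {1..n}" shows "compat (xg k)"
proof (rule compatI_single[OF FA_xg[OF k]])
  fix q m v assume q: "q \<in> carrier FA" and "m \<in> compositions n" and v: "v \<in> S0"
  have "expand (q * xg k) (single m v) \<doteq> \<tau> (q * xg k * x_pow n m) v"
    by (intro expand_single FA_mult q FA_xg k)
  also have "\<dots> = \<tau> (q * x_pow n (m(k := m k + 1))) v"
    unfolding mult.assoc
    by (rule tau_eq[OF hcong_h[OF hcong_mult[OF hcong_refl[OF q] x_pow_step[OF k]]]])
  also have "\<dots> \<doteq> expand q (act (xg k) (single m v))"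
    using eqv_sym[OF expand_single[OF q, of "m(k := m k + 1)" v]] by simp
  finally show "expand (q * xg k) (single m v) \<doteq> expand q (act (xg k) (single m v))" .
qed

text \<open>Induction on the degree: if \<open>p x\<^sub>k\<close> can be rewritten as \<open>p' p + e\<close> with \<open>p'\<close> and \<open>e\<close> already known
  to be compatible, then \<open>p\<close> can be moved through a monomial one variable at a time. The relations of the
  algebra have this form for \<open>p = t\<^sub>w\<close> (with \<open>e = 0\<close>) and for \<open>p = y\<^sub>i\<close> (with \<open>p' = x\<^sub>k\<close>).\<close>
lemma compat_by_relation:
  assumes p: "p \<in> carrier FA"
    and base: "\<And>q v. q \<in> carrier FA \<Longrightarrow> v \<in> S0 \<Longrightarrow>
       expand (q * p) (single (\<lambda>_. 0) v) \<doteq> expand q (act p (single (\<lambda>_. 0) v))"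
    and rel: "\<And>k. k \<in> {1..n} \<Longrightarrow> \<exists>p' e. compat p' \<and> compat e \<and> p * xg k - (p' * p + e) \<in> relations emb r n kappa c0 d"
  shows "compat p"
proof (rule compatI_single[OF p])
  fix q m v assume "q \<in> carrier FA" "m \<in> compositions n" and v: "v \<in> S0"
  then show "expand (q * p) (single m v) \<doteq> expand q (act p (single m v))"
  proof (induction "\<Sum>k\<in>{1..n}. m k" arbitrary: m q)
    case 0
    then have "m k = 0" for k by (cases "k \<in> {1..n}") (auto simp: compositions_def)
    then have "m = (\<lambda>_. 0)" by blast
    then show ?case using base 0 v by simp
  next
    case (Suc s)
    then obtain k where k: "k \<in> {1..n}" "m k \<noteq> 0"
      by (metis sum.neutral nat.distinct(1))
    let ?m = "m(k := m k - 1)"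
    let ?P = "single ?m v"
    have m: "?m(k := ?m k + 1) = m" using k by (auto simp: fun_eq_iff)
    have XP: "Xop k ?P = single m v" by (simp only: X_single m)
    have mc: "?m \<in> compositions n" using Suc(4) k by (auto simp: compositions_def)
    have P: "?P \<in> V0" by (intro V0_single mc v)
    have "(\<Sum>k\<in>{1..n}. m k) = m k + (\<Sum>k\<in>{1..n}-{k}. m k)"
      using k by (intro sum.remove) auto
    moreover have "(\<Sum>k\<in>{1..n}. ?m k) = ?m k + (\<Sum>j\<in>{1..n}-{k}. ?m j)"
      using k by (intro sum.remove) auto
    moreover have "(\<Sum>j\<in>{1..n}-{k}. ?m j) = (\<Sum>k\<in>{1..n}-{k}. m k)"
      by (intro sum.cong) auto
    ultimately have sk: "s = (\<Sum>k\<in>{1..n}. ?m k)" using Suc(2) k by simp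
    have IH: "expand (q' * p) ?P \<doteq> expand q' (act p ?P)" if "q' \<in> carrier FA" for q'
      using Suc(1)[OF sk that mc v] .
    obtain p' e where g: "compat p'" "compat e" and re: "p * xg k - (p' * p + e) \<in> relations emb r n kappa c0 d"
      using rel[OF k(1)] by blast
    have FAs: "p' \<in> carrier FA" "e \<in> carrier FA" "q * p' \<in> carrier FA" "q * p \<in> carrier FA"
      "q * p' * p \<in> carrier FA" "q * e \<in> carrier FA" "p * xg k \<in> carrier FA" "p' * p + e \<in> carrier FA"
      using g[THEN compat_FA] p Suc(3) by (simp_all add: FA_mult FA_add FA_xg[OF k(1)])
    have V: "act p ?P \<in> V0" "act e ?P \<in> V0" "act p' (act p ?P) \<in> V0"
      using V0_act P p FAs(1,2) by blast+
    have "expand (q * p) (Xop k ?P) \<doteq> expand (q * p * xg k) ?P"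
      using eqv_sym[OF compatD[OF compat_xg[OF k(1)] FAs(4) P]] by (simp only: act_xg)
    also have "\<dots> = expand (q * (p' * p + e)) ?P"
      unfolding mult.assoc[of q p] by (rule expand_hcong[OF hcong_mult[OF hcong_refl[OF Suc(3)] hcong_rel[OF re FAs(7,8)]]])
    also have "\<dots> = expand (q * p' * p + q * e) ?P" by (simp only: distrib_left mult.assoc)
    also have "\<dots> \<doteq> expand (q * p' * p) ?P + expand (q * e) ?P" by (rule expand_qadd[OF FAs(5,6) P])
    also have "\<dots> \<doteq> expand (q * p') (act p ?P) + expand q (act e ?P)"
      by (rule eqv_add[OF IH[OF FAs(3)] compatD[OF g(2) Suc(3) P]])
    also have "\<dots> \<doteq> expand q (act p' (act p ?P)) + expand q (act e ?P)"
      by (rule eqv_add[OF compatD[OF g(1) Suc(3) V(1)] eqv_refl])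
    also have "\<dots> \<doteq> expand q (act p' (act p ?P) + act e ?P)"
      by (rule eqv_sym[OF expand_add[OF Suc(3) V(3,2)]])
    also have "act p' (act p ?P) + act e ?P = act p (Xop k ?P)"
      using act_relations[OF re, of ?P] by (simp add: act_diff act_add act_mult del: X_single)
    finally show ?case unfolding XP .
  qed
qed

lemma x_pow_0: "x_pow n (\<lambda>_. 0) = 1"
  unfolding x_pow_def by (induction "[1..<n+1]") (simp_all add: map_replicate_const)

lemma compat_tg:
  assumes w: "w \<in> carrier (G_r1n r n)" shows "compat (tg w)"
proof (rule compat_by_relation[OF FA_tg[OF w]])
  fix q v assume q: "q \<in> carrier FA" and v: "v \<in> S0"
  have T0: "Tm w (single (\<lambda>_. 0) v) = single (\<lambda>_. 0) (R w v)"
    using perm_coef_of(2)[OF w] by (simp add: Tm_def T_single comp_def)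
  have "expand (q * tg w) (single (\<lambda>_. 0) v) \<doteq> \<tau> (q * tg w) v"
    using expand_single[of "q * tg w" "\<lambda>_. 0" v] FA_mult[OF q FA_tg[OF w]] by (simp add: x_pow_0)
  also have "\<dots> \<doteq> \<tau> q (R w v)" by (rule tau_tg[OF q v w])
  also have "\<dots> \<doteq> expand q (single (\<lambda>_. 0) (R w v))"
    using expand_single[OF q, of "\<lambda>_. 0" "R w v"] by (simp add: x_pow_0 eqv_sym)
  finally show "expand (q * tg w) (single (\<lambda>_. 0) v) \<doteq> expand q (act (tg w) (single (\<lambda>_. 0) v))"
    by (simp add: T0)
next
  fix k assume k: "k \<in> {1..n}"
  let ?p = "\<Sum>j \<in> {1..n}. scal (emb ((inv\<^bsub>G_r1n r n\<^esub> w) $$ (k - 1, j - 1))) * xg j"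
  have "compat ?p" by (intro compat_sum compat_mult compat_scal compat_xg)
  moreover have "tg w * xg k - ?p * tg w \<in> relations emb r n kappa c0 d"
    unfolding relations_def using w k by blast
  then have "tg w * xg k - (?p * tg w + 0) \<in> relations emb r n kappa c0 d"
    unfolding add_0_right .
  ultimately show "\<exists>p' e. compat p' \<and> compat e \<and> tg w * xg k - (p' * tg w + e) \<in> relations emb r n kappa c0 d"
    using compat_0 by blast
qed

lemma compat_yg:
  assumes i: "i \<in> {1..n}" shows "compat (yg i)"
proof (rule compat_by_relation[OF FA_yg[OF i]])
  fix q v assume q: "q \<in> carrier FA" and v: "v \<in> S0"
  have "expand (q * yg i) (single (\<lambda>_. 0) v) \<doteq> \<tau> (q * yg i) v"
    using expand_single[of "q * yg i" "\<lambda>_. 0" v] FA_mult[OF q FA_yg[OF i]] by (simp add: x_pow_0)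
  also have "\<dots> \<doteq> 0" by (rule tau_yg[OF q v i])
  finally show "expand (q * yg i) (single (\<lambda>_. 0) v) \<doteq> expand q (act (yg i) (single (\<lambda>_. 0) v))"
    using Y_base[of "\<lambda>_. 0" i v] i by simp
next
  fix k assume k: "k \<in> {1..n}"
  show "\<exists>p' e. compat p' \<and> compat e \<and> yg i * xg k - (p' * yg i + e) \<in> relations emb r n kappa c0 d"
  proof (cases "i = k")
    case False
    let ?e = "scal c0 * (\<Sum>l<r. scal (emb (zeta r powi (- int l))) * tg (refl_mat r n i k l))"
    have "compat ?e" by (intro compat_mult compat_sum compat_scal compat_tg refl_mat_in_G i k False)
    moreover have "yg i * xg k - (xg k * yg i + ?e) \<in> relations emb r n kappa c0 d"
      unfolding relations_def using False i k by blast
    ultimately show ?thesis using compat_xg[OF k] by blast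
  next
    case True
    let ?e = "scal kappa - (\<Sum>j<r. scal (d_ext r d (int j) - d_ext r d (int j - 1)) * idem emb r n i j)
          - scal c0 * (\<Sum>j \<in> {1..n} - {i}. refl_sum r n i j)"
    have "compat (refl_sum r n i j)" if "j \<in> {1..n} - {i}" for j
      unfolding refl_sum_def using that by (intro compat_sum compat_tg refl_mat_in_G i) auto
    then have "compat ?e"
      unfolding idem_def by (intro compat_diff compat_mult compat_sum compat_scal compat_tg zeta_pow_in_G)
    moreover have "yg i * xg i - (xg i * yg i + ?e) \<in> relations emb r n kappa c0 d"
    proof -
      have "yg i * xg i - (xg i * yg i + ?e) = yg i * xg i - (xg i * yg i + scal kappa
          - (\<Sum>j<r. scal (d_ext r d (int j) - d_ext r d (int j - 1)) * idem emb r n i j)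
          - scal c0 * (\<Sum>j \<in> {1..n} - {i}. refl_sum r n i j))" by (simp add: algebra_simps)
      then show ?thesis unfolding relations_def using i by blast
    qed
    ultimately show ?thesis using compat_xg[OF k] True by blast
  qed
qed

lemma compat_word: "set gs \<subseteq> gens r n \<Longrightarrow> compat (single (Word gs) a)"
proof (induction gs)
  case Nil
  then show ?case using compat_scal[of a] by (simp add: scal_def zero_word_def)
next
  case (Cons g gs)
  have "compat (single (Word [g]) 1)"
  proof -
    from Cons(2) have "g \<in> gens r n" by simp
    then consider i where "g = GX i" "i \<in> {1..n}" | i where "g = GY i" "i \<in> {1..n}"
      | w where "g = GT w" "w \<in> carrier (G_r1n r n)"
      unfolding gens_def by blast
    then show ?thesis
      using compat_xg compat_yg compat_tg by cases (simp_all add: xg_def yg_def tg_def del: One_nat_def)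
  qed
  then have "compat (single (Word [g]) 1 * single (Word gs) a)"
    using Cons by (intro compat_mult) auto
  then show ?case by (simp add: mult_single plus_word_def)
qed

text \<open>Hence every \<open>a \<otimes> v\<close> equals a sum of elements \<open>x\<^sup>m \<otimes> v'\<close>, namely the one given by the action
  of \<open>a\<close> on polynomials.\<close>
lemma compat_all:
  assumes "p \<in> carrier FA" shows "compat p"
proof -
  have "compat (single u (lookup p u))" if "u \<in> keys p" for u
    using compat_word[of "letters u"] that assms unfolding free_alg_carrier by (cases u) auto
  then show ?thesis by (subst poly_mapping_expand[of p]) (rule compat_sum)
qed

section \<open>The isomorphism with the induced module\<close>

text \<open>The map \<open>a \<otimes> v \<mapsto> a (1 \<otimes> v)\<close> on representatives.\<close>
definition tensor_eval :: "('f free_alg set \<times> 's \<Rightarrow>\<^sub>0 int) \<Rightarrow> 's pol" where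
  "tensor_eval = ext (\<lambda>av z. scaleV (of_int z) (class_act (fst av) (single (\<lambda>_. 0) (snd av))))"

lemma tensor_eval_add: "tensor_eval (x + y) = tensor_eval x + tensor_eval y"
  unfolding tensor_eval_def by (rule ext_add) (simp add: V.scale_left_distrib)

lemma additive_tensor_eval: "Modules.additive tensor_eval" by unfold_locales (rule tensor_eval_add)
lemmas tensor_eval_0 = Modules.additive.zero[OF additive_tensor_eval]
lemmas tensor_eval_diff = Modules.additive.diff[OF additive_tensor_eval]
lemmas tensor_eval_minus = Modules.additive.minus[OF additive_tensor_eval]
lemmas tensor_eval_sum = Modules.additive.sum[OF additive_tensor_eval]

lemma tensor_eval_of: "tensor_eval (frag_of (a, v)) = class_act a (single (\<lambda>_. 0) v)"
  by (simp add: tensor_eval_def ext_single)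

lemma tensor_eval_of_h: "p \<in> carrier FA \<Longrightarrow> tensor_eval (frag_of (h p, v)) = act p (single (\<lambda>_. 0) v)"
  by (simp add: tensor_eval_of class_act_h)

lemma tensor_eval_TR: "x \<in> TR \<Longrightarrow> tensor_eval x = 0"
proof -
  assume "x \<in> TR"
  then consider (1) a a' v where "x = frag_of (a \<oplus>\<^bsub>HH\<^esub> a', v) - (frag_of (a, v) + frag_of (a', v))"
      "a \<in> carrier HH" "a' \<in> carrier HH"
    | (2) a v v' where "x = frag_of (a, v + v') - (frag_of (a, v) + frag_of (a, v'))"
      "a \<in> carrier HH"
    | (3) a b f v where "x = frag_of (a \<otimes>\<^bsub>HH\<^esub> b, v) - frag_of (a, f v)" "a \<in> carrier HH" "(b, f) \<in> Bact" "v \<in> S0"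
    unfolding tensor_relations_def by blast
  then show ?thesis
  proof cases
    case 1
    then obtain p p' where "a = h p" "p \<in> carrier FA" "a' = h p'" "p' \<in> carrier FA"
      unfolding carrier_HH by blast
    then show ?thesis unfolding 1(1)
      by (simp add: tensor_eval_diff tensor_eval_add h_add tensor_eval_of_h FA_add act_add)
  next
    case 2
    then obtain p where "a = h p" "p \<in> carrier FA" unfolding carrier_HH by blast
    then show ?thesis unfolding 2(1)
      by (simp add: tensor_eval_diff tensor_eval_add tensor_eval_of_h single_add linop_addD[OF linop_act'])
  next
    case 3
    then obtain p where p: "a = h p" "p \<in> carrier FA" unfolding carrier_HH by blast
    from Bact_cases[OF 3(3)]
    obtain b' where b': "b = h b'" "b' \<in> carrier FA"
      "act b' (single (\<lambda>_. 0) v) = single (\<lambda>_. 0) (f v)"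
    proof (elim disjE exE bexE conjE)
      fix a assume "b = h (scal a)" "\<forall>v\<in>S0. f v = scale a v"
      then show thesis using that[of "scal a"] 3(4) by (simp add: FA_scal)
    next
      fix w assume w: "w \<in> carrier (G_r1n r n)" "b = h (tg w)" "\<forall>v\<in>S0. f v = R w v"
      have "Tm w (single (\<lambda>_. 0) v) = single (\<lambda>_. 0) (R w v)"
        using perm_coef_of(2)[OF w(1)] by (simp add: Tm_def T_single comp_def)
      then show thesis using that[of "tg w"] w 3(4) by (simp add: FA_tg)
    next
      fix i assume i: "i \<in> {1..n}" "b = h (yg i)" "\<forall>v\<in>S0. f v = 0"
      from i show thesis using that[of "yg i"] 3(4) Y_base[of "\<lambda>_. 0" i v] by (simp add: FA_yg)
    qed
    then show ?thesis unfolding 3(1)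
      by (simp add: tensor_eval_diff p h_mult tensor_eval_of_h FA_mult act_mult)
  qed
qed

lemma tensor_eval_TN: "x \<in> TN \<Longrightarrow> tensor_eval x = 0"
  unfolding tensor_kernel_def
proof (induction rule: generate.induct)
  case (inv g)
  then have "inv\<^bsub>TG\<^esub> g = - g" using TR_carrier TG_inv by blast
  then show ?case using tensor_eval_TR[OF inv] by (simp add: tensor_eval_minus)
qed (simp_all add: tensor_eval_0 tensor_eval_TR tensor_eval_add)

lemma act_xg_power: "act (xg i ^ e) (single m v) = single (m(i := m i + e)) v"
proof (induction e)
  case (Suc e)
  have "m(i := m i + e, i := (m(i := m i + e)) i + 1) = m(i := m i + Suc e)" by simp
  then show ?case by (simp only: power_Suc act_mult Suc act_xg X_single)
qed simp

lemma act_x_prod: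
  "distinct xs \<Longrightarrow> act (prod_list (map (\<lambda>i. xg i ^ m i) xs)) (single m0 v)
    = single (\<lambda>j. m0 j + (if j \<in> set xs then m j else 0)) v"
proof (induction xs)
  case (Cons i xs)
  have "(\<lambda>j. m0 j + (if j \<in> set xs then m j else 0))(i := m0 i + (if i \<in> set xs then m i else 0) + m i)
     = (\<lambda>j. m0 j + (if j \<in> set (i # xs) then m j else 0))"
    using Cons(2) by (auto simp: fun_eq_iff)
  then show ?case using Cons by (simp add: act_mult act_xg_power)
qed simp

lemma act_x_pow:
  assumes "m \<in> compositions n"
  shows "act (x_pow n m) (single (\<lambda>_. 0) v) = single m v"
proof -
  have "(\<lambda>j. 0 + (if j \<in> set [1..<n+1] then m j else 0)) = m"
    using assms by (auto simp: fun_eq_iff compositions_def)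
  then show ?thesis unfolding x_pow_def by (subst act_x_prod) simp_all
qed

lemma tensor_eval_expand:
  assumes "q \<in> carrier FA" "P \<in> V0"
  shows "tensor_eval (expand q P) = act q P"
proof -
  have "tensor_eval (expand q P) = (\<Sum>m\<in>keys P. act q (single m (lookup P m)))"
    unfolding expand_def tensor_eval_sum \<tau>_def
  proof (intro sum.cong refl)
    fix m assume "m \<in> keys P"
    then have "m \<in> compositions n" using assms by (auto simp: V0_def)
    then show "tensor_eval (frag_of (h (q * x_pow n m), lookup P m))
      = act q (single m (lookup P m))"
      by (simp add: tensor_eval_of_h FA_mult x_pow_FA assms act_mult act_x_pow)
  qed
  also have "\<dots> = act q P"
    by (subst (3) poly_mapping_expand[of P]) (rule linop_sumD[OF linop_act', symmetric])
  finally show ?thesis .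
qed

lemma tensor_eval_V0_eqv:
  assumes "x \<in> carrier TG"
  shows "tensor_eval x \<in> V0 \<and> x \<doteq> expand 1 (tensor_eval x)"
proof -
  have "keys x \<subseteq> carrier HH \<times> S0" using assms by (simp add: TG_carrier)
  then show ?thesis
  proof (induction rule: frag_induction)
    case zero
    then show ?case by (simp add: tensor_eval_0 V0_0)
  next
    case (one av)
    then obtain p v where av: "av = (h p, v)" "p \<in> carrier FA" "v \<in> S0" unfolding carrier_HH by blast
    let ?s = "single (\<lambda>_. 0::nat) v"
    have s: "?s \<in> V0" by (intro V0_single av) (simp add: compositions_def)
    have "frag_of av \<doteq> expand p ?s"
      using expand_single[OF av(2), of "\<lambda>_. 0" v] by (simp add: av(1) x_pow_0 \<tau>_def eqv_sym)
    also have "\<dots> \<doteq> expand 1 (act p ?s)"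
      using compatD[OF compat_all[OF av(2)] FA_1 s] by simp
    finally show ?case using V0_act[OF av(2) s] by (simp add: av tensor_eval_of_h)
  next
    case (diff a b)
    have "a - b \<doteq> expand 1 (tensor_eval a) - expand 1 (tensor_eval b)" using diff by (intro eqv_diff) auto
    also have "\<dots> \<doteq> expand 1 (tensor_eval a - tensor_eval b)"
      using diff by (intro eqv_sym[OF expand_diff] FA_1) auto
    finally show ?case using diff by (simp add: tensor_eval_diff V0_diff)
  qed
qed

text \<open>By \<open>compat_all\<close> an element is determined modulo the tensor relations by its polynomial; so the
  kernel of the map to polynomials is no larger than the tensor relations demand.\<close>
lemma TN_iff: "x \<in> carrier TG \<Longrightarrow> x \<in> TN \<longleftrightarrow> tensor_eval x = 0"
  using tensor_eval_TN tensor_eval_V0_eqv[of x] by (auto simp: eqv_def)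

text \<open>The element of the induced module with the given polynomial, as a coset.\<close>
definition of_model :: "'s pol \<Rightarrow> ('f free_alg set \<times> 's \<Rightarrow>\<^sub>0 int) set" where
  "of_model P = {x \<in> carrier TG. tensor_eval x = P}"

lemma coset_of_model:
  assumes "x \<in> carrier TG" shows "TN #>\<^bsub>TG\<^esub> x = of_model (tensor_eval x)"
proof
  show "TN #>\<^bsub>TG\<^esub> x \<subseteq> of_model (tensor_eval x)"
    unfolding r_coset_def of_model_def using assms TN_carrier TG_add tensor_eval_TN by (auto simp: tensor_eval_add)
  show "of_model (tensor_eval x) \<subseteq> TN #>\<^bsub>TG\<^esub> x"
  proof
    fix y assume "y \<in> of_model (tensor_eval x)"
    then have "y - x \<in> TN" using assms TG_diff by (simp add: TN_iff of_model_def tensor_eval_diff)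
    moreover have "y = (y - x) \<otimes>\<^bsub>TG\<^esub> x" by simp
    ultimately show "y \<in> TN #>\<^bsub>TG\<^esub> x" unfolding r_coset_def by blast
  qed
qed

abbreviation MM where "MM \<equiv> induced_module HH Bact S0"

lemma of_model_nonempty: "P \<in> V0 \<Longrightarrow> expand 1 P \<in> of_model P"
  unfolding of_model_def using expand_carrier[OF FA_1] tensor_eval_expand[OF FA_1] by simp

lemma of_model_coset: "P \<in> V0 \<Longrightarrow> of_model P = TN #>\<^bsub>TG\<^esub> expand 1 P"
  using coset_of_model[OF expand_carrier[OF FA_1]] tensor_eval_expand[OF FA_1] by simp

lemma of_model_inj: "P \<in> V0 \<Longrightarrow> Q \<in> V0 \<Longrightarrow> of_model P = of_model Q \<longleftrightarrow> P = Q"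
proof
  assume P: "P \<in> V0" and eq: "of_model P = of_model Q"
  have "expand 1 P \<in> of_model P" "expand 1 P \<in> of_model Q" using of_model_nonempty[OF P] unfolding eq by auto
  then show "P = Q" unfolding of_model_def by simp
qed simp

lemma carrier_MM: "carrier MM = of_model ` V0"
proof -
  have "carrier MM = (\<lambda>x. TN #>\<^bsub>TG\<^esub> x) ` carrier TG"
    by (simp add: induced_module_def Let_def carrier_FactGroup)
  also have "\<dots> = of_model ` V0"
  proof (intro equalityI subsetI)
    fix y assume "y \<in> (\<lambda>x. TN #>\<^bsub>TG\<^esub> x) ` carrier TG"
    then show "y \<in> of_model ` V0" using coset_of_model tensor_eval_V0_eqv by auto
  next
    fix y assume "y \<in> of_model ` V0"
    then show "y \<in> (\<lambda>x. TN #>\<^bsub>TG\<^esub> x) ` carrier TG" using of_model_coset expand_carrier[OF FA_1] by auto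
  qed
  finally show ?thesis .
qed

lemma TN_normal: "TN \<lhd> TG"
proof -
  have "comm_group TG" unfolding tensor_group_def by (rule abelian_free_Abelian_group)
  then show ?thesis using TN_subgroup by (simp add: comm_group.normal_iff_subgroup)
qed

lemma of_model_add: "P \<in> V0 \<Longrightarrow> Q \<in> V0 \<Longrightarrow> of_model P \<oplus>\<^bsub>MM\<^esub> of_model Q = of_model (P + Q)"
proof -
  assume P: "P \<in> V0" and Q: "Q \<in> V0"
  have c: "expand 1 P \<in> carrier TG" "expand 1 Q \<in> carrier TG" using P Q expand_carrier[OF FA_1] by auto
  have "of_model P \<oplus>\<^bsub>MM\<^esub> of_model Q = (TN #>\<^bsub>TG\<^esub> expand 1 P) <#>\<^bsub>TG\<^esub> (TN #>\<^bsub>TG\<^esub> expand 1 Q)"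
    by (simp add: induced_module_def Let_def of_model_coset P Q)
  also have "\<dots> = TN #>\<^bsub>TG\<^esub> (expand 1 P + expand 1 Q)"
    using normal.rcos_sum[OF TN_normal c] by simp
  also have "\<dots> = of_model (P + Q)"
    using coset_of_model[OF TG_add[OF c]] by (simp add: tensor_eval_add tensor_eval_expand[OF FA_1] P Q)
  finally show ?thesis .
qed

lemma of_model_zero: "\<zero>\<^bsub>MM\<^esub> = of_model 0"
  using of_model_coset[OF V0_0] group.coset_mult_one[OF TG_group, of TN] TN_carrier
  by (simp add: induced_module_def Let_def) blast

lemma of_model_smult:
  assumes p: "p \<in> carrier FA" and P: "P \<in> V0"
  shows "h p \<odot>\<^bsub>MM\<^esub> of_model P = of_model (act p P)"
proof -
  let ?L = "frag_extend (\<lambda>(a', v). frag_of (h p \<otimes>\<^bsub>HH\<^esub> a', v)) ::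
    ('f free_alg set \<times> 's \<Rightarrow>\<^sub>0 int) \<Rightarrow> ('f free_alg set \<times> 's \<Rightarrow>\<^sub>0 int)"
  have L: "?L x \<in> carrier TG \<and> tensor_eval (?L x) = act p (tensor_eval x)" if "x \<in> carrier TG" for x
  proof -
    have "keys x \<subseteq> carrier HH \<times> S0" using that by (simp add: TG_carrier)
    then show ?thesis
    proof (induction rule: frag_induction)
      case zero
      then show ?case by (simp add: tensor_eval_0 linop_0[OF linop_act'] TG_carrier)
    next
      case (one av)
      then obtain q v where av: "av = (h q, v)" "q \<in> carrier FA" "v \<in> S0" unfolding carrier_HH by blast
      then show ?case using p
        by (simp add: h_mult tensor_eval_of_h FA_mult act_mult TG_of h_in)
    next
      case (diff a b)
      then show ?case
        by (simp add: frag_extend_diff tensor_eval_diff linop_diffD[OF linop_act'] TG_diff)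
    qed
  qed
  have "h p \<odot>\<^bsub>MM\<^esub> of_model P = (\<Union>x\<in>of_model P. TN #>\<^bsub>TG\<^esub> ?L x)"
    by (simp add: induced_module_def Let_def)
  also have "\<dots> = (\<Union>x\<in>of_model P. of_model (act p P))"
    using coset_of_model L by (intro SUP_cong refl) (simp add: of_model_def)
  also have "\<dots> = of_model (act p P)" using of_model_nonempty[OF P] by blast
  finally show ?thesis .
qed

lemma of_model_tensor:
  assumes "p \<in> carrier FA" "v \<in> S0"
  shows "tensor HH Bact S0 (h p) v = of_model (act p (single (\<lambda>_. 0) v))"
  unfolding tensor_def using coset_of_model[OF TG_of[OF h_in]] assms by (simp add: tensor_eval_of_h)

lemma abelian_monoid_MM: "abelian_monoid MM"
proof (rule abelian_monoidI)
  show "\<zero>\<^bsub>MM\<^esub> \<in> carrier MM" unfolding carrier_MM of_model_zero using V0_0 by blast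
qed (auto simp: carrier_MM of_model_add of_model_zero V0_add V0_0 add_ac)

lemma of_model_finsum:
  assumes "finite A" "\<And>i. i \<in> A \<Longrightarrow> f i \<in> V0"
  shows "(\<Oplus>\<^bsub>MM\<^esub>i\<in>A. of_model (f i)) = of_model (sum f A)"
  using assms
proof (induction A rule: finite_induct)
  case empty
  then show ?case using abelian_monoid.finsum_empty[OF abelian_monoid_MM] by (simp add: of_model_zero)
next
  case (insert i A)
  have "(\<lambda>i. of_model (f i)) \<in> A \<rightarrow> carrier MM" "of_model (f i) \<in> carrier MM"
    using insert by (auto simp: carrier_MM)
  then show ?case
    using abelian_monoid.finsum_insert[OF abelian_monoid_MM insert(1,2)] insert
    by (simp add: of_model_add V0_sum)
qed

end

section \<open>The order on compositions\<close>

text \<open>The order in which \<open>w_comp\<close> numbers the positions: by value, and among equal values from right to left.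
  The second half is what makes \<open>w_comp\<close> the longest permutation that sorts.\<close>
definition precedes :: "(nat \<Rightarrow> nat) \<Rightarrow> nat \<Rightarrow> nat \<Rightarrow> bool" where
  "precedes mu i j \<longleftrightarrow> mu i < mu j \<or> (mu i = mu j \<and> j \<le> i)"

lemma w_comp_eq_card:
  assumes "j \<in> {1..n}"
  shows "w_comp n mu j = card {i \<in> {1..n}. precedes mu i j}"
proof -
  have "{i \<in> {1..n}. precedes mu i j} = {i \<in> {1..<j}. mu i < mu j} \<union> {i \<in> {j..n}. mu i \<le> mu j}"
    using assms by (auto simp: precedes_def)
  moreover have "{i \<in> {1..<j}. mu i < mu j} \<inter> {i \<in> {j..n}. mu i \<le> mu j} = {}" by auto
  ultimately show ?thesis
    using assms by (simp add: w_comp_def card_Un_disjoint)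
qed

lemma w_comp_mono:
  assumes "i \<in> {1..n}" "j \<in> {1..n}" "precedes mu i j" "i \<noteq> j"
  shows "w_comp n mu i < w_comp n mu j"
  unfolding w_comp_eq_card[OF assms(1)] w_comp_eq_card[OF assms(2)]
proof (rule psubset_card_mono)
  show "{k \<in> {1..n}. precedes mu k i} \<subset> {k \<in> {1..n}. precedes mu k j}"
  proof
    show "{k \<in> {1..n}. precedes mu k i} \<subseteq> {k \<in> {1..n}. precedes mu k j}"
      using assms(3) by (auto simp: precedes_def)
    have "j \<notin> {k \<in> {1..n}. precedes mu k i}" using assms(3,4) by (auto simp: precedes_def)
    moreover have "j \<in> {k \<in> {1..n}. precedes mu k j}" using assms(2) by (auto simp: precedes_def)
    ultimately show "{k \<in> {1..n}. precedes mu k i} \<noteq> {k \<in> {1..n}. precedes mu k j}" by blast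
  qed
qed simp

lemma w_comp_less_iff:
  assumes "i \<in> {1..n}" "j \<in> {1..n}"
  shows "w_comp n mu i < w_comp n mu j \<longleftrightarrow> mu i < mu j \<or> (mu i = mu j \<and> j < i)"
proof (cases "i = j")
  case False
  have ij: "w_comp n mu i < w_comp n mu j" if "precedes mu i j"
    using w_comp_mono[OF assms that False] .
  have ji: "w_comp n mu j < w_comp n mu i" if "precedes mu j i"
    using w_comp_mono[OF assms(2,1) that] False by simp
  show ?thesis
  proof (cases "precedes mu i j")
    case True
    then show ?thesis using ij False by (auto simp: precedes_def)
  next
    case f: False
    then have "precedes mu j i" by (auto simp: precedes_def)
    from ji[OF this] f show ?thesis by (auto simp: precedes_def)
  qed
qed simp

lemma w_comp_permutes: "w_comp n mu permutes {1..n}"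
proof (rule bij_imp_permutes)
  have "w_comp n mu i \<noteq> w_comp n mu j" if "i \<in> {1..n}" "j \<in> {1..n}" "i \<noteq> j" for i j
    using w_comp_less_iff[OF that(1,2), of mu] w_comp_less_iff[OF that(2,1), of mu] that(3) by linarith
  then have inj: "inj_on (w_comp n mu) {1..n}" unfolding inj_on_def by blast
  have "w_comp n mu ` {1..n} \<subseteq> {1..n}"
  proof
    fix y assume "y \<in> w_comp n mu ` {1..n}"
    then obtain j where j: "j \<in> {1..n}" "y = card {i \<in> {1..n}. precedes mu i j}"
      using w_comp_eq_card by auto
    have "j \<in> {i \<in> {1..n}. precedes mu i j}" using j by (auto simp: precedes_def)
    then have "card {i \<in> {1..n}. precedes mu i j} > 0" by (intro card_gt_0_iff[THEN iffD2]) auto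
    moreover have "card {i \<in> {1..n}. precedes mu i j} \<le> card {1..n}" by (rule card_mono) auto
    ultimately show "y \<in> {1..n}" using j(2) by simp
  qed
  then show "bij_betw (w_comp n mu) {1..n} {1..n}"
    using inj by (simp add: bij_betw_def endo_inj_surj)
qed (auto simp: w_comp_def)

text \<open>Exchanging two values does not change how the positions compare, up to the transposition, unless a
  position between them carries one of the two values.\<close>
lemma w_comp_swap:
  assumes ij: "i \<in> {1..n}" "j \<in> {1..n}" "i < j" "mu j < mu i"
    and between: "\<And>k. i < k \<Longrightarrow> k < j \<Longrightarrow> mu k \<noteq> mu i \<and> mu k \<noteq> mu j"
  shows "w_comp n (mu \<circ> transpose i j) = w_comp n mu \<circ> transpose i j"
proof
  fix m
  let ?t = "transpose i j"
  have p: "?t permutes {1..n}" using ij by (intro permutes_swap_id)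
  show "w_comp n (mu \<circ> ?t) m = (w_comp n mu \<circ> ?t) m"
  proof (cases "m \<in> {1..n}")
    case False
    then have "?t m = m" using ij by (auto simp: transpose_def)
    then show ?thesis using False by (auto simp: w_comp_def)
  next
    case True
    have tm: "?t m \<in> {1..n}" using True permutes_in_image[OF p] by blast
    have nb: "x < i \<or> x = i \<or> x = j \<or> j < x" if "mu x = mu i \<or> mu x = mu j" for x
      using between[of x] that by linarith
    have out: "?t x = x" if "x \<noteq> i" "x \<noteq> j" for x using that by (simp add: transpose_def)
    \<comment> \<open>Only the comparison of positions with equal values can be affected by moving them.\<close>
    have tie: "m \<le> k \<longleftrightarrow> ?t m \<le> ?t k" if e: "mu (?t k) = mu (?t m)" for k
    proof -
      consider "k = i" "m = i" | "k = j" "m = j" | "k = i" "m = j" | "k = j" "m = i"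
        | "k = i" "m \<noteq> i" "m \<noteq> j" | "k = j" "m \<noteq> i" "m \<noteq> j"
        | "m = i" "k \<noteq> i" "k \<noteq> j" | "m = j" "k \<noteq> i" "k \<noteq> j"
        | "k \<noteq> i" "k \<noteq> j" "m \<noteq> i" "m \<noteq> j" by blast
      then show ?thesis
      proof cases
        case 5 then show ?thesis using nb[of m] e ij out by auto
      next
        case 6 then show ?thesis using nb[of m] e ij out by auto
      next
        case 7 then show ?thesis using nb[of k] e ij out by auto
      next
        case 8 then show ?thesis using nb[of k] e ij out by auto
      qed (use e ij out in auto)
    qed
    have eq: "precedes (mu \<circ> ?t) k m \<longleftrightarrow> precedes mu (?t k) (?t m)" for k
      using tie[of k] by (auto simp: precedes_def)
    have "{k \<in> {1..n}. precedes mu k (?t m)} = ?t ` {k \<in> {1..n}. precedes (mu \<circ> ?t) k m}"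
    proof (intro equalityI subsetI)
      fix k assume "k \<in> {k \<in> {1..n}. precedes mu k (?t m)}"
      moreover have "?t k \<in> {1..n} \<longleftrightarrow> k \<in> {1..n}" by (rule permutes_in_image[OF p])
      ultimately have "?t k \<in> {k \<in> {1..n}. precedes (mu \<circ> ?t) k m}" by (simp add: eq)
      then show "k \<in> ?t ` {k \<in> {1..n}. precedes (mu \<circ> ?t) k m}"
        by (metis image_eqI transpose_involutory)
    next
      fix k assume "k \<in> ?t ` {k \<in> {1..n}. precedes (mu \<circ> ?t) k m}"
      then show "k \<in> {k \<in> {1..n}. precedes mu k (?t m)}" using permutes_in_image[OF p] eq by auto
    qed
    then show ?thesis
      unfolding o_def[of "w_comp n mu"] w_comp_eq_card[OF True] w_comp_eq_card[OF tm]
      using card_image[OF permutes_inj_on[OF p]] by metis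
  qed
qed

text \<open>An inversion of the shorter permutation is sent to its image under the transposition, or kept if that
  would reverse the pair. This is injective into the inversions of the longer permutation and misses the
  pair \<open>(i, j)\<close>.\<close>
lemma perm_length_swap:
  assumes w: "w permutes {1..n}" and ij: "i \<in> {1..n}" "j \<in> {1..n}" "i < j" "w j < w i"
  shows "perm_length n (w \<circ> transpose i j) < perm_length n w"
proof -
  let ?t = "transpose i j"
  let ?Inv = "\<lambda>w. {(p, q). 1 \<le> p \<and> p < q \<and> q \<le> n \<and> w q < w p}"
  \<comment> \<open>Kept pairs have decreasing images under the transposition and moved pairs come from increasing ones, which keeps the two kinds apart.\<close>
  define f where "f = (\<lambda>(p, q). if ?t p < ?t q then (?t p, ?t q) else (p, q))"
  have fin: "finite (?Inv w)" for w :: "nat \<Rightarrow> nat"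
    by (rule finite_subset[of _ "{1..n} \<times> {1..n}"]) auto
  have sub: "f ` ?Inv (w \<circ> ?t) \<subseteq> ?Inv w - {(i, j)}"
    using ij by (auto simp: f_def transpose_def split: if_splits)
  have inj: "inj_on f (?Inv (w \<circ> ?t))"
  proof (rule inj_onI, clarify)
    fix p q p' q' assume h: "p < q" "p' < q'" and eq: "f (p, q) = f (p', q')"
    have tt: "?t (?t x) = x" for x by simp
    have tinj: "?t x = ?t y \<longleftrightarrow> x = y" for x y by (metis tt)
    consider "?t p < ?t q" "?t p' < ?t q'" | "?t p < ?t q" "\<not> ?t p' < ?t q'"
      | "\<not> ?t p < ?t q" "?t p' < ?t q'" | "\<not> ?t p < ?t q" "\<not> ?t p' < ?t q'" by blast
    then show "p = p' \<and> q = q'"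
    proof cases
      case 1 then show ?thesis using eq by (simp add: f_def tinj)
    next
      case 2
      then have "p' = ?t p" "q' = ?t q" using eq by (simp_all add: f_def)
      then show ?thesis using 2 h by simp
    next
      case 3
      then have "p = ?t p'" "q = ?t q'" using eq by (simp_all add: f_def)
      then show ?thesis using 3 h by simp
    next
      case 4 then show ?thesis using eq by (simp add: f_def)
    qed
  qed
  have "card (?Inv (w \<circ> ?t)) = card (f ` ?Inv (w \<circ> ?t))" by (rule card_image[OF inj, symmetric])
  also have "\<dots> \<le> card (?Inv w - {(i, j)})" by (rule card_mono) (use fin sub in auto)
  also have "\<dots> < card (?Inv w)" by (rule psubset_card_mono) (use fin ij in auto)
  finally show ?thesis by (simp add: perm_length_def)
qed

text \<open>In general \<open>w_comp\<close> of the exchanged composition is not obtained by a single transposition. If a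
  position \<open>k\<close> between \<open>i\<close> and \<open>j\<close> carries one of the two values, the exchange is the product of an
  exchange with \<open>k\<close> at either end, and both have smaller distance.\<close>
lemma bruhat_swap:
  assumes "i \<in> {1..n}" "j \<in> {1..n}" "i < j" "mu j < mu i"
  shows "bruhat_less n (w_comp n (mu \<circ> transpose i j)) (w_comp n mu)"
  using assms
proof (induction "j - i" arbitrary: i j mu rule: less_induct)
  case less
  note ij = less.prems
  show ?case
  proof (cases "\<exists>k. i < k \<and> k < j \<and> (mu k = mu i \<or> mu k = mu j)")
    case False
    then have sw: "w_comp n (mu \<circ> transpose i j) = w_comp n mu \<circ> transpose i j"
      using ij by (intro w_comp_swap) auto
    have "bruhat_step n (w_comp n mu \<circ> transpose i j) (w_comp n mu)"
      unfolding bruhat_step_def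
    proof (intro conjI bexI)
      show "w_comp n mu = w_comp n mu \<circ> transpose i j \<circ> transpose i j" by (simp add: comp_assoc)
      show "perm_length n (w_comp n mu \<circ> transpose i j) < perm_length n (w_comp n mu)"
        using ij w_comp_less_iff[of j n i mu] by (intro perm_length_swap w_comp_permutes) auto
    qed (use ij in auto)
    then show ?thesis unfolding sw bruhat_less_def by auto
  next
    case True
    then obtain k where k: "i < k" "k < j" "mu k = mu i \<or> mu k = mu j" by blast
    have kn: "k \<in> {1..n}" using k ij by auto
    from k(3) show ?thesis
    proof
      assume e: "mu k = mu i"
      let ?m = "mu \<circ> transpose k j"
      have 1: "bruhat_less n (w_comp n ?m) (w_comp n mu)"
        using k ij kn e by (intro less.hyps) auto
      have 2: "bruhat_less n (w_comp n (?m \<circ> transpose i k)) (w_comp n ?m)"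
        using k ij kn e by (intro less.hyps) (auto simp: transpose_def)
      have "?m \<circ> transpose i k = mu \<circ> transpose i j"
        using k e by (auto simp: fun_eq_iff transpose_def)
      then show ?thesis using 1 2 unfolding bruhat_less_def by (metis tranclp_trans)
    next
      assume e: "mu k = mu j"
      let ?m = "mu \<circ> transpose i k"
      have 1: "bruhat_less n (w_comp n ?m) (w_comp n mu)"
        using k ij kn e by (intro less.hyps) auto
      have 2: "bruhat_less n (w_comp n (?m \<circ> transpose k j)) (w_comp n ?m)"
        using k ij kn e by (intro less.hyps) (auto simp: transpose_def)
      have "?m \<circ> transpose k j = mu \<circ> transpose i j"
        using k e by (auto simp: fun_eq_iff transpose_def)
      then show ?thesis using 1 2 unfolding bruhat_less_def by (metis tranclp_trans)
    qed
  qed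
qed

lemma comp_plus_perm:
  assumes "t permutes {1..n}"
  shows "comp_plus n (mu \<circ> t) = comp_plus n mu"
proof -
  have "mset (map t [1..<n+1]) = mset [1..<n+1]"
  proof -
    have "mset (map t [1..<n+1]) = image_mset t (mset_set {1..n})"
      by (simp add: atLeastLessThanSuc_atLeastAtMost del: upt_Suc)
    also have "\<dots> = mset_set (t ` {1..n})"
      using image_mset_mset_set[OF permutes_inj_on[OF assms]] by simp
    also have "\<dots> = mset [1..<n+1]"
      using permutes_image[OF assms] by (simp add: atLeastLessThanSuc_atLeastAtMost del: upt_Suc)
    finally show ?thesis .
  qed
  then have "image_mset mu (mset (map t [1..<n+1])) = image_mset mu (mset [1..<n+1])" by simp
  then have "mset (map (mu \<circ> t) [1..<n+1]) = mset (map mu [1..<n+1])"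
    by (simp add: multiset.map_comp del: upt_Suc)
  then have "sort (map (mu \<circ> t) [1..<n+1]) = sort (map mu [1..<n+1])"
    by (intro properties_for_sort) simp_all
  then show ?thesis by (simp only: comp_plus_def)
qed

lemma comp_less_swap:
  assumes "i \<in> {1..n}" "j \<in> {1..n}" "(i < j \<and> mu j < mu i) \<or> (j < i \<and> mu i < mu j)"
  shows "comp_less n (mu(i := mu j, j := mu i)) mu"
proof -
  have e: "mu(i := mu j, j := mu i) = mu \<circ> transpose i j" "transpose i j = transpose j i"
    using assms(3) by (auto simp: fun_eq_iff transpose_def)
  have "comp_plus n (mu \<circ> transpose i j) = comp_plus n mu"
    by (intro comp_plus_perm permutes_swap_id assms)
  moreover have "bruhat_less n (w_comp n (mu \<circ> transpose i j)) (w_comp n mu)"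
    using assms bruhat_swap[of i n j mu] bruhat_swap[of j n i mu] e(2) by auto
  ultimately show ?thesis unfolding comp_less_def e(1) by blast
qed

text \<open>Sorting does not change sums of functions of the entries. All properties of the dominance order that
  are needed come from suitable choices of \<open>f\<close>.\<close>
lemma sum_comp_plus:
  fixes f :: "nat \<Rightarrow> int"
  shows "(\<Sum>t\<in>{1..n}. f (comp_plus n mu t)) = (\<Sum>i\<in>{1..n}. f (mu i))"
proof -
  let ?xs = "map mu [1..<n+1]"
  let ?ys = "rev (sort ?xs)"
  have "(\<Sum>t\<in>{1..n}. f (comp_plus n mu t)) = (\<Sum>t<n. f (?ys ! t))"
    by (rule sum.reindex_bij_witness[of _ Suc "\<lambda>t. t - 1"]) (auto simp: comp_plus_def)
  also have "\<dots> = sum_list (map f ?ys)"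
    by (simp add: sum_list_sum_nth atLeast0LessThan del: upt_Suc)
  also have "\<dots> = sum_mset (image_mset f (mset ?ys))" by (simp only: sum_mset_sum_list[symmetric] mset_map)
  also have "\<dots> = sum_mset (image_mset f (mset ?xs))" by simp
  also have "\<dots> = sum_list (map f ?xs)" by (simp only: sum_mset_sum_list[symmetric] mset_map)
  also have "\<dots> = (\<Sum>i\<in>{1..n}. f (mu i))"
    by (simp add: interv_sum_list_conv_sum_set_nat comp_def atLeastLessThanSuc_atLeastAtMost del: upt_Suc)
  finally show ?thesis .
qed

lemma comp_plus_antimono:
  assumes "s \<in> {1..n}" "t \<in> {1..n}" "s \<le> t"
  shows "comp_plus n mu t \<le> comp_plus n mu s"
proof -
  let ?xs = "sort (map mu [1..<n+1])"
  have "rev ?xs ! (t - 1) = ?xs ! (n - t)" "rev ?xs ! (s - 1) = ?xs ! (n - s)"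
    using assms by (simp_all add: rev_nth)
  moreover have "?xs ! (n - t) \<le> ?xs ! (n - s)"
    using assms by (intro sorted_nth_mono) auto
  ultimately show ?thesis using assms by (simp add: comp_plus_def)
qed

text \<open>The sum of the \<open>m\<close> largest entries is at most \<open>m \<theta> + \<Sum>\<^sub>i max (\<nu>\<^sub>i - \<theta>) 0\<close> for every \<open>\<theta>\<close>, with
  equality if \<open>\<theta>\<close> is the \<open>m\<close>-th largest entry. So it suffices to compare the sums of the convex functions
  \<open>max (x - \<theta>) 0\<close>, for which sorting is irrelevant.\<close>
lemma partial_sum_le:
  assumes "m \<in> {1..n}"
    and conv: "\<And>th::int. (\<Sum>i\<in>{1..n}. max (int (nu i) - th) 0) \<le> (\<Sum>i\<in>{1..n}. max (int (mu i) - th) 0)"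
  shows "(\<Sum>t\<in>{1..m}. int (comp_plus n nu t)) \<le> (\<Sum>t\<in>{1..m}. int (comp_plus n mu t))"
proof -
  \<comment> \<open>With the \<open>m\<close>-th largest entry of \<open>mu\<close> as threshold the bound is an equality for \<open>mu\<close>.\<close>
  define th where "th = int (comp_plus n mu m)"
  let ?f = "\<lambda>x. max (int x - th) 0"
  have "(\<Sum>t\<in>{1..m}. int (comp_plus n nu t)) \<le> (\<Sum>t\<in>{1..m}. th + ?f (comp_plus n nu t))"
    by (intro sum_mono) auto
  also have "\<dots> = int m * th + (\<Sum>t\<in>{1..m}. ?f (comp_plus n nu t))" by (simp add: sum.distrib)
  also have "\<dots> \<le> int m * th + (\<Sum>t\<in>{1..n}. ?f (comp_plus n nu t))"
    using assms(1) by (intro add_left_mono sum_mono2) auto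
  also have "\<dots> \<le> int m * th + (\<Sum>t\<in>{1..n}. ?f (comp_plus n mu t))"
    using conv[of th] sum_comp_plus[where f = ?f, of n nu] sum_comp_plus[where f = ?f, of n mu] by simp
  also have "(\<Sum>t\<in>{1..n}. ?f (comp_plus n mu t)) = (\<Sum>t\<in>{1..m}. ?f (comp_plus n mu t))"
    using assms(1) comp_plus_antimono[of m n _ mu]
    by (intro sum.mono_neutral_right) (auto simp: th_def)
  also have "\<dots> = (\<Sum>t\<in>{1..m}. int (comp_plus n mu t) - th)"
    using assms(1) comp_plus_antimono[of _ n m mu] by (intro sum.cong) (auto simp: th_def)
  also have "int m * th + \<dots> = (\<Sum>t\<in>{1..m}. int (comp_plus n mu t))" by (simp add: sum_subtractf)
  finally show ?thesis by simp
qed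

text \<open>The multiplicities \<open>k\<^sub>m\<close> of the simple roots are the differences of the partial sums.\<close>
lemma dom_lessI:
  assumes ne: "nu \<noteq> mu"
    and tot: "(\<Sum>t\<in>{1..n}. int (nu t)) = (\<Sum>t\<in>{1..n}. int (mu t))"
    and part: "\<And>m. m \<in> {1..n} \<Longrightarrow> (\<Sum>t\<in>{1..m}. int (nu t)) \<le> (\<Sum>t\<in>{1..m}. int (mu t))"
  shows "dom_less n nu mu"
  unfolding dom_less_def
proof (intro conjI exI[of _ "\<lambda>m. if m \<in> {1..n} then (\<Sum>t\<in>{1..m}. int (mu t) - int (nu t)) else 0"] ballI allI)
  let ?S = "\<lambda>m. \<Sum>t\<in>{1..m}. int (mu t) - int (nu t)"
  show "mu \<noteq> nu" using ne by simp
  show "0 \<le> (if m \<in> {1..n} then ?S m else 0)" for m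
    using part[of m] by (simp add: sum_subtractf)
  fix i assume i: "i \<in> {1..n}"
  have Sn: "?S n = 0" using tot by (simp add: sum_subtractf)
  have "(\<Sum>m\<in>{1..<n}. (if m \<in> {1..n} then ?S m else 0) * ((if i = m then 1 else 0) - (if i = m + 1 then 1 else 0)))
    = (\<Sum>m\<in>{1..<n}. (if m = i then ?S i else 0) - (if m = i - 1 then ?S (i - 1) else 0))"
    using i by (intro sum.cong) auto
  also have "\<dots> = (if i < n then ?S i else 0) - (if i > 1 then ?S (i - 1) else 0)"
    using i by (auto simp: sum_subtractf)
  also have "\<dots> = ?S i - ?S (i - 1)"
    using i Sn by (cases "i = n"; cases "i = 1") auto
  also have "\<dots> = int (mu i) - int (nu i)"
    using i by (cases i) auto
  finally show "int (mu i) - int (nu i) = (\<Sum>m\<in>{1..<n}. (if m \<in> {1..n} then ?S m else 0) * ((if i = m then 1 else 0) - (if i = m + 1 then 1 else 0)))"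
    by simp
qed

lemma sum_upd2:
  fixes f :: "nat \<Rightarrow> int" and mu :: "nat \<Rightarrow> nat"
  assumes "i \<in> {1..n}" "j \<in> {1..n}" "i \<noteq> j"
  shows "(\<Sum>k\<in>{1..n}. f ((mu(i := a, j := b)) k)) = f a + f b + (\<Sum>k\<in>{1..n} - {i, j}. f (mu k))"
proof -
  have "(\<Sum>k\<in>{1..n}. f ((mu(i := a, j := b)) k))
    = (\<Sum>k\<in>{i, j}. f ((mu(i := a, j := b)) k)) + (\<Sum>k\<in>{1..n} - {i, j}. f ((mu(i := a, j := b)) k))"
    using assms by (subst sum.subset_diff[of "{i, j}"]) auto
  also have "(\<Sum>k\<in>{1..n} - {i, j}. f ((mu(i := a, j := b)) k)) = (\<Sum>k\<in>{1..n} - {i, j}. f (mu k))"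
    by (intro sum.cong) auto
  also have "(\<Sum>k\<in>{i, j}. f ((mu(i := a, j := b)) k)) = f a + f b" using assms(3) by simp
  finally show ?thesis .
qed

text \<open>Moving two entries towards each other does not increase any convex sum, and strictly decreases
  the sum of squares.\<close>
lemma comp_less_between:
  assumes i: "i \<in> {1..n}" and j: "j \<in> {1..n}" and ij: "i \<noteq> j"
    and e: "min (mu i) (mu j) < e" "e < max (mu i) (mu j)"
  shows "comp_less n (mu(i := e, j := mu i + mu j - e)) mu"
proof -
  \<comment> \<open>Both endpoints move inwards by the same amount, so a convex function can only decrease.\<close>
  let ?nu = "mu(i := e, j := mu i + mu j - e)"
  have le: "e \<le> mu i + mu j" using e by linarith
  have mu: "mu = mu(i := mu i, j := mu j)" by simp
  have s1: "(\<Sum>k\<in>{1..n}. f (?nu k)) = f e + f (mu i + mu j - e) + (\<Sum>k\<in>{1..n} - {i, j}. f (mu k))" for f :: "nat \<Rightarrow> int"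
    by (rule sum_upd2[OF i j ij])
  have s2: "(\<Sum>k\<in>{1..n}. f (mu k)) = f (mu i) + f (mu j) + (\<Sum>k\<in>{1..n} - {i, j}. f (mu k))" for f :: "nat \<Rightarrow> int"
    using sum_upd2[OF i j ij, of f mu "mu i" "mu j"] by simp
  have conv: "(\<Sum>k\<in>{1..n}. max (int (?nu k) - th) 0) \<le> (\<Sum>k\<in>{1..n}. max (int (mu k) - th) 0)" for th
  proof -
    have "max (int e - th) 0 + max (int (mu i + mu j - e) - th) 0 \<le> max (int (mu i) - th) 0 + max (int (mu j) - th) 0"
      using e le by (auto simp: max_def min_def split: if_splits)
    then show ?thesis using s1[of "\<lambda>x. max (int x - th) 0"] s2[of "\<lambda>x. max (int x - th) 0"] by linarith
  qed
  have tot: "(\<Sum>k\<in>{1..n}. int (?nu k)) = (\<Sum>k\<in>{1..n}. int (mu k))"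
    using s1[of int] s2[of int] le by simp
  have sq: "(\<Sum>k\<in>{1..n}. (int (?nu k))\<^sup>2) < (\<Sum>k\<in>{1..n}. (int (mu k))\<^sup>2)"
  proof -
    have "(int e - int (mu i)) * (int e - int (mu j)) < 0"
      using e by (auto simp: mult_less_0_iff min_def max_def split: if_splits)
    moreover have "(int (mu i))\<^sup>2 + (int (mu j))\<^sup>2 - (int e)\<^sup>2 - (int (mu i) + int (mu j) - int e)\<^sup>2
        = - 2 * ((int e - int (mu i)) * (int e - int (mu j)))"
      by (simp add: power2_eq_square algebra_simps)
    ultimately have "(int e)\<^sup>2 + (int (mu i + mu j - e))\<^sup>2 < (int (mu i))\<^sup>2 + (int (mu j))\<^sup>2"
      using le by (simp add: of_nat_diff)
    then show ?thesis using s1[of "\<lambda>x. (int x)\<^sup>2"] s2[of "\<lambda>x. (int x)\<^sup>2"] by simp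
  qed
  have "dom_less n (comp_plus n ?nu) (comp_plus n mu)"
  proof (rule dom_lessI)
    show "comp_plus n ?nu \<noteq> comp_plus n mu"
      using sq sum_comp_plus[where f = "\<lambda>x. (int x)\<^sup>2", of n ?nu]
        sum_comp_plus[where f = "\<lambda>x. (int x)\<^sup>2", of n mu] by auto
    show "(\<Sum>t\<in>{1..n}. int (comp_plus n ?nu t)) = (\<Sum>t\<in>{1..n}. int (comp_plus n mu t))"
      using tot sum_comp_plus[where f = int, of n ?nu] sum_comp_plus[where f = int, of n mu] by simp
  qed (rule partial_sum_le[OF _ conv])
  then show ?thesis by (simp add: comp_less_def)
qed

section \<open>The order as a strict partial order\<close>

text \<open>A linear functional that takes the value 1 on each \<open>\<epsilon>\<^sub>m - \<epsilon>\<^bsub>m+1\<^esub>\<close>, and therefore increases strictly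
  along the dominance order.\<close>
definition dom_rank :: "nat \<Rightarrow> (nat \<Rightarrow> nat) \<Rightarrow> int" where
  "dom_rank n mu = (\<Sum>i\<in>{1..n}. (int n - int i) * int (mu i))"

lemma dom_less_sums:
  fixes mu nu :: "nat \<Rightarrow> nat" and g k :: "nat \<Rightarrow> int"
  assumes k: "\<And>i. i \<in> {1..n} \<Longrightarrow> int (mu i) - int (nu i) =
     (\<Sum>m\<in>{1..<n}. k m * ((if i = m then 1 else 0) - (if i = m + 1 then 1 else 0)))"
  shows "(\<Sum>i\<in>{1..n}. g i * (int (mu i) - int (nu i))) = (\<Sum>m\<in>{1..<n}. k m * (g m - g (m + 1)))"
proof -
  have "(\<Sum>i\<in>{1..n}. g i * (int (mu i) - int (nu i)))
    = (\<Sum>i\<in>{1..n}. \<Sum>m\<in>{1..<n}. k m * ((if i = m then g i else 0) - (if i = m + 1 then g i else 0)))"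
  proof (rule sum.cong[OF refl])
    fix i assume i: "i \<in> {1..n}"
    have "g i * (k m * ((if i = m then 1 else 0) - (if i = m + 1 then 1 else 0)))
      = k m * ((if i = m then g i else 0) - (if i = m + 1 then g i else 0))" for m
      by simp
    then show "g i * (int (mu i) - int (nu i))
      = (\<Sum>m\<in>{1..<n}. k m * ((if i = m then g i else 0) - (if i = m + 1 then g i else 0)))"
      unfolding k[OF i] sum_distrib_left by presburger
  qed
  also have "\<dots> = (\<Sum>m\<in>{1..<n}. k m * (\<Sum>i\<in>{1..n}. (if i = m then g i else 0) - (if i = m + 1 then g i else 0)))"
    by (subst sum.swap) (simp add: sum_distrib_left)
  also have "\<dots> = (\<Sum>m\<in>{1..<n}. k m * (g m - g (m + 1)))"
    by (intro sum.cong refl) (auto simp: sum_subtractf)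
  finally show ?thesis .
qed

lemma dom_less_rank:
  assumes "dom_less n nu mu" "nu \<in> compositions n" "mu \<in> compositions n"
  shows "dom_rank n nu < dom_rank n mu"
proof -
  from assms(1) obtain k where ne: "mu \<noteq> nu" and k0: "\<And>m. k m \<ge> 0"
    and k: "\<And>i. i \<in> {1..n} \<Longrightarrow> int (mu i) - int (nu i) =
     (\<Sum>m\<in>{1..<n}. k m * ((if i = m then 1 else 0) - (if i = m + 1 then 1 else 0)))"
    unfolding dom_less_def by blast
  have d: "dom_rank n mu - dom_rank n nu = (\<Sum>m\<in>{1..<n}. k m)"
    using dom_less_sums[OF k, where g = "\<lambda>i. int n - int i"]
    by (simp add: dom_rank_def right_diff_distrib sum_subtractf)
  have "(\<Sum>m\<in>{1..<n}. k m) \<noteq> 0"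
  proof
    assume "(\<Sum>m\<in>{1..<n}. k m) = 0"
    then have "k m = 0" if "m \<in> {1..<n}" for m
      using that k0 by (subst (asm) sum_nonneg_eq_0_iff) auto
    then have "mu i = nu i" if "i \<in> {1..n}" for i using k[OF that] by simp
    moreover have "mu i = nu i" if "i \<notin> {1..n}" for i using assms(2,3) that by (auto simp: compositions_def)
    ultimately show False using ne by blast
  qed
  moreover have "(\<Sum>m\<in>{1..<n}. k m) \<ge> 0" using k0 by (intro sum_nonneg)
  ultimately show ?thesis using d by linarith
qed

lemma dom_less_trans:
  assumes "dom_less n a b" "dom_less n b c" "a \<in> compositions n" "b \<in> compositions n" "c \<in> compositions n"
  shows "dom_less n a c"
proof -
  from assms(1) obtain k where k0: "\<And>m. k m \<ge> 0"
    and k: "\<And>i. i \<in> {1..n} \<Longrightarrow> int (b i) - int (a i) =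
     (\<Sum>m\<in>{1..<n}. k m * ((if i = m then 1 else 0) - (if i = m + 1 then 1 else 0)))"
    unfolding dom_less_def by blast
  from assms(2) obtain l where l0: "\<And>m. l m \<ge> 0"
    and l: "\<And>i. i \<in> {1..n} \<Longrightarrow> int (c i) - int (b i) =
     (\<Sum>m\<in>{1..<n}. l m * ((if i = m then 1 else 0) - (if i = m + 1 then 1 else 0)))"
    unfolding dom_less_def by blast
  have "c \<noteq> a" using dom_less_rank[OF assms(1)] dom_less_rank[OF assms(2)] assms(3-5) by fastforce
  moreover have "int (c i) - int (a i) =
     (\<Sum>m\<in>{1..<n}. (k m + l m) * ((if i = m then 1 else 0) - (if i = m + 1 then 1 else 0)))" if "i \<in> {1..n}" for i
    unfolding distrib_right sum.distrib k[OF that, symmetric] l[OF that, symmetric] by simp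
  ultimately show ?thesis
    unfolding dom_less_def using k0 l0 by (intro conjI exI[of _ "\<lambda>m. k m + l m"]) (auto intro: add_nonneg_nonneg)
qed

lemma comp_plus_compositions: "comp_plus n mu \<in> compositions n"
  by (simp add: compositions_def comp_plus_def)

lemma bruhat_less_length: "bruhat_less n u w \<Longrightarrow> perm_length n u < perm_length n w"
  unfolding bruhat_less_def
  by (induction rule: tranclp_induct) (auto simp: bruhat_step_def)

lemma comp_less_irrefl: "\<not> comp_less n mu mu"
  using bruhat_less_length by (auto simp: comp_less_def dom_less_def)

lemma comp_less_trans:
  assumes "comp_less n a b" "comp_less n b c"
  shows "comp_less n a c"
  using assms dom_less_trans[OF _ _ comp_plus_compositions comp_plus_compositions comp_plus_compositions]
  unfolding comp_less_def bruhat_less_def by (metis tranclp_trans)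

lemma comp_less_sum:
  assumes "comp_less n nu mu"
  shows "(\<Sum>i\<in>{1..n}. int (nu i)) = (\<Sum>i\<in>{1..n}. int (mu i))"
proof -
  have "(\<Sum>i\<in>{1..n}. int (comp_plus n nu i)) = (\<Sum>i\<in>{1..n}. int (comp_plus n mu i))"
    using assms unfolding comp_less_def
  proof
    assume "dom_less n (comp_plus n nu) (comp_plus n mu)"
    then obtain k where k: "\<And>i. i \<in> {1..n} \<Longrightarrow> int (comp_plus n mu i) - int (comp_plus n nu i) =
     (\<Sum>m\<in>{1..<n}. k m * ((if i = m then 1 else 0) - (if i = m + 1 then 1 else 0)))"
      unfolding dom_less_def by blast
    from dom_less_sums[OF this, where g = "\<lambda>_. 1"] show ?thesis by (simp add: sum_subtractf)
  qed simp
  then show ?thesis using sum_comp_plus[where f = int] by simp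
qed

text \<open>Smaller compositions have the same sum, which bounds their entries.\<close>
lemma finite_lower_compositions: "finite {nu \<in> compositions n. comp_less n nu mu}"
proof (rule finite_subset)
  define N where "N = nat (\<Sum>i\<in>{1..n}. int (mu i))"
  show "finite {f. \<forall>x. (x \<in> {1..n} \<longrightarrow> f x \<in> {0..N}) \<and> (x \<notin> {1..n} \<longrightarrow> f x = (0::nat))}"
    by (intro finite_set_of_finite_funs) auto
  show "{nu \<in> compositions n. comp_less n nu mu}
      \<subseteq> {f. \<forall>x. (x \<in> {1..n} \<longrightarrow> f x \<in> {0..N}) \<and> (x \<notin> {1..n} \<longrightarrow> f x = 0)}"
  proof clarify
    fix nu x assume nu: "nu \<in> compositions n" "comp_less n nu mu"
    have "int (nu x) \<le> (\<Sum>i\<in>{1..n}. int (nu i))" if "x \<in> {1..n}"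
      using that by (intro member_le_sum) auto
    then have "nu x \<le> N" if "x \<in> {1..n}" using that comp_less_sum[OF nu(2)] by (simp add: N_def)
    then show "(x \<in> {1..n} \<longrightarrow> nu x \<in> {0..N}) \<and> (x \<notin> {1..n} \<longrightarrow> nu x = 0)"
      using nu(1) by (auto simp: compositions_def)
  qed
qed

lemma finite_SYT: "finite (SYT n lam)"
proof (cases "SYT n lam = {}")
  case False
  then obtain T where "T \<in> SYT n lam" by blast
  then have "boxes lam = T ` {1..n}" by (auto simp: SYT_def bij_betw_def)
  then have "finite (boxes lam)" by simp
  then have "finite ({1..n} \<rightarrow>\<^sub>E boxes lam)" by (intro finite_PiE) auto
  moreover have "SYT n lam \<subseteq> {1..n} \<rightarrow>\<^sub>E boxes lam"
    by (auto simp: SYT_def bij_betw_def PiE_def)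
  ultimately show ?thesis by (rule finite_subset[rotated])
qed simp

lemma finite_lower_pairs: "finite (lower_pairs n lam mu)"
proof -
  have "lower_pairs n lam mu \<subseteq> {nu \<in> compositions n. comp_less n nu mu} \<times> SYT n lam"
    by (auto simp: lower_pairs_def)
  then show ?thesis using finite_lower_compositions finite_SYT by (meson finite_SigmaI finite_subset)
qed

section \<open>Commuting triangular operators\<close>

context vector_space begin

lemma span_image_finite:
  assumes "finite L" "x \<in> span (e ` L)"
  obtains c where "x = (\<Sum>p\<in>L. scale (c p) (e p))"
proof -
  have "\<exists>c. x = (\<Sum>p\<in>L. scale (c p) (e p))"
    using assms(2)
  proof (induction rule: span_induct)
    case base
    show ?case
    proof (rule subspaceI)
      show "0 \<in> {x. \<exists>c. x = (\<Sum>p\<in>L. scale (c p) (e p))}"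
        by (auto intro!: exI[of _ "\<lambda>_. 0"])
      fix x y
      assume "x \<in> {x. \<exists>c. x = (\<Sum>p\<in>L. scale (c p) (e p))}" "y \<in> {x. \<exists>c. x = (\<Sum>p\<in>L. scale (c p) (e p))}"
      then obtain c c' where "x = (\<Sum>p\<in>L. scale (c p) (e p))" "y = (\<Sum>p\<in>L. scale (c' p) (e p))" by blast
      then have "x + y = (\<Sum>p\<in>L. scale (c p + c' p) (e p))" by (simp add: scale_left_distrib sum.distrib)
      then show "x + y \<in> {x. \<exists>c. x = (\<Sum>p\<in>L. scale (c p) (e p))}"
        by (intro CollectI exI[of _ "\<lambda>p. c p + c' p"])
    next
      fix a x assume "x \<in> {x. \<exists>c. x = (\<Sum>p\<in>L. scale (c p) (e p))}"
      then obtain c where "x = (\<Sum>p\<in>L. scale (c p) (e p))" by blast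
      then have "scale a x = (\<Sum>p\<in>L. scale (a * c p) (e p))" by (simp add: scale_sum_right)
      then show "scale a x \<in> {x. \<exists>c. x = (\<Sum>p\<in>L. scale (c p) (e p))}"
        by (intro CollectI exI[of _ "\<lambda>p. a * c p"])
    qed
  next
    case (step y)
    then obtain q where q: "q \<in> L" "y = e q" by blast
    have "(\<Sum>p\<in>L. scale (if p = q then 1 else 0) (e p)) = (\<Sum>p\<in>L. if p = q then e q else 0)"
      by (intro sum.cong) auto
    then have "y = (\<Sum>p\<in>L. scale (if p = q then 1 else 0) (e p))"
      using q assms(1) by simp
    then show ?case by (rule exI[of _ "\<lambda>p. if p = q then 1 else 0"])
  qed
  then show ?thesis using that by blast
qed

lemma linear_map_span:
  assumes "\<And>x y. f (x + y) = f x + f y" "\<And>a x. f (scale a x) = scale a (f x)"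
    and "\<And>x. x \<in> B \<Longrightarrow> f x \<in> span S" "x \<in> span B"
  shows "f x \<in> span S"
  using assms(4)
proof (induction rule: span_induct)
  case base
  have f0: "f 0 = 0" using assms(2)[of 0 0] by simp
  show ?case
    by (rule subspaceI) (auto simp: assms(1,2) f0 span_zero intro: span_add span_scale)
qed (rule assms(3))

end

text \<open>Commuting operators \<open>z\<^sub>i\<close> that are triangular with respect to the family \<open>e\<close>, near an index \<open>p\<^sub>0\<close>
  that some \<open>z\<^sub>i\<close> separates from each smaller index.\<close>
locale commuting_triangular = vector_space scale
  for scale :: "'a::field \<Rightarrow> 'b::ab_group_add \<Rightarrow> 'b" +
  fixes z :: "'i \<Rightarrow> 'b \<Rightarrow> 'b" and I :: "'i set" and e :: "'p \<Rightarrow> 'b" and chi :: "'i \<Rightarrow> 'p \<Rightarrow> 'a"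
    and less :: "'p \<Rightarrow> 'p \<Rightarrow> bool" and p0 :: 'p
  assumes z_add: "i \<in> I \<Longrightarrow> z i (x + y) = z i x + z i y"
    and z_scale: "i \<in> I \<Longrightarrow> z i (scale a x) = scale a (z i x)"
    and z_comm: "i \<in> I \<Longrightarrow> j \<in> I \<Longrightarrow> z i (z j x) = z j (z i x)"
    and tri: "i \<in> I \<Longrightarrow> p = p0 \<or> less p p0 \<Longrightarrow> z i (e p) - scale (chi i p) (e p) \<in> span (e ` {q. less q p})"
    and fin: "finite {q. less q p0}"
    and trans: "less p q \<Longrightarrow> less q s \<Longrightarrow> less p s"
    and irrefl: "\<not> less p p"
    and sep: "less q p0 \<Longrightarrow> \<exists>i\<in>I. chi i q \<noteq> chi i p0"
begin

abbreviation low :: "'b set" where "low \<equiv> span (e ` {q. less q p0})"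

text \<open>For \<open>q\<close> in \<open>C\<close> take an \<open>i\<close> with \<open>\<chi>\<^sub>i(q) \<noteq> \<chi>\<^sub>i(p\<^sub>0)\<close>; the operator
  \<open>(z\<^sub>i - \<chi>\<^sub>i(q)) / (\<chi>\<^sub>i(p\<^sub>0) - \<chi>\<^sub>i(q))\<close> sends \<open>e\<^sub>q\<close> below \<open>q\<close>, fixes joint eigenvectors with eigenvalues
  \<open>\<chi>(p\<^sub>0)\<close>, and changes \<open>e\<^bsub>p\<^sub>0\<^esub>\<close> only by lower terms. The product over \<open>C\<close>, with maximal elements
  applied first, is \<open>Q\<close>.\<close>
lemma annihilator:
  assumes "C \<subseteq> {q. less q p0}" "\<And>p q. p \<in> C \<Longrightarrow> less q p \<Longrightarrow> q \<in> C"
  shows "\<exists>Q. (\<forall>x y. Q (x + y) = Q x + Q y) \<and> (\<forall>a x. Q (scale a x) = scale a (Q x)) \<and>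
     (\<forall>i\<in>I. \<forall>x. Q (z i x) = z i (Q x)) \<and> (\<forall>x\<in>span (e ` C). Q x = 0) \<and>
     (\<forall>x\<in>low. Q x \<in> low) \<and> Q (e p0) - e p0 \<in> low \<and>
     (\<forall>g. (\<forall>i\<in>I. z i g = scale (chi i p0) g) \<longrightarrow> Q g = g)"
proof -
  have "finite C" using assms(1) fin finite_subset by blast
  then show ?thesis using assms
  proof (induction "card C" arbitrary: C)
    case 0
    then have "C = {}" by simp
    then show ?case by (intro exI[of _ "\<lambda>x. x"]) (simp add: span_zero)
  next
    case (Suc k)
    have "C \<noteq> {}" using Suc(2) by auto
    moreover have "asymp_on C less" using trans irrefl by (auto simp: asymp_on_def)
    moreover have "transp_on C less" using trans by (auto simp: transp_on_def)
    ultimately obtain p where p: "p \<in> C" and mx: "\<And>q. q \<in> C \<Longrightarrow> q \<noteq> p \<Longrightarrow> \<not> less p q"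
      using Finite_Set.bex_max_element[OF Suc(3), of less] by blast
    let ?C = "C - {p}"
    have down: "less q' q \<Longrightarrow> q \<in> C \<Longrightarrow> q' \<in> ?C" for q q'
      using Suc(5)[of q q'] mx[of q] irrefl by auto
    have "\<exists>Q. (\<forall>x y. Q (x + y) = Q x + Q y) \<and> (\<forall>a x. Q (scale a x) = scale a (Q x)) \<and>
     (\<forall>i\<in>I. \<forall>x. Q (z i x) = z i (Q x)) \<and> (\<forall>x\<in>span (e ` ?C). Q x = 0) \<and>
     (\<forall>x\<in>low. Q x \<in> low) \<and> Q (e p0) - e p0 \<in> low \<and>
     (\<forall>g. (\<forall>i\<in>I. z i g = scale (chi i p0) g) \<longrightarrow> Q g = g)"
    proof (rule Suc(1))
      show "k = card ?C" "finite ?C" "?C \<subseteq> {q. less q p0}" using Suc(2-4) p by auto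
      show "\<And>p' q. p' \<in> ?C \<Longrightarrow> less q p' \<Longrightarrow> q \<in> ?C" using down by blast
    qed
    then obtain Q where Q': "\<forall>x y. Q (x + y) = Q x + Q y" "\<forall>a x. Q (scale a x) = scale a (Q x)"
      "\<forall>i\<in>I. \<forall>x. Q (z i x) = z i (Q x)" "\<forall>x\<in>span (e ` ?C). Q x = 0"
      "\<forall>x\<in>low. Q x \<in> low" "Q (e p0) - e p0 \<in> low"
      "\<forall>g. (\<forall>i\<in>I. z i g = scale (chi i p0) g) \<longrightarrow> Q g = g" by (elim exE conjE)
    note Q = Q'[rule_format]
    obtain i where i: "i \<in> I" "chi i p \<noteq> chi i p0" using sep[of p] p Suc(4) by blast
    \<comment> \<open>This factor normalizes \<open>Z\<close> so that it fixes the joint eigenvectors with the eigenvalues of \<open>p0\<close>.\<close>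
    define b where "b = inverse (chi i p0 - chi i p)"
    have b: "b * (chi i p0 - chi i p) = 1" using i(2) by (simp add: b_def)
    define Z where "Z x = scale b (z i x - scale (chi i p) x)" for x
    have Zadd: "Z (x + y) = Z x + Z y" for x y
      by (simp add: Z_def z_add[OF i(1)] scale_right_distrib scale_right_diff_distrib)
    have Zsc: "Z (scale a x) = scale a (Z x)" for a x
      by (simp add: Z_def z_scale[OF i(1)] scale_right_diff_distrib mult_ac)
    have zdown: "z i (e q) \<in> span (e ` D)" if "q = p0 \<or> less q p0" "q \<in> D" "\<And>q'. less q' q \<Longrightarrow> q' \<in> D" for q D
    proof -
      have "e ` {q'. less q' q} \<subseteq> e ` D" using that(3) by blast
      then have "z i (e q) - scale (chi i q) (e q) \<in> span (e ` D)"
        using tri[OF i(1) that(1)] span_mono by blast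
      moreover have "scale (chi i q) (e q) \<in> span (e ` D)" using that(2) by (intro span_scale span_base) blast
      ultimately show ?thesis using span_add by fastforce
    qed
    have ZC: "Z x \<in> span (e ` ?C)" if "x \<in> span (e ` C)" for x
    proof (rule linear_map_span[OF Zadd Zsc _ that])
      fix y assume "y \<in> e ` C"
      then obtain q where q: "q \<in> C" "y = e q" by blast
      have ql: "less q p0" using q Suc(4) by blast
      show "Z y \<in> span (e ` ?C)"
      proof (cases "q = p")
        case True
        have "e ` {q'. less q' p} \<subseteq> e ` ?C" using down[OF _ p] by blast
        then show ?thesis
          unfolding Z_def q(2) True using tri[OF i(1), of p] ql True span_mono by (intro span_scale) blast
      next
        case False
        then have qC: "q \<in> ?C" using q by blast
        have "z i (e q) \<in> span (e ` ?C)" by (rule zdown) (use ql qC down q(1) in auto)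
        moreover have "e q \<in> span (e ` ?C)" using qC by (intro span_base) blast
        ultimately show ?thesis unfolding Z_def q(2) by (intro span_scale span_diff)
      qed
    qed
    have Zlow: "Z x \<in> low" if "x \<in> low" for x
    proof (rule linear_map_span[OF Zadd Zsc _ that])
      fix y assume "y \<in> e ` {q. less q p0}"
      then obtain q where q: "less q p0" "y = e q" by blast
      have "z i (e q) \<in> low" by (rule zdown) (use q trans in auto)
      moreover have "e q \<in> low" using q by (intro span_base) blast
      ultimately show "Z y \<in> low" unfolding Z_def q(2) by (intro span_scale span_diff)
    qed
    have Zp0: "Z (e p0) - e p0 \<in> low"
    proof -
      \<comment> \<open>The multiples of the leading vector combine to that vector itself, and what is left is the lower part.\<close>
      have "scale b (scale (chi i p0 - chi i p) (e p0)) = e p0" using b by simp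
      then have "Z (e p0) - e p0 = scale b (z i (e p0) - scale (chi i p0) (e p0))"
        unfolding Z_def scale_right_diff_distrib scale_left_diff_distrib by (simp add: algebra_simps)
      then show ?thesis using tri[OF i(1), of p0] by (simp add: span_scale)
    qed
    show ?case
    proof (intro exI[of _ "\<lambda>x. Q (Z x)"] conjI allI ballI impI)
      show "Q (Z (x + y)) = Q (Z x) + Q (Z y)" for x y by (simp add: Zadd Q(1))
      show "Q (Z (scale a x)) = scale a (Q (Z x))" for a x by (simp add: Zsc Q(2))
      show "Q (Z (z j x)) = z j (Q (Z x))" if j: "j \<in> I" for j x
      proof -
        have "z j (u - v) = z j u - z j v" for u v
          using z_add[OF j, of "u - v" v] by (simp add: algebra_simps)
        then have "Z (z j x) = z j (Z x)"
          by (simp add: Z_def z_scale[OF j] z_comm[OF i(1) j])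
        then show ?thesis using Q(3)[OF j] by simp
      qed
      show "Q (Z x) = 0" if "x \<in> span (e ` C)" for x using Q(4) ZC[OF that] by blast
      show "Q (Z x) \<in> low" if "x \<in> low" for x using Q(5) Zlow[OF that] by blast
      have "Q (Z (e p0)) - e p0 = Q (Z (e p0) - e p0) + (Q (e p0) - e p0)"
        using Q(1)[of "Z (e p0) - e p0" "e p0"] by simp
      then show "Q (Z (e p0)) - e p0 \<in> low" using Q(5)[OF Zp0] Q(6) span_add by metis
      fix g assume g: "\<forall>i\<in>I. z i g = scale (chi i p0) g"
      have "Z g = scale (b * (chi i p0 - chi i p)) g"
        using g i(1) by (simp add: Z_def scale_left_diff_distrib[symmetric])
      then have "Z g = g" using b by simp
      then show "Q (Z g) = g" using Q(7)[of g] g by simp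
    qed
  qed
qed

lemma annihilator_low:
  "\<exists>Q. (\<forall>x y. Q (x + y) = Q x + Q y) \<and> (\<forall>a x. Q (scale a x) = scale a (Q x)) \<and>
     (\<forall>i\<in>I. \<forall>x. Q (z i x) = z i (Q x)) \<and> (\<forall>x\<in>low. Q x = 0) \<and>
     (\<forall>x\<in>low. Q x \<in> low) \<and> Q (e p0) - e p0 \<in> low \<and>
     (\<forall>g. (\<forall>i\<in>I. z i g = scale (chi i p0) g) \<longrightarrow> Q g = g)"
proof (rule annihilator)
  show "q \<in> {q. less q p0}" if "p \<in> {q. less q p0}" "less q p" for p q
    using that trans[of q p p0] by simp
qed simp

text \<open>The eigenvector is \<open>Q e\<^bsub>p\<^sub>0\<^esub>\<close> for the operator \<open>Q\<close> that kills all lower terms: since \<open>Q\<close> commutes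
  with \<open>z\<^sub>i\<close>, it turns the lower terms of \<open>z\<^sub>i e\<^bsub>p\<^sub>0\<^esub>\<close> into 0.\<close>
theorem eigenvector_exists:
  "\<exists>f. f - e p0 \<in> low \<and> (\<forall>i\<in>I. z i f = scale (chi i p0) f)"
proof -
  from annihilator_low
  obtain Q where Q': "\<forall>x y. Q (x + y) = Q x + Q y" "\<forall>a x. Q (scale a x) = scale a (Q x)"
      "\<forall>i\<in>I. \<forall>x. Q (z i x) = z i (Q x)" "\<forall>x\<in>low. Q x = 0" "Q (e p0) - e p0 \<in> low"
    by (elim exE conjE)
  note Q = Q'[rule_format]
  have "z i (Q (e p0)) = scale (chi i p0) (Q (e p0))" if i: "i \<in> I" for i
  proof -
    have "Q (z i (e p0) - scale (chi i p0) (e p0)) = 0" by (rule Q(4)) (rule tri[OF i], simp)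
    then show ?thesis
      using Q(1)[of "z i (e p0) - scale (chi i p0) (e p0)" "scale (chi i p0) (e p0)"] Q(2) Q(3)[OF i] by simp
  qed
  then show ?thesis using Q(5) by blast
qed

text \<open>\<open>Q\<close> kills \<open>g\<close> and fixes it.\<close>
theorem eigenvector_unique:
  assumes "g \<in> low" "\<And>i. i \<in> I \<Longrightarrow> z i g = scale (chi i p0) g"
  shows "g = 0"
proof -
  from annihilator_low
  obtain Q where Q: "\<forall>x\<in>low. Q x = 0" "\<forall>g. (\<forall>i\<in>I. z i g = scale (chi i p0) g) \<longrightarrow> Q g = g"
    by (elim exE conjE)
  show ?thesis using Q(1)[rule_format, OF assms(1)] Q(2)[rule_format, of g] assms(2) by simp
qed

end

section \<open>Algebraic independence\<close>

text \<open>Algebraic independence, applied to a homogeneous polynomial of degree 1.\<close>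
lemma alg_independent_linear:
  assumes ind: "alg_independent emb m a" and emb0: "emb 0 = 0"
    and sum0: "(\<Sum>k\<in>{0..m}. emb (q k) * a k) = 0" and k: "k \<in> {0..m}"
  shows "q k = 0"
proof -
  define s where "s k = single k (1::nat)" for k :: nat
  have s_inj: "s i = s j \<longleftrightarrow> i = j" for i j
  proof
    assume "s i = s j"
    then have "keys (s i) = keys (s j)" by simp
    then show "i = j" by (simp add: s_def)
  qed simp
  define P where "P = (\<Sum>k\<in>{0..m}. single (s k) (q k))"
  have lk: "lookup P (s j) = q j" if "j \<in> {0..m}" for j
  proof -
    have "lookup P (s j) = (\<Sum>k\<in>{0..m}. if k = j then q j else 0)"
      unfolding P_def lookup_sum by (intro sum.cong) (auto simp: lookup_single when_def s_inj)
    then show ?thesis using that by simp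
  qed
  have keys: "keys P \<subseteq> s ` {0..m}"
  proof
    fix x assume "x \<in> keys P"
    then have "(\<Sum>k\<in>{0..m}. lookup (single (s k) (q k)) x) \<noteq> 0"
      by (simp add: P_def in_keys_iff lookup_sum)
    then obtain k where "k \<in> {0..m}" "lookup (single (s k) (q k)) x \<noteq> 0"
      by (meson sum.neutral)
    then show "x \<in> s ` {0..m}" by (auto simp: lookup_single when_def split: if_splits)
  qed
  let ?t = "\<lambda>e. emb (lookup P e) * (\<Prod>k \<in> {0..m}. a k ^ lookup e k)"
  have "(\<Sum>e\<in>keys P. ?t e) = (\<Sum>e\<in>s ` {0..m}. ?t e)"
    using keys by (intro sum.mono_neutral_left) (auto simp: in_keys_iff emb0)
  also have "\<dots> = (\<Sum>k\<in>{0..m}. ?t (s k))"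
    by (subst sum.reindex) (auto simp: inj_on_def s_inj)
  also have "\<dots> = (\<Sum>k\<in>{0..m}. emb (q k) * a k)"
  proof (intro sum.cong refl)
    fix k assume k: "k \<in> {0..m}"
    have "(\<Prod>j\<in>{0..m}. a j ^ lookup (s k) j) = (\<Prod>j\<in>{0..m}. if j = k then a k else 1)"
      by (intro prod.cong) (auto simp: s_def lookup_single when_def)
    then show "?t (s k) = emb (q k) * a k" using lk k by simp
  qed
  finally have "(\<Sum>e\<in>keys P. ?t e) = 0" using sum0 by simp
  moreover have "\<forall>e\<in>keys P. keys e \<subseteq> {0..m}"
    using keys by (auto simp: s_def)
  ultimately have "P = 0" using ind unfolding alg_independent_def by blast
  then show ?thesis using lk[OF k] by simp
qed

section \<open>Standard Young tableaux\<close>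

lemma SYT_row_less:
  assumes "T \<in> SYT n lam" "i \<in> {1..n}" "j \<in> {1..n}" "T i = (l, p, q)" "T j = (l, p, q')" "q < q'"
  shows "i < j"
proof -
  have "\<forall>i\<in>{1..n}. \<forall>j\<in>{1..n}. beta (T i) = beta (T j) \<and> row (T i) = row (T j) \<and> column (T i) < column (T j) \<longrightarrow> i < j"
    using assms(1) unfolding SYT_def by blast
  from this[THEN bspec, OF assms(2), THEN bspec, OF assms(3)] show ?thesis using assms(4-6) by simp
qed

lemma SYT_column_less:
  assumes "T \<in> SYT n lam" "i \<in> {1..n}" "j \<in> {1..n}" "T i = (l, p, q)" "T j = (l, p', q)" "p < p'"
  shows "i < j"
proof -
  have "\<forall>i\<in>{1..n}. \<forall>j\<in>{1..n}. beta (T i) = beta (T j) \<and> column (T i) = column (T j) \<and> row (T i) < row (T j) \<longrightarrow> i < j"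
    using assms(1) unfolding SYT_def by blast
  from this[THEN bspec, OF assms(2), THEN bspec, OF assms(3)] show ?thesis using assms(4-6) by simp
qed

lemma SYT_box: "T \<in> SYT n lam \<Longrightarrow> i \<in> {1..n} \<Longrightarrow> T i \<in> boxes lam"
  by (auto simp: SYT_def bij_betw_def)

lemma SYT_surj: "T \<in> SYT n lam \<Longrightarrow> b \<in> boxes lam \<Longrightarrow> \<exists>i\<in>{1..n}. T i = b"
proof -
  assume "T \<in> SYT n lam" "b \<in> boxes lam"
  then have "b \<in> T ` {1..n}" by (simp add: SYT_def bij_betw_def)
  then show ?thesis by blast
qed

lemma boxes_downset:
  assumes "is_multipartition r n lam" "(l, p, q) \<in> boxes lam" "1 \<le> p'" "p' \<le> p" "1 \<le> q'" "q' \<le> q"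
  shows "(l, p', q') \<in> boxes lam"
proof -
  have b: "l < length lam" "p \<le> length (lam ! l)" "q \<le> lam ! l ! (p - 1)"
    using assms(2) by (auto simp: boxes_def)
  then have "sorted_wrt (\<ge>) (lam ! l)" using assms(1) by (auto simp: is_multipartition_def is_partition_def)
  then have "lam ! l ! (p - 1) \<le> lam ! l ! (p' - 1)"
    using b assms(3,4) sorted_wrt_nth_less[of "(\<ge>)" "lam ! l" "p' - 1" "p - 1"]
    by (cases "p' = p") auto
  then show ?thesis using b assms by (auto simp: boxes_def)
qed

lemma SYT_beta_less:
  assumes "is_multipartition r n lam" "T \<in> SYT n lam" "i \<in> {1..n}"
  shows "beta (T i) < r"
  using SYT_box[OF assms(2,3)] assms(1) by (cases "T i") (auto simp: boxes_def is_multipartition_def)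

lemma SYT_first_corner:
  assumes "is_multipartition r n lam" "T \<in> SYT n lam" "n \<ge> 1"
  shows "ct (T 1) = 0"
proof -
  obtain l p q where T1: "T 1 = (l, p, q)" by (metis prod_cases3)
  have n1: "1 \<in> {1..n}" using assms(3) by simp
  have b: "(l, p, q) \<in> boxes lam" using SYT_box[OF assms(2) n1] T1 by simp
  then have pq: "1 \<le> p" "1 \<le> q" by (auto simp: boxes_def)
  have "q = 1"
  proof (rule ccontr)
    assume "q \<noteq> 1"
    then have "(l, p, q - 1) \<in> boxes lam" using boxes_downset[OF assms(1) b, of p "q - 1"] pq by simp
    then obtain j where j: "j \<in> {1..n}" "T j = (l, p, q - 1)" using SYT_surj[OF assms(2)] by blast
    have "j < 1" using SYT_row_less[OF assms(2) j(1) n1 j(2) T1] pq by simp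
    then show False using j(1) by simp
  qed
  moreover have "p = 1"
  proof (rule ccontr)
    assume "p \<noteq> 1"
    then have "(l, p - 1, q) \<in> boxes lam" using boxes_downset[OF assms(1) b, of "p - 1" q] pq by simp
    then obtain j where j: "j \<in> {1..n}" "T j = (l, p - 1, q)" using SYT_surj[OF assms(2)] by blast
    have "j < 1" using SYT_column_less[OF assms(2) j(1) n1 j(2) T1] pq by simp
    then show False using j(1) by simp
  qed
  ultimately show ?thesis unfolding T1 ct_def by simp
qed

text \<open>Two boxes on one diagonal are separated by the corner of the rectangle that they span, and the entry
  there lies strictly between theirs. This keeps \<open>a\<close> in the seminormal form away from 0.\<close>
lemma SYT_adjacent_content:
  assumes mp: "is_multipartition r n lam" and T: "T \<in> SYT n lam" and i: "i \<in> {1..<n}"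
    and eq: "beta (T i) = beta (T (i + 1))"
  shows "ct (T i) \<noteq> ct (T (i + 1))"
proof
  assume c: "ct (T i) = ct (T (i + 1))"
  have ii: "i \<in> {1..n}" "i + 1 \<in> {1..n}" using i by auto
  have *: False if ab: "a \<in> {1..n}" "b \<in> {1..n}" and Ta: "T a = (l, p, q)" and Tb: "T b = (l, p', q')"
    and lt: "p < p'" "q < q'" and near: "b \<le> a + 1" for a b l p q p' q'
  proof -
    have b: "(l, p', q') \<in> boxes lam" "(l, p, q) \<in> boxes lam"
      using SYT_box[OF T ab(1)] SYT_box[OF T ab(2)] Ta Tb by simp_all
    then have "(l, p, q') \<in> boxes lam"
      using boxes_downset[OF mp b(1), of p q'] lt by (auto simp: boxes_def)
    then obtain x where x: "x \<in> {1..n}" "T x = (l, p, q')" using SYT_surj[OF T] by blast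
    have "a < x" by (rule SYT_row_less[OF T ab(1) x(1) Ta x(2) lt(2)])
    moreover have "x < b" by (rule SYT_column_less[OF T x(1) ab(2) x(2) Tb lt(1)])
    ultimately show False using near by simp
  qed
  obtain l p q where Ti: "T i = (l, p, q)" by (metis prod_cases3)
  obtain l' p' q' where Tj: "T (i + 1) = (l', p', q')" by (metis prod_cases3)
  have l: "l' = l" using eq Ti Tj by simp
  have pq: "int q - int p = int q' - int p'" using c Ti Tj by (simp add: ct_def)
  have "inj_on T {1..n}" using T by (simp add: SYT_def bij_betw_def)
  then have "T i \<noteq> T (i + 1)" using inj_on_eq_iff[of T "{1..n}" i "i + 1"] ii by simp
  then have "p \<noteq> p'" using pq Ti Tj l by auto
  then consider "p < p'" "q < q'" | "p' < p" "q' < q" using pq by linarith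
  then show False
  proof cases
    case 1 then show ?thesis using *[OF ii Ti Tj[unfolded l]] by simp
  next
    case 2 then show ?thesis using *[OF ii(2,1) Tj[unfolded l] Ti] by simp
  qed
qed

text \<open>Entries \<open>i\<close> and \<open>i + 1\<close> in different components are never compared, and for all other pairs the
  exchange preserves the order.\<close>
lemma swap_entries_SYT:
  assumes T: "T \<in> SYT n lam" and i: "i \<in> {1..<n}" and ne: "beta (T i) \<noteq> beta (T (i + 1))"
  shows "swap_entries i T \<in> SYT n lam"
proof -
  let ?t = "transpose i (i + 1)"
  have ii: "i \<in> {1..n}" "i + 1 \<in> {1..n}" using i by auto
  have p: "?t permutes {1..n}" by (intro permutes_swap_id ii)
  have tn: "?t x \<in> {1..n} \<longleftrightarrow> x \<in> {1..n}" for x by (rule permutes_in_image[OF p])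
  have ext: "T \<in> extensional {1..n}" and bij: "bij_betw T {1..n} (boxes lam)" using T by (auto simp: SYT_def)
  have lt: "a < b" if "?t a < ?t b" "beta (T (?t a)) = beta (T (?t b))" for a b
  proof (rule ccontr)
    assume "\<not> a < b"
    then have "?t a = i \<and> ?t b = i + 1"
      using that(1) by (auto simp: transpose_def split: if_splits)
    then show False using that(2) ne by simp
  qed
  have row_less: "?t a < ?t b" if "a \<in> {1..n}" "b \<in> {1..n}" "beta (T (?t a)) = beta (T (?t b))"
    "row (T (?t a)) = row (T (?t b))" "column (T (?t a)) < column (T (?t b))" for a b
  proof -
    have "\<forall>i\<in>{1..n}. \<forall>j\<in>{1..n}. beta (T i) = beta (T j) \<and> row (T i) = row (T j) \<and> column (T i) < column (T j) \<longrightarrow> i < j"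
      using T unfolding SYT_def by blast
    then show ?thesis using that tn by blast
  qed
  have col_less: "?t a < ?t b" if "a \<in> {1..n}" "b \<in> {1..n}" "beta (T (?t a)) = beta (T (?t b))"
    "column (T (?t a)) = column (T (?t b))" "row (T (?t a)) < row (T (?t b))" for a b
  proof -
    have "\<forall>i\<in>{1..n}. \<forall>j\<in>{1..n}. beta (T i) = beta (T j) \<and> column (T i) = column (T j) \<and> row (T i) < row (T j) \<longrightarrow> i < j"
      using T unfolding SYT_def by blast
    then show ?thesis using that tn by blast
  qed
  show ?thesis
    unfolding SYT_def swap_entries_def
  proof (intro CollectI conjI ballI impI)
    show "T \<circ> ?t \<in> extensional {1..n}"
      using ext tn by (auto simp: extensional_def)
    show "bij_betw (T \<circ> ?t) {1..n} (boxes lam)"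
      by (rule bij_betw_trans[OF permutes_imp_bij[OF p] bij])
    fix a b assume ab: "a \<in> {1..n}" "b \<in> {1..n}"
    show "a < b" if "beta ((T \<circ> ?t) a) = beta ((T \<circ> ?t) b) \<and> row ((T \<circ> ?t) a) = row ((T \<circ> ?t) b)
        \<and> column ((T \<circ> ?t) a) < column ((T \<circ> ?t) b)"
      by (rule lt[OF row_less[OF ab]]) (use that in simp_all)
    show "a < b" if "beta ((T \<circ> ?t) a) = beta ((T \<circ> ?t) b) \<and> column ((T \<circ> ?t) a) = column ((T \<circ> ?t) b)
        \<and> row ((T \<circ> ?t) a) < row ((T \<circ> ?t) b)"
      by (rule lt[OF col_less[OF ab]]) (use that in simp_all)
  qed
qed

section \<open>Sums over roots of unity\<close>

text \<open>Multiplying the index of summation by \<open>\<zeta>\<close> multiplies the sum by \<open>\<zeta>\<^sup>b \<zeta>\<^sup>-\<^sup>b'\<close>, so it is 0 unless that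
  factor is 1.\<close>
lemma sum_roots_eq:
  assumes "r \<ge> 1"
  shows "(\<Sum>x\<in>unity_roots r. x ^ b * inverse x ^ b') = (if b mod r = b' mod r then of_nat r else 0)"
proof -
  let ?f = "\<lambda>x::complex. x ^ b * inverse x ^ b'"
  have z: "zeta r \<in> unity_roots r" using zeta_pow_r[OF assms] by (simp add: unity_roots_def)
  have red: "x ^ b = x ^ (b mod r)" if "x \<in> unity_roots r" for x b
  proof -
    have "x ^ b = x ^ (r * (b div r) + b mod r)" by simp
    then show ?thesis using that by (simp only: power_add power_mult) (simp add: unity_roots_def)
  qed
  show ?thesis
  proof (cases "b mod r = b' mod r")
    case True
    have "?f x = 1" if x: "x \<in> unity_roots r" for x
    proof -
      have "x ^ b = x ^ b'" using red[OF x, of b] red[OF x, of b'] True by simp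
      then show ?thesis using unity_roots_nonzero[OF assms x] by (simp add: power_inverse)
    qed
    moreover have "card (unity_roots r) = r" using bij_betw_same_card[OF bij_betw_zeta[OF assms]] by simp
    ultimately show ?thesis using True by simp
  next
    case False
    \<comment> \<open>Shifting the summation by \<open>zeta r\<close> multiplies the sum by this factor.\<close>
    let ?q = "?f (zeta r)"
    have "(\<Sum>x\<in>unity_roots r. ?f x) = (\<Sum>x\<in>unity_roots r. ?f (x * zeta r))"
      by (rule sum_unity_roots_shift[OF assms z, symmetric])
    also have "\<dots> = (\<Sum>x\<in>unity_roots r. ?f x) * ?q"
      by (simp add: sum_distrib_right sum_distrib_left power_mult_distrib mult_ac)
    finally have "(\<Sum>x\<in>unity_roots r. ?f x) * (1 - ?q) = 0" by (simp add: algebra_simps)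
    moreover have "?q \<noteq> 1"
    proof
      assume "?q = 1"
      then have "zeta r ^ b = zeta r ^ b'" by (simp add: power_inverse field_simps)
      then have "zeta r ^ (b mod r) = zeta r ^ (b' mod r)" using red[OF z] by metis
      then have "b mod r = b' mod r"
        using bij_betw_zeta[OF assms] assms unfolding bij_betw_def inj_on_def by simp
      then show False using False by simp
    qed
    ultimately have "(\<Sum>x\<in>unity_roots r. ?f x) = 0" by simp
    then show ?thesis using False by simp
  qed
qed

lemma d_ext_mod: "d_ext r d (k mod int r) = d_ext r d k"
  by (simp add: d_ext_def)

lemma d_ext_mod_diff: "d_ext r d (k mod int r - 1) = d_ext r d (k - 1)"
  using d_ext_mod[of r d "k mod int r - 1"] d_ext_mod[of r d "k - 1"] by (simp add: mod_diff_left_eq)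

lemma single_eq_iff: "single k a = single k b \<longleftrightarrow> a = b"
  by (metis lookup_single_eq)

context W_rep begin

lemma sum_roots_emb:
  "(\<Sum>x\<in>unity_roots r. emb x ^ b * inverse (emb x) ^ b') = (if b mod r = b' mod r then of_nat r else 0)"
proof -
  have "(\<Sum>x\<in>unity_roots r. emb x ^ b * inverse (emb x) ^ b') = emb (\<Sum>x\<in>unity_roots r. x ^ b * inverse x ^ b')"
    by (simp add: hom_sum hom_mult hom_power hom_inverse)
  then show ?thesis by (simp add: sum_roots_eq[OF r_pos] hom_of_nat)
qed

lemma of_nat_r_nonzero: "(of_nat r :: 'f) \<noteq> 0"
proof -
  have "emb (of_nat r) \<noteq> 0" using r_pos by (simp del: hom_of_nat)
  then show ?thesis by (simp add: hom_of_nat)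
qed

text \<open>The idempotents \<open>e\<^sub>i\<^sub>j\<close> pick one \<open>j\<close> from each power \<open>p\<close>, namely \<open>j = b - p\<close> modulo \<open>r\<close>, which leaves
  a telescoping sum of differences of the \<open>d\<^sub>j\<close>.\<close>
lemma dcoef_telescope:
  "(\<Sum>x\<in>unity_roots r. dcoef x * (\<Sum>p<m. inverse (emb x) ^ p) * emb x ^ b)
    = d_ext r d (int b) - d_ext r d (int b - int m)"
proof -
  let ?U = "unity_roots r"
  let ?g = "\<lambda>j::nat. d_ext r d (int j) - d_ext r d (int j - 1)"
  have one: "(\<Sum>x\<in>?U. dcoef x * inverse (emb x) ^ p * emb x ^ b)
      = d_ext r d (int b - int p) - d_ext r d (int b - int p - 1)" for p
  proof -
    have rr: "emb (1 / of_nat r) * of_nat r = 1"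
      using of_nat_r_nonzero by (simp add: divide_inverse hom_inverse hom_of_nat)
    \<comment> \<open>The one summand that survives the sum over roots of unity.\<close>
    define j0 where "j0 = nat ((int b - int p) mod int r)"
    have j0: "j0 < r" "int j0 = (int b - int p) mod int r"
      using r_pos by (auto simp: j0_def nat_less_iff)
    have iff: "b mod r = (j + p) mod r \<longleftrightarrow> j = j0" if "j < r" for j
    proof -
      have "b mod r = (j + p) mod r \<longleftrightarrow> int b mod int r = (int j + int p) mod int r"
        by (metis of_nat_add of_nat_eq_iff zmod_int)
      also have "\<dots> \<longleftrightarrow> (int b - int p) mod int r = int j mod int r"
        by (simp add: mod_eq_dvd_iff algebra_simps)
      also have "\<dots> \<longleftrightarrow> j = j0" using that j0 by auto
      finally show ?thesis .
    qed
    have "(\<Sum>x\<in>?U. dcoef x * inverse (emb x) ^ p * emb x ^ b)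
      = (\<Sum>x\<in>?U. \<Sum>j<r. emb (1 / of_nat r) * ?g j * (emb x ^ b * inverse (emb x) ^ (j + p)))"
      by (simp add: dcoef_def sum_distrib_left sum_distrib_right power_add mult_ac)
    also have "\<dots> = (\<Sum>j<r. emb (1 / of_nat r) * ?g j * (\<Sum>x\<in>?U. emb x ^ b * inverse (emb x) ^ (j + p)))"
      by (subst sum.swap) (simp add: sum_distrib_left)
    also have "\<dots> = (\<Sum>j<r. if j = j0 then ?g j0 else 0)"
      unfolding sum_roots_emb using rr by (intro sum.cong) (auto simp: iff mult_ac)
    also have "\<dots> = ?g j0" using j0 by simp
    finally show ?thesis unfolding j0(2) d_ext_mod d_ext_mod_diff .
  qed
  have "(\<Sum>x\<in>?U. dcoef x * (\<Sum>p<m. inverse (emb x) ^ p) * emb x ^ b)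
    = (\<Sum>p<m. \<Sum>x\<in>?U. dcoef x * inverse (emb x) ^ p * emb x ^ b)"
    by (subst sum.swap) (simp add: sum_distrib_left sum_distrib_right)
  also have "\<dots> = (\<Sum>p<m. d_ext r d (int b - int p) - d_ext r d (int b - int (Suc p)))"
    unfolding one by (simp add: algebra_simps)
  also have "\<dots> = d_ext r d (int b) - d_ext r d (int b - int m)"
    using sum_lessThan_telescope'[of "\<lambda>p. d_ext r d (int b - int p)" m] by simp
  finally show ?thesis .
qed

text \<open>The sum of reflections \<open>psi\<close> on the coefficients. Facts about it are the degree 0 case of facts
  about \<open>psi\<close>.\<close>
definition Rpsi :: "nat \<Rightarrow> nat \<Rightarrow> 's \<Rightarrow> 's" where
  "Rpsi i j v = (\<Sum>x\<in>unity_roots r. Rf i j x v)"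

lemma T_deg0: "Tw s c (single (\<lambda>_. 0) v) = single (\<lambda>_. 0) (R (mono_mat n s c) v)"
  by (simp add: T_single comp_def)

lemma psi_deg0: "psi i j (single (\<lambda>_. 0) v) = single (\<lambda>_. 0) (Rpsi i j v)"
  unfolding psi_def Rpsi_def by (simp add: T_deg0 single_sum)

lemma R_Rpsi:
  assumes "adm r n s c" "j \<in> {1..n}" "k \<in> {1..n}" "j \<noteq> k"
  shows "R (mono_mat n s c) (Rpsi j k v) = Rpsi (s j) (s k) (R (mono_mat n s c) v)"
  using T_psi[OF assms, of "single (\<lambda>_. 0) v"] by (simp add: T_deg0 psi_deg0 single_eq_iff)

lemma R_Rd:
  assumes "adm r n s c" "x \<in> unity_roots r"
  shows "R (mono_mat n s c) (Rd i x v) = Rd (s i) x (R (mono_mat n s c) v)"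
  using T_Td[OF assms, of i "single (\<lambda>_. 0) v"]
  by (simp only: T_deg0 single_eq_iff)

lemma R_mono_mult:
  assumes "adm r n s c" "adm r n t e"
  shows "R (mono_mat n s c) (R (mono_mat n t e) v) = R (mono_mat n (s \<circ> t) (\<lambda>j. c (t j) * e j)) v"
  using R_mult[OF mono_mat_in_G[OF assms(1) r_pos] mono_mat_in_G[OF assms(2) r_pos]]
  by (simp add: mono_mat_mult[OF adm_permutes[OF assms(2)]])

lemma Rf_factor:
  assumes "i \<in> {1..n}" "j \<in> {1..n}" "i \<noteq> j" "x \<in> unity_roots r"
  shows "Rf i j x v = Rd i x (R (s_mat n i j) (Rd i (inverse x) v))"
proof -
  have p: "transpose i j permutes {1..n}" using assms by (intro permutes_swap_id)
  note a = adm_diag'[OF root_inverse[OF assms(4)], of i] adm_perm[OF p] adm_diag'[OF assms(4), of i]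
  have "Rd i x (R (s_mat n i j) (Rd i (inverse x) v))
     = R (mono_mat n (id \<circ> (transpose i j \<circ> id))
          (\<lambda>m. diag_fun i x ((transpose i j \<circ> id) m) * (1 * diag_fun i (inverse x) m))) v"
    unfolding s_mat_def perm_mat_mono R_mono_mult[OF a(2,1)]
      R_mono_mult[OF a(3) adm_comp[OF a(2,1)]] ..
  also have "mono_mat n (id \<circ> (transpose i j \<circ> id))
          (\<lambda>m. diag_fun i x ((transpose i j \<circ> id) m) * (1 * diag_fun i (inverse x) m))
     = mono_mat n (transpose i j) (refl_fun i j x)"
    using assms(3) by (intro mono_mat_cong) (auto simp: diag_fun_def refl_fun_def transpose_def)
  finally show ?thesis ..
qed

text \<open>The element \<open>\<phi>\<^sub>k\<close> acting on the coefficients.\<close>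
definition Phi :: "nat \<Rightarrow> 's \<Rightarrow> 's" where
  "Phi k v = (\<Sum>j\<in>{1..<k}. Rpsi k j v)"

lemma s_mat_involution:
  assumes "i \<in> {1..n}" "j \<in> {1..n}"
  shows "R (s_mat n i j) (R (s_mat n i j) v) = v"
proof -
  have a: "adm r n (transpose i j) (\<lambda>_. 1)" using assms by (intro adm_perm permutes_swap_id)
  have "mono_mat n (transpose i j \<circ> transpose i j) (\<lambda>_. 1 * 1) = 1\<^sub>m n"
    unfolding transpose_comp_involutory mult_1 by (rule mono_mat_one)
  then show ?thesis unfolding s_mat_def perm_mat_mono R_mono_mult[OF a a] by (simp add: R_one)
qed

lemma R_sum: "R w (sum f A) = (\<Sum>x\<in>A. R w (f x))"
  by (induction A rule: infinite_finite_induct) (simp_all add: R_add)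

text \<open>The recursion \<open>\<phi>\<^bsub>i+1\<^esub> = s\<^sub>i \<phi>\<^sub>i s\<^sub>i + \<Sum>\<^sub>l \<zeta>\<^sub>i\<^sup>l s\<^sub>i \<zeta>\<^sub>i\<^sup>-\<^sup>l\<close> of Jucys-Murphy elements.\<close>
lemma Phi_Suc:
  assumes i: "i \<in> {1..<n}"
  shows "Phi (i + 1) v = R (s_mat n i (i + 1)) (Phi i (R (s_mat n i (i + 1)) v)) + Rpsi (i + 1) i v"
proof -
  let ?s = "s_mat n i (i + 1)"
  have ii: "i \<in> {1..n}" "i + 1 \<in> {1..n}" using i by auto
  have a: "adm r n (transpose i (i + 1)) (\<lambda>_. 1)" using ii by (intro adm_perm permutes_swap_id)
  have "R ?s (Phi i (R ?s v)) = (\<Sum>j\<in>{1..<i}. Rpsi (i + 1) j (R ?s (R ?s v)))"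
    unfolding Phi_def R_sum
  proof (intro sum.cong refl)
    fix j assume j: "j \<in> {1..<i}"
    then have "j \<in> {1..n}" "i \<noteq> j" using i by auto
    from R_Rpsi[OF a ii(1) this, of "R ?s v"]
    show "R ?s (Rpsi i j (R ?s v)) = Rpsi (i + 1) j (R ?s (R ?s v))"
      using j by (simp add: s_mat_def perm_mat_mono transpose_def)
  qed
  then have 1: "R ?s (Phi i (R ?s v)) = (\<Sum>j\<in>{1..<i}. Rpsi (i + 1) j v)"
    unfolding s_mat_involution[OF ii] .
  have "{1..<i + 1} = insert i {1..<i}" using i by auto
  then show ?thesis unfolding 1 Phi_def[of "i + 1"] by (simp add: add.commute)
qed

end

locale lambda_model = cherednik_setup emb r n kappa c0 d
  for emb :: "complex \<Rightarrow> 'f::field" and r n :: nat and kappa c0 :: 'f and d :: "nat \<Rightarrow> 'f" +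
  fixes lam :: "nat list list" and rho :: "complex mat \<Rightarrow> tableau \<Rightarrow> tableau \<Rightarrow> complex"
  assumes n_pos: "n \<ge> 1" and mp: "is_multipartition r n lam" and rho: "is_S_lambda r n lam rho"
begin

abbreviation ST :: "tableau set" where "ST \<equiv> SYT n lam"

definition scaleS :: "'f \<Rightarrow> (tableau \<Rightarrow>\<^sub>0 'f) \<Rightarrow> (tableau \<Rightarrow>\<^sub>0 'f)" where
  "scaleS a = Poly_Mapping.map ((*) a)"

lemma lookup_scaleS [simp]: "lookup (scaleS a v) S = a * lookup v S"
  by (simp add: scaleS_def map.rep_eq when_def)

text \<open>The representation on tableaux, extended by the identity to functions that are not supported on standard
  tableaux. Then the unit matrix acts as the identity on the whole type, as a representation must.\<close>
definition RS :: "complex mat \<Rightarrow> (tableau \<Rightarrow>\<^sub>0 'f) \<Rightarrow> (tableau \<Rightarrow>\<^sub>0 'f)" where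
  "RS w v = S_act emb n lam rho w v
     + (\<Sum>T\<in>keys v - ST. single T (lookup v T))"

lemma lookup_S_act:
  "lookup (S_act emb n lam rho w v) S =
     (if S \<in> ST then \<Sum>T\<in>ST. emb (rho w S T) * lookup v T else 0)"
proof -
  have "lookup (S_act emb n lam rho w v) S
    = (\<Sum>S'\<in>ST. if S' = S then (\<Sum>T\<in>ST. emb (rho w S T) * lookup v T) else 0)"
    unfolding S_act_def lookup_sum by (intro sum.cong) (auto simp: lookup_single when_def)
  then show ?thesis using finite_SYT by (simp add: sum.delta')
qed

lemma lookup_RS:
  "lookup (RS w v) S =
     (if S \<in> ST then \<Sum>T\<in>ST. emb (rho w S T) * lookup v T else lookup v S)"
proof -
  have "(\<Sum>T\<in>keys v - ST. lookup (single T (lookup v T)) S)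
    = (\<Sum>T\<in>keys v - ST. if T = S then lookup v S else 0)"
    by (intro sum.cong) (auto simp: lookup_single when_def)
  then have "(\<Sum>T\<in>keys v - ST. lookup (single T (lookup v T)) S)
    = (if S \<in> ST then 0 else lookup v S)"
    by (auto simp: sum.delta in_keys_iff)
  then show ?thesis
    unfolding RS_def lookup_add lookup_S_act lookup_sum by simp
qed

lemma rho_one: "S \<in> ST \<Longrightarrow> T \<in> ST \<Longrightarrow> rho (1\<^sub>m n) S T = (if S = T then 1 else 0)"
  and rho_mult: "u \<in> carrier (G_r1n r n) \<Longrightarrow> w \<in> carrier (G_r1n r n) \<Longrightarrow> S \<in> ST \<Longrightarrow> T \<in> ST \<Longrightarrow>
     rho (u * w) S T = (\<Sum>R\<in>ST. rho u S R * rho w R T)"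
  and rho_zeta: "i \<in> {1..n} \<Longrightarrow> S \<in> ST \<Longrightarrow> T \<in> ST \<Longrightarrow>
     rho (zeta_mat r n i) S T = (if S = T then zeta r ^ beta (T i) else 0)"
  and rho_s: "i \<in> {1..<n} \<Longrightarrow> S \<in> ST \<Longrightarrow> T \<in> ST \<Longrightarrow> rho (s_mat n i (i + 1)) S T =
          (if beta (T i) \<noteq> beta (T (i + 1)) then (if S = swap_entries i T then 1 else 0)
           else let a = real_of_int (ct (T (i + 1)) - ct (T i)) in
             (if S = T then complex_of_real (1 / a) else 0) +
             (if S = swap_entries i T then complex_of_real (sqrt (1 - 1 / a\<^sup>2)) else 0))"
  using rho unfolding is_S_lambda_def by blast+

sublocale W_rep emb r n kappa c0 d scaleS RS
proof unfold_locales
  show "scaleS a (x + y) = scaleS a x + scaleS a y" for a x y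
    by (rule poly_mapping_eqI) (simp add: lookup_add distrib_left)
  show "scaleS (a + b) x = scaleS a x + scaleS b x" for a b x
    by (rule poly_mapping_eqI) (simp add: lookup_add distrib_right)
  show "scaleS a (scaleS b x) = scaleS (a * b) x" for a b x
    by (rule poly_mapping_eqI) (simp add: mult.assoc)
  show "scaleS 1 x = x" for x
    by (rule poly_mapping_eqI) simp
  show "RS w (v + v') = RS w v + RS w v'" for w v v'
    by (rule poly_mapping_eqI) (simp add: lookup_RS lookup_add distrib_left sum.distrib)
  show "RS w (scaleS a v) = scaleS a (RS w v)" for w a v
    by (rule poly_mapping_eqI) (simp add: lookup_RS sum_distrib_left mult_ac)
  show "RS (1\<^sub>m n) v = v" for v
  proof (rule poly_mapping_eqI)
    fix S
    have "(\<Sum>T\<in>ST. emb (rho (1\<^sub>m n) S T) * lookup v T) = (\<Sum>T\<in>ST. if T = S then lookup v S else 0)"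
      if "S \<in> ST" using that by (intro sum.cong) (auto simp: rho_one)
    then show "lookup (RS (1\<^sub>m n) v) S = lookup v S"
      using finite_SYT by (simp add: lookup_RS)
  qed
  fix u w v assume u: "u \<in> carrier (G_r1n r n)" and w: "w \<in> carrier (G_r1n r n)"
  show "RS (u * w) v = RS u (RS w v)"
  proof (rule poly_mapping_eqI)
    fix S
    show "lookup (RS (u * w) v) S = lookup (RS u (RS w v)) S"
    proof (cases "S \<in> ST")
      case True
      have "(\<Sum>T\<in>ST. emb (rho (u * w) S T) * lookup v T)
        = (\<Sum>T\<in>ST. \<Sum>Q\<in>ST. emb (rho u S Q) * emb (rho w Q T) * lookup v T)"
        using True by (intro sum.cong refl) (simp add: rho_mult[OF u w] hom_sum hom_mult sum_distrib_right)
      also have "\<dots> = (\<Sum>Q\<in>ST. emb (rho u S Q) * (\<Sum>T\<in>ST. emb (rho w Q T) * lookup v T))"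
        by (subst sum.swap) (simp add: sum_distrib_left mult.assoc)
      finally show ?thesis using True by (simp add: lookup_RS)
    qed (simp add: lookup_RS)
  qed
qed

lemma S_space_iff: "v \<in> S_space n lam \<longleftrightarrow> (\<forall>S. S \<notin> ST \<longrightarrow> lookup v S = 0)"
  unfolding S_space_def by (auto simp: in_keys_iff)

lemma S_act_RS: "v \<in> S_space n lam \<Longrightarrow> S_act emb n lam rho w v = RS w v"
  by (rule poly_mapping_eqI) (simp add: lookup_S_act lookup_RS S_space_iff)

sublocale induced_model emb r n kappa c0 d scaleS RS "S_space n lam" "B_act emb r n kappa c0 d lam rho"
proof unfold_locales
  show "0 \<in> S_space n lam" by (simp add: S_space_iff)
  show "u + v \<in> S_space n lam" if "u \<in> S_space n lam" "v \<in> S_space n lam" for u v :: "tableau \<Rightarrow>\<^sub>0 'f"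
    using that by (simp add: S_space_iff lookup_add)
  show "scaleS a v \<in> S_space n lam" if "v \<in> S_space n lam" for a v
    using that by (simp add: S_space_iff)
  show "RS w v \<in> S_space n lam" if "w \<in> carrier (G_r1n r n)" "v \<in> S_space n lam" for w v
    using that by (simp add: S_space_iff lookup_RS)
  show "(\<exists>a. b = h (scal a) \<and> (\<forall>v\<in>S_space n lam. f v = scaleS a v)) \<or>
       (\<exists>w\<in>carrier (G_r1n r n). b = h (tg w) \<and> (\<forall>v\<in>S_space n lam. f v = RS w v)) \<or>
       (\<exists>i\<in>{1..n}. b = h (yg i) \<and> (\<forall>v\<in>S_space n lam. f v = 0))"
    if "(b, f) \<in> B_act emb r n kappa c0 d lam rho" for b f
    using that S_act_RS unfolding B_act_def scaleS_def by auto
  show "\<exists>f. (h (scal a), f) \<in> B_act emb r n kappa c0 d lam rho \<and> (\<forall>v\<in>S_space n lam. f v = scaleS a v)" for a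
    unfolding B_act_def scaleS_def by (intro exI[of _ "Poly_Mapping.map ((*) a)"]) auto
  show "\<exists>f. (h (tg w), f) \<in> B_act emb r n kappa c0 d lam rho \<and> (\<forall>v\<in>S_space n lam. f v = RS w v)"
    if "w \<in> carrier (G_r1n r n)" for w
    using that S_act_RS unfolding B_act_def by (intro exI[of _ "S_act emb n lam rho w"]) blast
  show "\<exists>f. (h (yg i), f) \<in> B_act emb r n kappa c0 d lam rho \<and> (\<forall>v\<in>S_space n lam. f v = 0)"
    if "i \<in> {1..n}" for i
    using that unfolding B_act_def by (intro exI[of _ "\<lambda>_. 0"]) blast
qed

section \<open>Jucys-Murphy elements on the seminormal basis\<close>

abbreviation vT :: "tableau \<Rightarrow> (tableau \<Rightarrow>\<^sub>0 'f)" where "vT T \<equiv> single T 1"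

lemma vT_S_space: "T \<in> ST \<Longrightarrow> vT T \<in> S_space n lam"
  by (auto simp: S_space_iff lookup_single when_def)

lemma lookup_RS_vT:
  assumes "T \<in> ST"
  shows "lookup (RS w (vT T)) S = (if S \<in> ST then emb (rho w S T) else 0)"
proof -
  have "(\<Sum>T'\<in>ST. emb (rho w S T') * lookup (vT T) T') = (\<Sum>T'\<in>ST. if T' = T then emb (rho w S T) else 0)"
    by (intro sum.cong) (auto simp: lookup_single when_def)
  then show ?thesis using assms finite_SYT by (auto simp: lookup_RS lookup_single when_def)
qed

lemma RS_zeta_vT:
  assumes "T \<in> ST" "i \<in> {1..n}"
  shows "Rd i (zeta r) (vT T) = scaleS (emb (zeta r) ^ beta (T i)) (vT T)"
  unfolding zeta_mat_mono[symmetric]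
  by (rule poly_mapping_eqI)
     (auto simp: lookup_RS_vT[OF assms(1)] rho_zeta[OF assms(2) _ assms(1)] lookup_single when_def hom_power assms)

lemma Rd_vT:
  assumes "T \<in> ST" "i \<in> {1..n}" "x \<in> unity_roots r"
  shows "Rd i x (vT T) = scaleS (emb x ^ beta (T i)) (vT T)"
proof -
  have zr: "zeta r ^ l \<in> unity_roots r" for l by (rule zeta_power_root)
  have "Rd i (zeta r ^ l) (vT T) = scaleS (emb (zeta r ^ l) ^ beta (T i)) (vT T)" for l
  proof (induction l)
    case 0
    have "diag_fun i 1 = (\<lambda>_. 1)" by (auto simp: diag_fun_def)
    then show ?case by (simp add: R_one mono_mat_one[unfolded id_def])
  next
    case (Suc l)
    have "Rd i (zeta r ^ Suc l) (vT T) = Rd i (zeta r ^ l) (Rd i (zeta r ^ 1) (vT T))"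
      unfolding R_mono_mult[OF adm_diag'[OF zr] adm_diag'[OF zr]]
      by (intro arg_cong[where f = "\<lambda>w. RS w (vT T)"] mono_mat_cong) (auto simp: diag_fun_def mult.commute)
    also have "\<dots> = scaleS (emb (zeta r ^ Suc l) ^ beta (T i)) (vT T)"
      using RS_zeta_vT[OF assms(1,2)]
      by (simp add: R_scale Suc hom_mult power_mult_distrib mult.commute del: scaleV_single)
    finally show ?case .
  qed
  moreover obtain l where "x = zeta r ^ l"
    using bij_betw_imp_surj_on[OF bij_betw_zeta[OF r_pos]] assms(3) by blast
  ultimately show ?thesis by blast
qed

lemma RS_s_diff:
  assumes "T \<in> ST" "i \<in> {1..<n}" "beta (T i) \<noteq> beta (T (i + 1))"
  shows "RS (s_mat n i (i + 1)) (vT T) = vT (swap_entries i T)"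
  by (rule poly_mapping_eqI)
     (use swap_entries_SYT[OF assms] assms(3) in
      \<open>auto simp: lookup_RS_vT[OF assms(1)] rho_s[OF assms(2) _ assms(1)] lookup_single when_def
        simp del: One_nat_def\<close>)

lemma RS_s_same:
  assumes "T \<in> ST" "i \<in> {1..<n}" "beta (T i) = beta (T (i + 1))"
  obtains q where "RS (s_mat n i (i + 1)) (vT T)
     = scaleS (inverse (of_int (ct (T (i + 1)) - ct (T i)))) (vT T)
       + (if swap_entries i T \<in> ST then scaleS q (vT (swap_entries i T)) else 0)"
proof -
  define a where "a = real_of_int (ct (T (i + 1)) - ct (T i))"
  have "emb (complex_of_real (1 / a)) = inverse (of_int (ct (T (i + 1)) - ct (T i)))"
    unfolding a_def by (simp only: inverse_eq_divide[symmetric] of_real_inverse of_real_of_int_eq hom_inverse hom_of_int)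
  then have "RS (s_mat n i (i + 1)) (vT T)
     = scaleS (inverse (of_int (ct (T (i + 1)) - ct (T i)))) (vT T)
       + (if swap_entries i T \<in> ST then scaleS (emb (complex_of_real (sqrt (1 - 1 / a\<^sup>2)))) (vT (swap_entries i T)) else 0)"
    using assms(1,3)
    by (intro poly_mapping_eqI)
       (auto simp: lookup_RS_vT[OF assms(1)] rho_s[OF assms(2) _ assms(1)] lookup_single when_def lookup_add
          Let_def a_def[symmetric] hom_add simp del: One_nat_def of_int_diff)
  then show ?thesis by (rule that)
qed

lemma of_int_inj_f: "(of_int a :: 'f) = of_int b \<longleftrightarrow> a = b"
proof -
  have "emb (of_int a) = emb (of_int b) \<longleftrightarrow> a = b" by (simp del: hom_of_int)
  then show ?thesis by (simp add: hom_of_int)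
qed

text \<open>The diagonal matrices at \<open>i + 1\<close> act on \<open>s\<^sub>i v\<^sub>T\<close> by a power of the root of unity that depends on the
  component of the entry \<open>i\<close> in \<open>T\<close>. If the entries \<open>i\<close> and \<open>i + 1\<close> lie in different components, the sum over
  the roots is 0; otherwise all \<open>r\<close> summands equal \<open>s\<^sub>i v\<^sub>T\<close>.\<close>
lemma Rpsi_adjacent_vT:
  assumes T: "T \<in> ST" and i: "i \<in> {1..<n}"
  shows "Rpsi (i + 1) i (vT T) = (if beta (T i) = beta (T (i + 1))
     then scaleS (of_nat r) (RS (s_mat n i (i + 1)) (vT T)) else 0)"
proof -
  let ?s = "s_mat n i (i + 1)" and ?b = "beta (T i)" and ?b' = "beta (T (i + 1))"
  have ii: "i \<in> {1..n}" "i + 1 \<in> {1..n}" using i by auto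
  have br: "?b < r" "?b' < r" using SYT_beta_less[OF mp T] ii by auto
  have sc: "s_mat n (i + 1) i = ?s" by (simp add: s_mat_def transpose_commute)
  have Rd_s: "Rd (i + 1) x (RS ?s (vT T)) = scaleS (emb x ^ ?b) (RS ?s (vT T))" if x: "x \<in> unity_roots r" for x
  proof (cases "?b = ?b'")
    case False
    have "beta (swap_entries i T (i + 1)) = ?b" by (simp add: swap_entries_def)
    then show ?thesis
      using RS_s_diff[OF T i False] Rd_vT[OF swap_entries_SYT[OF T i False] ii(2) x] by simp
  next
    case True
    obtain q where q: "RS ?s (vT T) = scaleS (inverse (of_int (ct (T (i + 1)) - ct (T i)))) (vT T)
       + (if swap_entries i T \<in> ST then scaleS q (vT (swap_entries i T)) else 0)"
      by (rule RS_s_same[OF T i True])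
    have b: "beta (swap_entries i T (i + 1)) = ?b" by (simp add: swap_entries_def)
    show ?thesis
      unfolding q R_add R_scale Rd_vT[OF T ii(2) x]
      using Rd_vT[OF _ ii(2) x, of "swap_entries i T"] b True
      by (simp add: R_scale scale_right_distrib mult.commute)
  qed
  have "Rpsi (i + 1) i (vT T) = (\<Sum>x\<in>unity_roots r. scaleS (emb x ^ ?b * inverse (emb x) ^ ?b') (RS ?s (vT T)))"
    unfolding Rpsi_def
  proof (intro sum.cong refl)
    fix x assume x: "x \<in> unity_roots r"
    have "i + 1 \<noteq> i" by simp
    have "Rf (i + 1) i x (vT T) = Rd (i + 1) x (RS ?s (Rd (i + 1) (inverse x) (vT T)))"
      using Rf_factor[OF ii(2,1) \<open>i + 1 \<noteq> i\<close> x] unfolding sc .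
    also have "\<dots> = scaleS (emb x ^ ?b * inverse (emb x) ^ ?b') (RS ?s (vT T))"
      unfolding Rd_vT[OF T ii(2) root_inverse[OF x]] R_scale Rd_s[OF x] scale_scale
      by (simp add: hom_inverse mult.commute)
    finally show "Rf (i + 1) i x (vT T) = scaleS (emb x ^ ?b * inverse (emb x) ^ ?b') (RS ?s (vT T))" .
  qed
  also have "\<dots> = scaleS (if ?b mod r = ?b' mod r then of_nat r else 0) (RS ?s (vT T))"
    unfolding scale_sum_left[symmetric] sum_roots_emb ..
  finally show ?thesis using br by simp
qed

lemma Phi_add: "Phi k (u + v) = Phi k u + Phi k v"
  by (simp add: Phi_def Rpsi_def R_add sum.distrib)

lemma Phi_scale: "Phi k (scaleS a v) = scaleS a (Phi k v)"
  by (simp add: Phi_def Rpsi_def R_scale scale_sum_right)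

text \<open>Induction along \<open>Phi_Suc\<close>. The box of the entry 1 has content 0. In the step, if the entries
  \<open>i\<close> and \<open>i + 1\<close> lie in different components, the recursion just exchanges them. In the same component, with
  contents \<open>c\<close>, \<open>c'\<close> and \<open>a = c' - c\<close>, the seminormal form gives \<open>\<phi>\<^sub>i s\<^sub>i v\<^sub>T = r (c' s\<^sub>i v\<^sub>T - v\<^sub>T)\<close>; applying
  \<open>s\<^sub>i\<close> and adding \<open>r s\<^sub>i v\<^sub>T\<close> leaves \<open>r c' v\<^sub>T\<close>.\<close>
theorem jucys_murphy:
  assumes "T \<in> ST" "k \<in> {1..n}"
  shows "Phi k (vT T) = scaleS (of_nat r * of_int (ct (T k))) (vT T)"
proof -
  have "T \<in> ST \<Longrightarrow> Suc k \<le> n \<Longrightarrow> Phi (Suc k) (vT T) = scaleS (of_nat r * of_int (ct (T (Suc k)))) (vT T)" for k T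
  proof (induction k arbitrary: T)
    case 0
    then show ?case using SYT_first_corner[OF mp 0(1) n_pos] by (simp add: Phi_def)
  next
    case (Suc k)
    define i where "i = Suc k"
    have i: "i \<in> {1..<n}" "Suc (Suc k) = i + 1" using Suc by (auto simp: i_def)
    have in': "Suc k \<le> n" using Suc by simp
    have IH: "Phi i (vT T') = scaleS (of_nat r * of_int (ct (T' i))) (vT T')" if "T' \<in> ST" for T'
      using Suc.IH[OF that in'] by (simp only: i_def)
    note T = Suc.prems(1)
    let ?s = "RS (s_mat n i (i + 1))" and ?c = "ct (T i)" and ?c' = "ct (T (i + 1))"
    let ?T = "swap_entries i T"
    have ii: "i \<in> {1..n}" "i + 1 \<in> {1..n}" using i by auto
    have ss: "?s (?s v) = v" for v by (rule s_mat_involution[OF ii])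
    have cs: "ct (?T i) = ?c'" by (simp add: swap_entries_def)
    show ?case
      unfolding i(2) Phi_Suc[OF i(1)] Rpsi_adjacent_vT[OF T i(1)]
    proof (cases "beta (T i) = beta (T (i + 1))")
      case False
      have "?s (Phi i (?s (vT T))) = scaleS (of_nat r * of_int ?c') (?s (?s (vT T)))"
        unfolding RS_s_diff[OF T i(1) False] IH[OF swap_entries_SYT[OF T i(1) False]] R_scale cs ..
      then show "?s (Phi i (?s (vT T))) + (if beta (T i) = beta (T (i + 1)) then scaleS (of_nat r) (?s (vT T)) else 0)
        = scaleS (of_nat r * of_int ?c') (vT T)" using False ss by simp
    next
      case True
      obtain q where q: "?s (vT T) = scaleS (inverse (of_int (?c' - ?c))) (vT T)
       + (if ?T \<in> ST then scaleS q (vT ?T) else 0)"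
        by (rule RS_s_same[OF T i(1) True])
      let ?a = "of_int (?c' - ?c) :: 'f"
      have a0: "?a \<noteq> 0"
        using SYT_adjacent_content[OF mp T i(1) True] of_int_inj_f[of "?c' - ?c" 0] by simp
      have P: "Phi i (?s (vT T)) = scaleS (of_nat r) (scaleS (of_int ?c') (?s (vT T)) - vT T)"
      proof -
        have "Phi i (?s (vT T)) = scaleS (inverse ?a * (of_nat r * of_int ?c)) (vT T)
           + scaleS (of_nat r * of_int ?c') (if ?T \<in> ST then scaleS q (vT ?T) else 0)"
          unfolding q Phi_add Phi_scale IH[OF T]
          using IH[of ?T] cs by (simp add: Phi_scale scale_left_commute) (simp add: Phi_def Rpsi_def)
        also have "\<dots> = scaleS (inverse ?a * (of_nat r * of_int ?c) - of_nat r * of_int ?c' * inverse ?a) (vT T)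
           + scaleS (of_nat r * of_int ?c') (?s (vT T))"
          unfolding q scale_right_distrib scale_scale scale_left_diff_distrib by simp
        also have "inverse ?a * (of_nat r * of_int ?c) - of_nat r * of_int ?c' * inverse ?a = - of_nat r"
        proof -
          have "inverse a * (R * c) - R * c' * inverse a = - R" if "c' - c = a" "a \<noteq> 0" for a c c' R :: 'f
          proof -
            have "inverse a * (R * c) - R * c' * inverse a = - (R * (inverse a * (c' - c)))"
              by (simp add: algebra_simps)
            then show ?thesis using that by simp
          qed
          then show ?thesis using a0 by simp
        qed
        finally show ?thesis
          by (simp only: scale_right_diff_distrib scale_scale scale_minus_left) simp
      qed
      have sd: "?s (u - v) = ?s u - ?s v" for u v
        using R_add[of "s_mat n i (i + 1)" "u - v" v] by (simp add: algebra_simps)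
      have "?s (Phi i (?s (vT T))) = scaleS (of_nat r * of_int ?c') (vT T) - scaleS (of_nat r) (?s (vT T))"
        unfolding P R_scale sd ss by (simp add: scale_right_diff_distrib del: scaleV_single)
      then show "?s (Phi i (?s (vT T))) + (if beta (T i) = beta (T (i + 1)) then scaleS (of_nat r) (?s (vT T)) else 0)
        = scaleS (of_nat r * of_int ?c') (vT T)" using True by simp
    qed
  qed
  from this[of T "k - 1"] show ?thesis using assms by simp
qed

end

section \<open>Triangularity of the operators z\<close>

context induced_model begin

definition lower :: "(nat \<Rightarrow> nat) \<Rightarrow> 's pol set" where
  "lower m = {P. keys P \<subseteq> {nu \<in> compositions n. comp_less n nu m} \<and> (\<forall>k. lookup P k \<in> S0)}"

lemma lower_V0: "P \<in> lower m \<Longrightarrow> P \<in> V0"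
  by (auto simp: lower_def V0_def)

lemma subspace_lower: "V.subspace (lower m)"
proof (rule V.subspaceI)
  show "0 \<in> lower m" by (simp add: lower_def S0_0)
  show "P + Q \<in> lower m" if "P \<in> lower m" "Q \<in> lower m" for P Q
    using that Poly_Mapping.keys_add[of P Q] unfolding lower_def by (auto simp: lookup_add S0_add)
  show "scaleV a P \<in> lower m" if "P \<in> lower m" for a P
    using that unfolding lower_def by (auto simp: S0_scale in_keys_iff)
qed

lemmas lower_intros = V.subspace_0[OF subspace_lower] V.subspace_add[OF subspace_lower]
  V.subspace_diff[OF subspace_lower] V.subspace_neg[OF subspace_lower] V.subspace_scale[OF subspace_lower]
  V.subspace_sum[OF subspace_lower]

lemma lower_single:
  "nu \<in> compositions n \<Longrightarrow> comp_less n nu m \<Longrightarrow> u \<in> S0 \<Longrightarrow> single nu u \<in> lower m"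
  by (auto simp: lower_def lookup_single when_def S0_0)

text \<open>Of the exponents between \<open>m\<^sub>j\<close> and \<open>m\<^sub>i\<close> in the geometric sum, the inner ones are smaller in the
  dominance order. One end is \<open>x\<^sup>m\<close>, and it is present exactly if \<open>m\<^sub>j \<le> m\<^sub>i\<close>; the other end is the exchange, which
  the term with \<open>j < i\<close> (from \<open>\<phi>\<^sub>i\<close>) either cancels or, if \<open>m\<^sub>i < m\<^sub>j\<close>, supplies as a term that is smaller in
  the Bruhat order. For \<open>m\<^sub>i = m\<^sub>j\<close> both ends coincide, and \<open>x\<^sup>m\<close> survives only if \<open>i < j\<close>. These are the
  conditions for \<open>w_comp n m j < w_comp n m i\<close>.\<close>
lemma nabla_triangular:
  assumes i: "i \<in> {1..n}" and j: "j \<in> {1..n}" and ij: "i \<noteq> j" and m: "m \<in> compositions n" and u: "u \<in> S0"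
  shows "nabla i j x (m(i := m i + 1)) u
    - (if j < i then single (m(i := m j, j := m i)) (scale (emb x powi (int (m i) - int (m j))) u) else 0)
    - (if w_comp n m j < w_comp n m i then single m u else 0) \<in> lower m"
proof -
  let ?a = "m i" and ?b = "m j"
  define G where "G e = single (m(i := e, j := ?a + ?b - e)) (scale (emb x powi (int ?a - int e)) u)" for e
  have "nabla_term i j x (m(i := ?a + 1)) u = G"
    using ij by (intro ext) (simp add: nabla_term_def G_def fun_upd_twist)
  then have N: "nabla i j x (m(i := ?a + 1)) u = sum G {..<Suc ?a} - sum G {..<?b}"
    using ij by (simp add: nabla_def)
  have Gb: "G ?b = single (m(i := ?b, j := ?a)) (scale (emb x powi (int ?a - int ?b)) u)"
    by (simp add: G_def)
  have Ga: "G ?a = single m u" by (simp add: G_def)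
  have comp: "m(i := e, j := e') \<in> compositions n" for e e' using m i j by (auto simp: compositions_def)
  have mid: "G e \<in> lower m" if "min ?a ?b < e" "e < max ?a ?b" for e
    unfolding G_def by (intro lower_single comp S0_scale u comp_less_between i j ij that)
  have swap: "G ?b \<in> lower m" if "(i < j \<and> ?b < ?a) \<or> (j < i \<and> ?a < ?b)"
    unfolding Gb by (intro lower_single comp S0_scale u comp_less_swap i j that)
  have w: "w_comp n m j < w_comp n m i \<longleftrightarrow> ?b < ?a \<or> (?b = ?a \<and> i < j)"
    by (rule w_comp_less_iff[OF j i])
  consider "?b < ?a" | "?b = ?a" | "?a < ?b" by linarith
  then show ?thesis
  proof cases
    case 1
    have "sum G {..<?a} = sum G {..<?b} + sum G {?b..<?a}"
      using 1 sum.atLeastLessThan_concat[of 0 ?b ?a G] by (simp add: atLeast0LessThan)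
    also have "sum G {?b..<?a} = G ?b + sum G {Suc ?b..<?a}" by (rule sum.atLeast_Suc_lessThan[OF 1])
    finally have "nabla i j x (m(i := ?a + 1)) u = G ?b + sum G {Suc ?b..<?a} + G ?a" unfolding N by simp
    then have "nabla i j x (m(i := ?a + 1)) u - (if j < i then G ?b else 0) - G ?a
        = sum G {Suc ?b..<?a} + (if j < i then 0 else G ?b)" by simp
    moreover have "sum G {Suc ?b..<?a} \<in> lower m" using 1 by (intro lower_intros mid) auto
    moreover have "(if j < i then 0 else G ?b) \<in> lower m" using 1 ij by (auto intro: lower_intros swap)
    ultimately show ?thesis using 1 w lower_intros(2) unfolding Gb[symmetric] Ga[symmetric] by simp
  next
    case 2
    have "nabla i j x (m(i := ?a + 1)) u = G ?a" unfolding N using 2 by simp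
    then show ?thesis
      unfolding Gb[symmetric] Ga[symmetric] using 2 w ij lower_intros(1) by auto
  next
    case 3
    have "sum G {..<?b} = sum G {..<Suc ?a} + sum G {Suc ?a..<?b}"
      using 3 sum.atLeastLessThan_concat[of 0 "Suc ?a" ?b G] by (simp add: atLeast0LessThan)
    then have "nabla i j x (m(i := ?a + 1)) u - (if j < i then G ?b else 0)
        = - sum G {Suc ?a..<?b} - (if j < i then G ?b else 0)" unfolding N by simp
    moreover have "- sum G {Suc ?a..<?b} \<in> lower m" using 3 by (intro lower_intros mid) auto
    moreover have "(if j < i then G ?b else 0) \<in> lower m" using 3 by (auto intro: lower_intros swap)
    ultimately show ?thesis using 3 w lower_intros(3) unfolding Gb[symmetric] Ga[symmetric] by simp
  qed
qed

text \<open>Summing \<open>nabla_triangular\<close> over all reflections that involve \<open>i\<close>.\<close>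
lemma zop_single_triangular:
  assumes i: "i \<in> {1..n}" and m: "m \<in> compositions n" and v: "v \<in> S0"
  shows "zop i (single m v) - single m
     (scale (kappa * of_nat (m i + 1)) v
      - (\<Sum>x\<in>unity_roots r. scale (dcoef x * (\<Sum>p<m i + 1. inverse (emb x) ^ p)) (Rd i x v))
      - scale c0 (\<Sum>j\<in>{j \<in> {1..n}. w_comp n m j < w_comp n m i}. Rpsi i j v)) \<in> lower m"
proof -
  let ?U = "unity_roots r"
  let ?m = "m(i := m i + 1)"
  let ?w = "w_comp n m"
  let ?J = "{1..n} - {i}"
  define sw where "sw j x = single (m(i := m j, j := m i)) (scale (emb x powi (int (m i) - int (m j))) (Rf i j x v))" for j x
  define E where "E j x = nabla i j x ?m (Rf i j x v) - (if j < i then sw j x else 0)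
    - (if ?w j < ?w i then single m (Rf i j x v) else 0)" for j x
  have mm: "?m(i := ?m i - 1) = m" "?m i = m i + 1" by simp_all
  have jm: "jm i (single m v) = (\<Sum>j\<in>?J. \<Sum>x\<in>?U. if j < i then sw j x else 0)"
  proof -
    have "jm i (single m v) = (\<Sum>j\<in>{1..<i}. \<Sum>x\<in>?U. sw j x)"
      unfolding jm_def psi_def
    proof (intro sum.cong refl)
      fix j x assume "j \<in> {1..<i}" "x \<in> ?U"
      then show "Tf i j x (single m v) = sw j x"
        unfolding sw_def using i by (intro Tf_single) auto
    qed
    also have "\<dots> = (\<Sum>j\<in>{1..<i}. \<Sum>x\<in>?U. if j < i then sw j x else 0)"
      by (intro sum.cong refl) auto
    also have "\<dots> = (\<Sum>j\<in>?J. \<Sum>x\<in>?U. if j < i then sw j x else 0)"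
      using i by (intro sum.mono_neutral_left) auto
    finally show ?thesis .
  qed
  have wsum: "single m (\<Sum>j\<in>{j \<in> {1..n}. ?w j < ?w i}. Rpsi i j v)
      = (\<Sum>j\<in>?J. \<Sum>x\<in>?U. if ?w j < ?w i then single m (Rf i j x v) else 0)"
  proof -
    have "single m (\<Sum>j\<in>{j \<in> {1..n}. ?w j < ?w i}. Rpsi i j v)
      = (\<Sum>j\<in>{j \<in> {1..n}. ?w j < ?w i}. \<Sum>x\<in>?U. if ?w j < ?w i then single m (Rf i j x v) else 0)"
      unfolding single_sum Rpsi_def by (intro sum.cong refl) auto
    also have "\<dots> = (\<Sum>j\<in>?J. \<Sum>x\<in>?U. if ?w j < ?w i then single m (Rf i j x v) else 0)"
      by (intro sum.mono_neutral_left) auto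
    finally show ?thesis .
  qed
  have z: "zop i (single m v) = single m (scale (kappa * of_nat (m i + 1)) v)
     - single m (\<Sum>x\<in>?U. scale (dcoef x * (\<Sum>p<m i + 1. inverse (emb x) ^ p)) (Rd i x v))
     - scaleV c0 (\<Sum>j\<in>?J. \<Sum>x\<in>?U. nabla i j x ?m (Rf i j x v))
     + scaleV c0 (\<Sum>j\<in>?J. \<Sum>x\<in>?U. if j < i then sw j x else 0)"
    unfolding zop_def yx_def X_single Y_single Y_mono_def mm(1) unfolding mm(2) jm ..
  have "zop i (single m v) - single m
     (scale (kappa * of_nat (m i + 1)) v
      - (\<Sum>x\<in>unity_roots r. scale (dcoef x * (\<Sum>p<m i + 1. inverse (emb x) ^ p)) (Rd i x v))
      - scale c0 (\<Sum>j\<in>{j \<in> {1..n}. ?w j < ?w i}. Rpsi i j v))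
     = - scaleV c0 (\<Sum>j\<in>?J. \<Sum>x\<in>?U. E j x)"
    unfolding z single_diff scaleV_single[symmetric] wsum E_def sum_subtractf V.scale_right_diff_distrib
    by (simp del: scaleV_single)
  also have "\<dots> \<in> lower m"
  proof (intro lower_intros)
    fix j x assume j: "j \<in> ?J" and x: "x \<in> ?U"
    then have jj: "j \<in> {1..n}" "i \<noteq> j" by auto
    have "Rf i j x v \<in> S0" by (intro S0_R mono_mat_in_G adm_refl' i jj x r_pos v)
    then show "E j x \<in> lower m"
      unfolding E_def sw_def by (rule nabla_triangular[OF i jj m])
  qed
  finally show ?thesis .
qed

end

context lambda_model begin

text \<open>The vector \<open>v\<^sub>T\<^sup>\<mu>\<close>.\<close>
definition vmu :: "(nat \<Rightarrow> nat) \<Rightarrow> tableau \<Rightarrow> (tableau \<Rightarrow>\<^sub>0 'f)" where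
  "vmu m T = RS (mono_mat n (pinv (w_comp n m)) (\<lambda>_. 1)) (vT T)"

lemma adm_w: "adm r n (w_comp n m) (\<lambda>_. 1)"
  and adm_w_inv: "adm r n (pinv (w_comp n m)) (\<lambda>_. 1)"
  by (intro adm_perm w_comp_permutes permutes_inv)+

lemma v_mu_eq:
  assumes "T \<in> ST" shows "v_mu emb r n lam rho m T = vmu m T"
  unfolding v_mu_def vmu_def perm_mat_mono inv_mono_mat[OF adm_w r_pos]
  using S_act_RS[OF vT_S_space[OF assms]] by simp

lemma vmu_S_space: "T \<in> ST \<Longrightarrow> vmu m T \<in> S_space n lam"
  unfolding vmu_def by (intro S0_R mono_mat_in_G adm_w_inv r_pos vT_S_space)

lemma w_cancel:
  "RS (mono_mat n (pinv (w_comp n m)) (\<lambda>_. 1)) (RS (mono_mat n (w_comp n m) (\<lambda>_. 1)) v) = v"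
  "RS (mono_mat n (w_comp n m) (\<lambda>_. 1)) (RS (mono_mat n (pinv (w_comp n m)) (\<lambda>_. 1)) v) = v"
  using mono_mat_one R_one permutes_inv_o[OF w_comp_permutes[of n m]]
  unfolding R_mono_mult[OF adm_w_inv adm_w] R_mono_mult[OF adm_w adm_w_inv] by simp_all

lemma vmu_nonzero: "vmu m T \<noteq> 0"
proof
  assume "vmu m T = 0"
  then have "vT T = 0" using w_cancel(2)[of m "vT T"] by (simp add: vmu_def)
  then show False by (metis lookup_single_eq lookup_zero zero_neq_one)
qed

text \<open>The element \<open>x\<^sup>\<mu> v\<^sub>T\<^sup>\<mu>\<close> for \<open>p = (\<mu>, T)\<close>.\<close>
definition basis_elt :: "(nat \<Rightarrow> nat) \<times> tableau \<Rightarrow> (tableau \<Rightarrow>\<^sub>0 'f) pol" where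
  "basis_elt p = single (fst p) (vmu (fst p) (snd p))"

lemma basis_elt_V0: "m \<in> compositions n \<Longrightarrow> T \<in> ST \<Longrightarrow> basis_elt (m, T) \<in> V0"
  unfolding basis_elt_def by (simp add: V0_single vmu_S_space)

lemma single_in_span_basis_elt:
  assumes v: "v \<in> S_space n lam"
  shows "single m v \<in> V.span (basis_elt ` ({m} \<times> ST))"
proof -
  let ?g = "mono_mat n (pinv (w_comp n m)) (\<lambda>_. 1)"
  \<comment> \<open>Undo \<open>w\<close>, expand in the standard tableaux, and apply it back.\<close>
  define u where "u = RS (mono_mat n (w_comp n m) (\<lambda>_. 1)) v"
  have u: "u \<in> S_space n lam" unfolding u_def by (intro S0_R mono_mat_in_G adm_w r_pos v)
  have "u = (\<Sum>T\<in>ST. scaleS (lookup u T) (vT T))"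
  proof (rule poly_mapping_eqI)
    fix S
    have "(\<Sum>T\<in>ST. lookup u T * lookup (vT T) S)
       = (\<Sum>T\<in>ST. if T = S then lookup u S else 0)"
      by (intro sum.cong) (auto simp: lookup_single when_def)
    then show "lookup u S = lookup (\<Sum>T\<in>ST. scaleS (lookup u T) (vT T)) S"
      using u finite_SYT by (auto simp: lookup_sum S_space_iff)
  qed
  then have "v = (\<Sum>T\<in>ST. scaleS (lookup u T) (vmu m T))"
    using w_cancel(1)[of m v] unfolding u_def[symmetric] vmu_def by (metis (no_types, lifting) R_sum R_scale sum.cong)
  then have "single m v = (\<Sum>T\<in>ST. scaleV (lookup u T) (basis_elt (m, T)))"
    by (simp add: basis_elt_def single_sum[symmetric])
  then show ?thesis by (simp only:) (intro V.span_sum V.span_scale V.span_base, auto)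
qed

text \<open>For fixed \<open>\<nu>\<close> the vectors \<open>v\<^sub>S\<^sup>\<nu>\<close> are the image of a basis under an invertible map.\<close>
lemma lower_span: "lower m = V.span (basis_elt ` lower_pairs n lam m)"
proof
  show "V.span (basis_elt ` lower_pairs n lam m) \<subseteq> lower m"
  proof (rule V.span_minimal[OF _ subspace_lower])
    show "basis_elt ` lower_pairs n lam m \<subseteq> lower m"
      unfolding lower_pairs_def basis_elt_def by (auto intro!: lower_single vmu_S_space)
  qed
  show "lower m \<subseteq> V.span (basis_elt ` lower_pairs n lam m)"
  proof
    fix P assume P: "P \<in> lower m"
    have "single k (lookup P k) \<in> V.span (basis_elt ` lower_pairs n lam m)"
      if k: "k \<in> keys P" for k
    proof -
      have "{k} \<times> ST \<subseteq> lower_pairs n lam m" using P k by (auto simp: lower_def lower_pairs_def)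
      then have "V.span (basis_elt ` ({k} \<times> ST)) \<subseteq> V.span (basis_elt ` lower_pairs n lam m)"
        by (intro V.span_mono image_mono)
      moreover have "lookup P k \<in> S_space n lam" using P by (simp add: lower_def)
      ultimately show ?thesis using single_in_span_basis_elt by blast
    qed
    then show "P \<in> V.span (basis_elt ` lower_pairs n lam m)"
      by (subst poly_mapping_expand[of P]) (rule V.span_sum)
  qed
qed

text \<open>The eigenvalues of \<open>z\<^sub>i\<close> and of \<open>t\<close> at \<open>\<zeta>\<^sub>i\<close> that belong to \<open>x\<^sup>m v\<^sub>T\<^sup>m\<close>.\<close>
definition zval :: "nat \<Rightarrow> (nat \<Rightarrow> nat) \<Rightarrow> tableau \<Rightarrow> 'f" where
  "zval i m T = kappa * of_nat (m i + 1)
     - (d_ext r d (int (beta (T (w_comp n m i)))) - d_ext r d (int (beta (T (w_comp n m i))) - int (m i) - 1))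
     - c0 * of_nat r * of_int (ct (T (w_comp n m i)))"

definition tval :: "nat \<Rightarrow> (nat \<Rightarrow> nat) \<Rightarrow> tableau \<Rightarrow> 'f" where
  "tval i m T = emb (zeta r powi (int (beta (T (w_comp n m i))) - int (m i)))"

lemma w_in: "i \<in> {1..n} \<Longrightarrow> w_comp n m i \<in> {1..n}"
  using permutes_in_image[OF w_comp_permutes] by blast

lemma Rd_vmu:
  assumes "T \<in> ST" "i \<in> {1..n}" "x \<in> unity_roots r"
  shows "Rd i x (vmu m T) = scaleS (emb x ^ beta (T (w_comp n m i))) (vmu m T)"
proof -
  have "Rd i x (vmu m T) = RS (mono_mat n (pinv (w_comp n m)) (\<lambda>_. 1)) (Rd (w_comp n m i) x (vT T))"
    unfolding R_Rd[OF adm_w_inv assms(3)] vmu_def permutes_inverses(2)[OF w_comp_permutes] ..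
  then show ?thesis
    unfolding Rd_vT[OF assms(1) w_in[OF assms(2)] assms(3)] R_scale vmu_def .
qed

text \<open>Conjugation by \<open>w\<^sub>m\<close> carries the reflections in \<open>i\<close> and \<open>j\<close> with \<open>w\<^sub>m(j) < w\<^sub>m(i)\<close> to those in \<open>w\<^sub>m(i)\<close>
  and any smaller index, whose sum is a Jucys-Murphy element.\<close>
lemma Rpsi_vmu:
  assumes T: "T \<in> ST" and i: "i \<in> {1..n}"
  shows "(\<Sum>j\<in>{j \<in> {1..n}. w_comp n m j < w_comp n m i}. Rpsi i j (vmu m T))
    = scaleS (of_nat r * of_int (ct (T (w_comp n m i)))) (vmu m T)"
proof -
  let ?w = "w_comp n m"
  let ?g = "mono_mat n (pinv ?w) (\<lambda>_. 1)"
  have p: "?w permutes {1..n}" by (rule w_comp_permutes)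
  have "(\<Sum>j\<in>{j \<in> {1..n}. ?w j < ?w i}. Rpsi i j (vmu m T))
     = (\<Sum>j\<in>{j \<in> {1..n}. ?w j < ?w i}. RS ?g (Rpsi (?w i) (?w j) (vT T)))"
  proof (intro sum.cong refl)
    fix j assume "j \<in> {j \<in> {1..n}. ?w j < ?w i}"
    then have j: "j \<in> {1..n}" "?w i \<noteq> ?w j" by auto
    show "Rpsi i j (vmu m T) = RS ?g (Rpsi (?w i) (?w j) (vT T))"
      unfolding R_Rpsi[OF adm_w_inv w_in[OF i] w_in[OF j(1)] j(2)] permutes_inverses(2)[OF p] vmu_def ..
  qed
  also have "\<dots> = RS ?g (\<Sum>j\<in>{j \<in> {1..n}. ?w j < ?w i}. Rpsi (?w i) (?w j) (vT T))"
    by (rule R_sum[symmetric])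
  also have "(\<Sum>j\<in>{j \<in> {1..n}. ?w j < ?w i}. Rpsi (?w i) (?w j) (vT T)) = Phi (?w i) (vT T)"
    unfolding Phi_def
  proof (rule sum.reindex_bij_betw)
    have "?w ` {j \<in> {1..n}. ?w j < ?w i} = {1..<?w i}"
    proof (intro equalityI subsetI)
      fix k assume "k \<in> ?w ` {j \<in> {1..n}. ?w j < ?w i}"
      then obtain j where "j \<in> {1..n}" "?w j < ?w i" "k = ?w j" by blast
      then show "k \<in> {1..<?w i}" using w_in[of j m] by auto
    next
      fix k assume k: "k \<in> {1..<?w i}"
      then have "k \<in> {1..n}" using w_in[OF i, of m] by auto
      then obtain j where "j \<in> {1..n}" "k = ?w j" using permutes_image[OF p] by blast
      then show "k \<in> ?w ` {j \<in> {1..n}. ?w j < ?w i}" using k by auto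
    qed
    then show "bij_betw ?w {j \<in> {1..n}. ?w j < ?w i} {1..<?w i}"
      using permutes_inj_on[OF p] by (auto simp: bij_betw_def)
  qed
  finally show ?thesis
    unfolding jucys_murphy[OF T w_in[OF i]] R_scale vmu_def .
qed

theorem zop_basis_elt:
  assumes m: "m \<in> compositions n" and T: "T \<in> ST" and i: "i \<in> {1..n}"
  shows "zop i (basis_elt (m, T)) - scaleV (zval i m T) (basis_elt (m, T)) \<in> lower m"
proof -
  let ?b = "beta (T (w_comp n m i))"
  have 1: "(\<Sum>x\<in>unity_roots r. scaleS (dcoef x * (\<Sum>p<m i + 1. inverse (emb x) ^ p)) (Rd i x (vmu m T)))
    = scaleS (d_ext r d (int ?b) - d_ext r d (int ?b - int (m i) - 1)) (vmu m T)"
  proof -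
    have "(\<Sum>x\<in>unity_roots r. scaleS (dcoef x * (\<Sum>p<m i + 1. inverse (emb x) ^ p)) (Rd i x (vmu m T)))
      = (\<Sum>x\<in>unity_roots r. scaleS (dcoef x * (\<Sum>p<m i + 1. inverse (emb x) ^ p) * emb x ^ ?b) (vmu m T))"
      by (intro sum.cong refl) (simp only: Rd_vmu[OF T i] scale_scale)
    also have "\<dots> = scaleS (d_ext r d (int ?b) - d_ext r d (int ?b - int (m i + 1))) (vmu m T)"
      unfolding scale_sum_left[symmetric] dcoef_telescope ..
    finally show ?thesis by (simp add: algebra_simps)
  qed
  show ?thesis
    using zop_single_triangular[OF i m vmu_S_space[OF T, of m]]
    unfolding 1 Rpsi_vmu[OF T i] scale_scale scale_left_diff_distrib[symmetric]
    by (simp add: basis_elt_def zval_def mult.assoc)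
qed

lemma Td_basis_elt:
  assumes "T \<in> ST" "i \<in> {1..n}"
  shows "Td i (zeta r) (basis_elt (m, T)) = scaleV (tval i m T) (basis_elt (m, T))"
proof -
  have "inverse (emb (zeta r)) ^ m i * emb (zeta r) ^ beta (T (w_comp n m i)) = tval i m T"
    unfolding tval_def hom_inverse[symmetric] hom_power[symmetric] hom_mult[symmetric]
    by (simp add: power_int_diff power_inverse divide_inverse mult.commute)
  then show ?thesis
    using Rd_vmu[OF assms, of "zeta r" m] zeta_power_root[of 1]
    unfolding basis_elt_def fst_conv snd_conv Td_single[OF assms(2)] by simp
qed

section \<open>Separation of eigenvalues\<close>

text \<open>The coefficient of the parameter \<open>d\<^sub>j\<close>, for \<open>1 \<le> j < r\<close>, in \<open>d\<^sub>k\<close>; the parameter \<open>d\<^sub>0\<close> is minus the sum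
  of the others.\<close>
definition d_coeff :: "int \<Rightarrow> nat \<Rightarrow> int" where
  "d_coeff k j = (if k mod int r = 0 then - 1 else if int j = k mod int r then 1 else 0)"

lemma d_ext_eq_sum: "d_ext r d k = (\<Sum>j\<in>{1..<r}. of_int (d_coeff k j) * d j)"
proof (cases "k mod int r = 0")
  case True
  then show ?thesis by (simp add: d_ext_def d_coeff_def sum_negf)
next
  case False
  let ?j = "nat (k mod int r)"
  have k: "0 \<le> k mod int r" "k mod int r < int r" using r_pos by simp_all
  have "(\<Sum>j\<in>{1..<r}. of_int (d_coeff k j) * d j) = (\<Sum>j\<in>{1..<r}. if j = ?j then d ?j else 0)"
    using False k by (intro sum.cong) (auto simp: d_coeff_def)
  moreover have "?j \<in> {1..<r}" using False k by auto
  ultimately show ?thesis using False by (simp add: d_ext_def)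
qed

text \<open>The difference of the two eigenvalues is a linear combination of the parameters, and the coefficient
  of \<open>\<kappa>\<close> in it is the difference of the two exponents.\<close>
lemma zval_separates:
  assumes ind: "alg_independent emb r (param kappa c0 d)" and eq: "zval i m T = zval i m' T'"
  shows "m i = m' i"
proof -
  let ?b = "int (beta (T (w_comp n m i)))" and ?b' = "int (beta (T' (w_comp n m' i)))"
  let ?c = "ct (T (w_comp n m i))" and ?c' = "ct (T' (w_comp n m' i))"
  define D where "D j = d_coeff ?b j - d_coeff (?b - int (m i) - 1) j - (d_coeff ?b' j - d_coeff (?b' - int (m' i) - 1) j)" for j
  \<comment> \<open>Coefficients of the difference of the eigenvalues, numbered like the parameters in \<open>param\<close>.\<close>
  define q where "q k = (if k = 0 then int (m i) - int (m' i) else if k = 1 then - (int r * (?c - ?c')) else - D (k - 1))" for k :: nat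
  have DS: "(\<Sum>j\<in>{1..<r}. of_int (D j) * d j) = (d_ext r d ?b - d_ext r d (?b - int (m i) - 1))
     - (d_ext r d ?b' - d_ext r d (?b' - int (m' i) - 1))"
    unfolding d_ext_eq_sum D_def by (simp add: sum_subtractf[symmetric] left_diff_distrib)
  have "(\<Sum>k\<in>{0..r}. of_int (q k) * param kappa c0 d k)
    = of_int (q 0) * kappa + (of_int (q 1) * c0 + (\<Sum>k\<in>{2..r}. of_int (q k) * param kappa c0 d k))"
  proof -
    have "{0..r} = insert 0 (insert 1 {2..r})" using r_pos by auto
    then show ?thesis by (simp add: param_def)
  qed
  also have "(\<Sum>k\<in>{2..r}. of_int (q k) * param kappa c0 d k) = (\<Sum>j\<in>{1..<r}. - (of_int (D j) * d j))"
    by (rule sum.reindex_bij_witness[of _ Suc "\<lambda>k. k - 1"]) (auto simp: q_def param_def)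
  also have "\<dots> = - (\<Sum>j\<in>{1..<r}. of_int (D j) * d j)" by (rule sum_negf)
  also have "of_int (q 0) * kappa + (of_int (q 1) * c0 + \<dots>) = zval i m T - zval i m' T'"
    unfolding DS by (simp add: q_def zval_def algebra_simps)
  finally have "(\<Sum>k\<in>{0..r}. emb (of_int (q k)) * param kappa c0 d k) = 0"
    using eq by (simp add: hom_of_int)
  then have "(of_int (q 0) :: complex) = 0"
    by (rule alg_independent_linear[OF ind hom_zero]) simp
  then show ?thesis by (simp add: q_def)
qed

section \<open>Transfer to the standard module\<close>

abbreviation xvb where "xvb \<equiv> xv emb r n kappa c0 d lam rho"

lemma standard_module_MM: "standard_module emb r n kappa c0 d lam rho = MM"
  by (simp add: standard_module_def)

lemma xv_of_model:
  assumes "m \<in> compositions n" "T \<in> ST"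
  shows "xvb m T = of_model (basis_elt (m, T))"
  unfolding xv_def v_mu_eq[OF assms(2)] of_model_tensor[OF x_pow_FA vmu_S_space[OF assms(2)]]
    act_x_pow[OF assms(1)] by (simp add: basis_elt_def)

lemma lower_pairsD: "p \<in> lower_pairs n lam m \<Longrightarrow> fst p \<in> compositions n \<and> snd p \<in> ST"
  by (auto simp: lower_pairs_def)

lemma basis_elt_V0_pair: "p \<in> lower_pairs n lam m \<Longrightarrow> basis_elt p \<in> V0"
  using basis_elt_V0[of "fst p" "snd p"] lower_pairsD[of p m] by simp

lemma comb_of_model:
  "(\<Oplus>\<^bsub>MM\<^esub>p\<in>lower_pairs n lam m. h (scal (c p)) \<odot>\<^bsub>MM\<^esub> xvb (fst p) (snd p))
     = of_model (\<Sum>p\<in>lower_pairs n lam m. scaleV (c p) (basis_elt p))"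
proof -
  have e: "h (scal (c p)) \<odot>\<^bsub>MM\<^esub> xvb (fst p) (snd p) = of_model (scaleV (c p) (basis_elt p))"
    if p: "p \<in> lower_pairs n lam m" for p
    using xv_of_model[of "fst p" "snd p"] lower_pairsD[OF p] of_model_smult[OF FA_scal basis_elt_V0_pair[OF p]] by simp
  have "(\<Oplus>\<^bsub>MM\<^esub>p\<in>lower_pairs n lam m. h (scal (c p)) \<odot>\<^bsub>MM\<^esub> xvb (fst p) (snd p))
     = (\<Oplus>\<^bsub>MM\<^esub>p\<in>lower_pairs n lam m. of_model (scaleV (c p) (basis_elt p)))"
  proof (rule abelian_monoid.finsum_cong'[OF abelian_monoid_MM refl _ e])
    show "(\<lambda>p. of_model (scaleV (c p) (basis_elt p))) \<in> lower_pairs n lam m \<rightarrow> carrier MM"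
      unfolding carrier_MM using basis_elt_V0_pair V0_scale by blast
  qed
  then show ?thesis
    using of_model_finsum[OF finite_lower_pairs, of n lam m "\<lambda>p. scaleV (c p) (basis_elt p)"] basis_elt_V0_pair V0_scale by simp
qed

lemma comb_lower: "(\<Sum>p\<in>lower_pairs n lam m. scaleV (c p) (basis_elt p)) \<in> lower m"
  unfolding lower_span by (intro V.span_sum V.span_scale V.span_base imageI)

lemma lower_comb:
  assumes "P \<in> lower m" obtains c where "P = (\<Sum>p\<in>lower_pairs n lam m. scaleV (c p) (basis_elt p))"
  using V.span_image_finite[OF finite_lower_pairs] assms unfolding lower_span by blast

lemma leading_iff:
  assumes m: "m \<in> compositions n" and T: "T \<in> ST"
  shows "(\<exists>c. f = xvb m T \<oplus>\<^bsub>MM\<^esub> (\<Oplus>\<^bsub>MM\<^esub>p\<in>lower_pairs n lam m. h (scal (c p)) \<odot>\<^bsub>MM\<^esub> xvb (fst p) (snd p)))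
     \<longleftrightarrow> (\<exists>P\<in>lower m. f = of_model (basis_elt (m, T) + P))"
  unfolding comb_of_model xv_of_model[OF m T] of_model_add[OF basis_elt_V0[OF m T] lower_V0[OF comb_lower]]
proof
  assume "\<exists>c. f = of_model (basis_elt (m, T) + (\<Sum>p\<in>lower_pairs n lam m. scaleV (c p) (basis_elt p)))"
  then show "\<exists>P\<in>lower m. f = of_model (basis_elt (m, T) + P)" using comb_lower by blast
next
  assume "\<exists>P\<in>lower m. f = of_model (basis_elt (m, T) + P)"
  then obtain P where P: "P \<in> lower m" "f = of_model (basis_elt (m, T) + P)" by blast
  obtain c where "P = (\<Sum>p\<in>lower_pairs n lam m. scaleV (c p) (basis_elt p))" by (rule lower_comb[OF P(1)])
  then show "\<exists>c. f = of_model (basis_elt (m, T) + (\<Sum>p\<in>lower_pairs n lam m. scaleV (c p) (basis_elt p)))" using P(2) by blast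
qed

lemma basis_action:
  assumes m: "m \<in> compositions n" and T: "T \<in> ST" and i: "i \<in> {1..n}"
  shows "h (tg (zeta_mat r n i)) \<odot>\<^bsub>MM\<^esub> xvb m T = h (scal (tval i m T)) \<odot>\<^bsub>MM\<^esub> xvb m T"
    and "\<exists>c. h (zg r n c0 i) \<odot>\<^bsub>MM\<^esub> xvb m T = h (scal (zval i m T)) \<odot>\<^bsub>MM\<^esub> xvb m T
      \<oplus>\<^bsub>MM\<^esub> (\<Oplus>\<^bsub>MM\<^esub>p\<in>lower_pairs n lam m. h (scal (c p)) \<odot>\<^bsub>MM\<^esub> xvb (fst p) (snd p))"
proof -
  note e = basis_elt_V0[OF m T]
  show "h (tg (zeta_mat r n i)) \<odot>\<^bsub>MM\<^esub> xvb m T = h (scal (tval i m T)) \<odot>\<^bsub>MM\<^esub> xvb m T"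
    unfolding xv_of_model[OF m T] of_model_smult[OF FA_tg[OF zeta_mat_in_G] e] of_model_smult[OF FA_scal e]
      act_tg_zeta act_scal Td_basis_elt[OF T i] ..
  obtain c where c: "zop i (basis_elt (m, T)) - scaleV (zval i m T) (basis_elt (m, T)) = (\<Sum>p\<in>lower_pairs n lam m. scaleV (c p) (basis_elt p))"
    by (rule lower_comb[OF zop_basis_elt[OF m T i]])
  show "\<exists>c. h (zg r n c0 i) \<odot>\<^bsub>MM\<^esub> xvb m T = h (scal (zval i m T)) \<odot>\<^bsub>MM\<^esub> xvb m T
      \<oplus>\<^bsub>MM\<^esub> (\<Oplus>\<^bsub>MM\<^esub>p\<in>lower_pairs n lam m. h (scal (c p)) \<odot>\<^bsub>MM\<^esub> xvb (fst p) (snd p))"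
    unfolding comb_of_model xv_of_model[OF m T] of_model_smult[OF FA_zg[OF i] e] of_model_smult[OF FA_scal e] act_scal act_zg[OF i]
      of_model_add[OF V0_scale[OF e] lower_V0[OF comb_lower]]
    by (rule exI[of _ c]) (simp add: c[symmetric])
qed

abbreviation tA where "tA \<equiv> t_alg emb r n kappa c0 d"

lemma tA_gens:
  "i \<in> {1..n} \<Longrightarrow> h (zg r n c0 i) \<in> tA" "i \<in> {1..n} \<Longrightarrow> h (tg (zeta_mat r n i)) \<in> tA"
  unfolding t_alg_def by (intro generate_ring.incl imageI UnI1 UnI2, simp)+

lemma tA_eigen:
  assumes "\<And>i. i \<in> {1..n} \<Longrightarrow> \<exists>c. zop i F = scaleV c F" "\<And>i. i \<in> {1..n} \<Longrightarrow> \<exists>c. Td i (zeta r) F = scaleV c F"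
    and "a \<in> tA"
  shows "\<exists>p\<in>carrier FA. a = h p \<and> (\<exists>c. act p F = scaleV c F)"
  using assms(3) unfolding t_alg_def
proof (induction rule: generate_ring.induct)
  case one
  show ?case using h_one FA_1 act_one V.scale_one by metis
next
  case (incl a)
  then consider c where "a = h (scal c)" | i where "a = h (zg r n c0 i)" "i \<in> {1..n}"
    | i where "a = h (tg (zeta_mat r n i))" "i \<in> {1..n}" by blast
  then show ?case
  proof cases
    case (1 c)
    then show ?thesis using FA_scal by (intro bexI[of _ "scal c"]) auto
  next
    case (2 i)
    then show ?thesis using assms(1)[OF 2(2)] FA_zg[OF 2(2)]
      by (intro bexI[of _ "zg r n c0 i"]) (auto simp: act_zg)
  next
    case (3 i)
    then show ?thesis using assms(2)[OF 3(2)]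
      by (intro bexI[of _ "tg (zeta_mat r n i)"] FA_tg zeta_mat_in_G) (auto simp: act_tg_zeta simp del: act_tg)
  qed
next
  case (a_inv a)
  then obtain p c where "p \<in> carrier FA" "a = h p" "act p F = scaleV c F" by blast
  then show ?case by (intro bexI[of _ "- p"] conjI exI[of _ "- c"]) (simp_all add: h_uminus FA_uminus act_minus)
next
  case (eng_add a b)
  then obtain p c q e where "p \<in> carrier FA" "a = h p" "act p F = scaleV c F"
    "q \<in> carrier FA" "b = h q" "act q F = scaleV e F" by blast
  then show ?case
    by (intro bexI[of _ "p + q"] conjI exI[of _ "c + e"]) (simp_all add: h_add FA_add act_add V.scale_left_distrib)
next
  case (eng_mult a b)
  then obtain p c q e where "p \<in> carrier FA" "a = h p" "act p F = scaleV c F"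
    "q \<in> carrier FA" "b = h q" "act q F = scaleV e F" by blast
  then show ?case
    by (intro bexI[of _ "p * q"] conjI exI[of _ "e * c"])
      (simp_all add: h_mult FA_mult act_mult linop_scaleD[OF linop_act'])
qed

lemma t_eigenvector_of_model:
  assumes F: "F \<in> V0"
  shows "t_eigenvector emb r n kappa c0 d lam rho (of_model F) \<longleftrightarrow> F \<noteq> 0 \<and>
    (\<forall>i\<in>{1..n}. (\<exists>c. zop i F = scaleV c F) \<and> (\<exists>c. Td i (zeta r) F = scaleV c F))"
    (is "?L \<longleftrightarrow> ?R")
proof
  assume L: ?L
  have sm: "h p \<odot>\<^bsub>MM\<^esub> of_model F = h (scal c) \<odot>\<^bsub>MM\<^esub> of_model F \<longleftrightarrow> act p F = scaleV c F" if "p \<in> carrier FA" for p c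
    unfolding of_model_smult[OF that F] of_model_smult[OF FA_scal F] act_scal
    by (rule of_model_inj[OF V0_act[OF that F] V0_scale[OF F]])
  have "F \<noteq> 0" using L by (auto simp: t_eigenvector_def Let_def standard_module_MM of_model_zero)
  moreover have "\<exists>c. act p F = scaleV c F" if "p \<in> carrier FA" "h p \<in> tA" for p
    using L that sm[OF that(1)] unfolding t_eigenvector_def Let_def standard_module_MM by blast
  ultimately show ?R
    using FA_zg tA_gens FA_tg[OF zeta_mat_in_G] by (metis act_zg act_tg_zeta)
next
  assume R: ?R
  have "\<exists>c. a \<odot>\<^bsub>MM\<^esub> of_model F = h (scal c) \<odot>\<^bsub>MM\<^esub> of_model F" if a: "a \<in> tA" for a
  proof -
    obtain p c where "p \<in> carrier FA" "a = h p" "act p F = scaleV c F"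
      using tA_eigen[OF _ _ a, of F] R by blast
    then show ?thesis using of_model_smult[OF _ F] FA_scal by (metis act_scal)
  qed
  moreover have "of_model F \<noteq> of_model 0" using of_model_inj[OF F V0_0] R by simp
  ultimately show ?L
    using F unfolding t_eigenvector_def Let_def standard_module_MM of_model_zero carrier_MM by blast
qed

text \<open>The coefficient of the leading term can be compared because no lower term involves the exponent \<open>m\<close>.\<close>
lemma eigenvalue_leading:
  assumes lin: "linop z" and tri: "z (basis_elt (m, T)) - scaleV chi (basis_elt (m, T)) \<in> lower m"
    and low: "\<And>P. P \<in> lower m \<Longrightarrow> z P \<in> lower m"
    and P: "P \<in> lower m" and eig: "z (basis_elt (m, T) + P) = scaleV c (basis_elt (m, T) + P)"
  shows "c = chi"
proof -
  let ?e = "basis_elt (m, T)"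
  have "scaleV (c - chi) ?e = (z ?e - scaleV chi ?e) + z P - scaleV c P"
    using eig by (simp add: linop_addD[OF lin] V.scale_right_distrib V.scale_left_diff_distrib algebra_simps)
  then have "scaleV (c - chi) ?e \<in> lower m"
    using tri low[OF P] P by (simp add: lower_intros)
  moreover have "m \<notin> {nu \<in> compositions n. comp_less n nu m}" using comp_less_irrefl by blast
  ultimately have "lookup (scaleV (c - chi) ?e) m = 0"
    unfolding lower_def by (auto simp: in_keys_iff subset_iff)
  then have "scaleS (c - chi) (vmu m T) = 0" by (simp add: basis_elt_def)
  then show ?thesis using vmu_nonzero[of m T] by simp
qed

lemma zop_lower:
  assumes i: "i \<in> {1..n}" and P: "P \<in> lower m" shows "zop i P \<in> lower m"
  unfolding lower_span
proof (rule V.linear_map_span[where f = "zop i" and B = "basis_elt ` lower_pairs n lam m"])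
  fix y assume "y \<in> basis_elt ` lower_pairs n lam m"
  then obtain k S where k: "y = basis_elt (k, S)" "k \<in> compositions n" "S \<in> ST" "comp_less n k m"
    by (auto simp: lower_pairs_def)
  have "lower k \<subseteq> lower m" using comp_less_trans[OF _ k(4)] by (auto simp: lower_def)
  then have A: "zop i (basis_elt (k, S)) - scaleV (zval i k S) (basis_elt (k, S)) \<in> lower m"
    using zop_basis_elt[OF k(2,3) i] by blast
  have "basis_elt (k, S) \<in> lower m" unfolding basis_elt_def using k by (auto intro: lower_single vmu_S_space)
  then have "scaleV (zval i k S) (basis_elt (k, S)) \<in> lower m" by (rule V.subspace_scale[OF subspace_lower])
  from V.subspace_add[OF subspace_lower A this]
  show "zop i y \<in> V.span (basis_elt ` lower_pairs n lam m)" by (simp add: lower_span k(1))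
qed (use P lower_span linop_addD[OF linop_zop'] linop_scaleD[OF linop_zop'] in auto)

lemma Td_lower:
  assumes i: "i \<in> {1..n}" and P: "P \<in> lower m" shows "Td i (zeta r) P \<in> lower m"
  unfolding lower_span
proof (rule V.linear_map_span[where f = "Td i (zeta r)" and B = "basis_elt ` lower_pairs n lam m"])
  fix y assume y: "y \<in> basis_elt ` lower_pairs n lam m"
  then obtain k S where k: "y = basis_elt (k, S)" "S \<in> ST" by (auto simp: lower_pairs_def)
  show "Td i (zeta r) y \<in> V.span (basis_elt ` lower_pairs n lam m)"
    using y unfolding k(1) Td_basis_elt[OF k(2) i] by (intro V.span_scale V.span_base)
qed (use P lower_span linop_addD[OF linop_T'] linop_scaleD[OF linop_T'] in auto)

lemma leading_eigenvalues:
  assumes T: "T \<in> ST" and m: "m \<in> compositions n" and P: "P \<in> lower m"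
    and F: "F = basis_elt (m, T) + P" and eig: "t_eigenvector emb r n kappa c0 d lam rho (of_model F)" and i: "i \<in> {1..n}"
  shows "zop i F = scaleV (zval i m T) F" "Td i (zeta r) F = scaleV (tval i m T) F"
proof -
  have F0: "F \<in> V0" unfolding F by (intro V0_add basis_elt_V0 m T lower_V0[OF P])
  obtain c c' where c: "zop i F = scaleV c F" "Td i (zeta r) F = scaleV c' F"
    using eig i unfolding t_eigenvector_of_model[OF F0] by blast
  have "c = zval i m T"
    by (rule eigenvalue_leading[OF linop_zop' zop_basis_elt[OF m T i] _ P c(1)[unfolded F]]) (rule zop_lower[OF i])
  then show "zop i F = scaleV (zval i m T) F" using c(1) by simp
  have "Td i (zeta r) (basis_elt (m, T)) - scaleV (tval i m T) (basis_elt (m, T)) \<in> lower m"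
    using Td_basis_elt[OF T i] lower_intros(1) by simp
  then have "c' = tval i m T"
    by (rule eigenvalue_leading[OF linop_T' _ _ P c(2)[unfolded F]]) (rule Td_lower[OF i])
  then show "Td i (zeta r) F = scaleV (tval i m T) F" using c(2) by simp
qed

lemma leading_eigenvector_exists_unique:
  assumes m: "m \<in> compositions n" and T: "T \<in> ST"
    and ind: "alg_independent emb r (param kappa c0 d)"
  shows "\<exists>!f. t_eigenvector emb r n kappa c0 d lam rho f \<and> (\<exists>P\<in>lower m. f = of_model (basis_elt (m, T) + P))"
proof -
  let ?z = "\<lambda>bi. if fst bi then zop (snd bi) else Td (snd bi) (zeta r)"
  let ?chi = "\<lambda>bi p. if fst bi then zval (snd bi) (fst p) (snd p) else tval (snd bi) (fst p) (snd p)"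
  let ?I = "(UNIV :: bool set) \<times> {1..n}"
  let ?less = "\<lambda>q p. q \<in> lower_pairs n lam (fst p)"
  have zr: "zeta r \<in> unity_roots r" using zeta_power_root[of 1] by simp
  interpret C: commuting_triangular scaleV ?z ?I basis_elt ?chi ?less "(m, T)"
  proof
    show "?z bi (P + Q) = ?z bi P + ?z bi Q" for bi P Q
      by (simp add: linop_addD[OF linop_zop'] linop_addD[OF linop_T'])
    show "?z bi (scaleV a P) = scaleV a (?z bi P)" for bi a P
      by (simp add: linop_scaleD[OF linop_zop'] linop_scaleD[OF linop_T'])
    show "?z bi (?z bj P) = ?z bj (?z bi P)" if "bi \<in> ?I" "bj \<in> ?I" for bi bj P
    proof -
      have ij: "snd bi \<in> {1..n}" "snd bj \<in> {1..n}" using that by (simp_all add: mem_Times_iff)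
      show ?thesis
        using zop_commute[OF ij] Td_zop[OF zr ij(1)] Td_zop[OF zr ij(2)] T_Td[OF adm_diag'[OF zr] zr]
        by (cases "fst bi"; cases "fst bj") simp_all
    qed
    show "?z bi (basis_elt p) - scaleV (?chi bi p) (basis_elt p) \<in> V.span (basis_elt ` {q. ?less q p})"
      if "bi \<in> ?I" "p = (m, T) \<or> ?less p (m, T)" for bi p
    proof -
      have p: "fst p \<in> compositions n" "snd p \<in> ST" and i: "snd bi \<in> {1..n}"
        using that m T lower_pairsD[of p m] by (auto simp: mem_Times_iff)
      have "?z bi (basis_elt p) - scaleV (?chi bi p) (basis_elt p) \<in> lower (fst p)"
        using zop_basis_elt[OF p i] Td_basis_elt[OF p(2) i, of "fst p"] lower_intros(1) by simp
      then show ?thesis by (simp add: lower_span)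
    qed
    show "finite {q. ?less q (m, T)}" using finite_lower_pairs[of n lam m] by simp
    show "?less p s" if "?less p q" "?less q s" for p q s
      using that comp_less_trans by (fastforce simp: lower_pairs_def)
    show "\<not> ?less p p" for p using comp_less_irrefl by (auto simp: lower_pairs_def)
    show "\<exists>bi\<in>?I. ?chi bi q \<noteq> ?chi bi (m, T)" if q: "?less q (m, T)" for q
    proof -
      have "fst q \<noteq> m" "fst q \<in> compositions n" using q comp_less_irrefl by (auto simp: lower_pairs_def)
      then obtain i where "fst q i \<noteq> m i" by blast
      moreover then have "i \<in> {1..n}" using m \<open>fst q \<in> compositions n\<close> unfolding compositions_def by fastforce
      ultimately show ?thesis
        using zval_separates[OF ind, of i "fst q" "snd q" m T] by (intro bexI[of _ "(True, i)"]) auto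
    qed
  qed
  have low: "C.low = lower m" by (simp add: lower_span)
  obtain F where F: "F - basis_elt (m, T) \<in> lower m" and Fz: "\<And>bi. bi \<in> ?I \<Longrightarrow> ?z bi F = scaleV (?chi bi (m, T)) F"
    using C.eigenvector_exists unfolding low by blast
  define P where "P = F - basis_elt (m, T)"
  have FP: "F = basis_elt (m, T) + P" "P \<in> lower m" using F by (simp_all add: P_def)
  have F0: "F \<in> V0" unfolding FP(1) by (intro V0_add basis_elt_V0 m T lower_V0[OF FP(2)])
  have ev: "zop i F = scaleV (zval i m T) F" "Td i (zeta r) F = scaleV (tval i m T) F" if "i \<in> {1..n}" for i
    using Fz[of "(True, i)"] Fz[of "(False, i)"] that by simp_all
  have ne: "F \<noteq> 0"
  proof
    assume "F = 0"
    then have "P = - basis_elt (m, T)" using FP(1) by (simp add: eq_neg_iff_add_eq_0 add.commute)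
    then have "lookup P m = - vmu m T" by (simp add: basis_elt_def)
    moreover have "lookup P m = 0"
      using FP(2) comp_less_irrefl[of n m] unfolding lower_def by (auto simp: in_keys_iff subset_iff)
    ultimately show False using vmu_nonzero[of m T] by simp
  qed
  show ?thesis
  proof (rule ex1I[of _ "of_model F"])
    show "t_eigenvector emb r n kappa c0 d lam rho (of_model F) \<and> (\<exists>P\<in>lower m. of_model F = of_model (basis_elt (m, T) + P))"
      using ne ev FP unfolding t_eigenvector_of_model[OF F0] by blast
    fix f assume f: "t_eigenvector emb r n kappa c0 d lam rho f \<and> (\<exists>P\<in>lower m. f = of_model (basis_elt (m, T) + P))"
    then obtain P' where P': "P' \<in> lower m" "f = of_model (basis_elt (m, T) + P')" by blast
    define F' where "F' = basis_elt (m, T) + P'"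
    have eig': "t_eigenvector emb r n kappa c0 d lam rho (of_model F')" using f P' by (simp add: F'_def)
    have "F' - F = 0"
    proof (rule C.eigenvector_unique)
      have "P' - P \<in> lower m" by (intro lower_intros P' FP)
      then show "F' - F \<in> C.low" unfolding low F'_def FP(1) by simp
      fix bi assume bi: "bi \<in> ?I"
      then have i: "snd bi \<in> {1..n}" by (simp add: mem_Times_iff)
      show "?z bi (F' - F) = scaleV (?chi bi (m, T)) (F' - F)"
        using leading_eigenvalues[OF T m P'(1) F'_def eig' i] ev[OF i]
        by (simp add: linop_diffD[OF linop_zop'] linop_diffD[OF linop_T'] V.scale_right_diff_distrib)
    qed
    then show "f = of_model F" using P' by (simp add: F'_def)
  qed
qed

lemma leading_eigenvector_eigenvalues:
  assumes m: "m \<in> compositions n" and T: "T \<in> ST"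
    and f: "t_eigenvector emb r n kappa c0 d lam rho f" "\<exists>P\<in>lower m. f = of_model (basis_elt (m, T) + P)"
    and i: "i \<in> {1..n}"
  shows "h (tg (zeta_mat r n i)) \<odot>\<^bsub>MM\<^esub> f = h (scal (tval i m T)) \<odot>\<^bsub>MM\<^esub> f"
    and "h (zg r n c0 i) \<odot>\<^bsub>MM\<^esub> f = h (scal (zval i m T)) \<odot>\<^bsub>MM\<^esub> f"
proof -
  obtain P where P: "P \<in> lower m" "f = of_model (basis_elt (m, T) + P)" using f(2) by blast
  define F where "F = basis_elt (m, T) + P"
  have F0: "F \<in> V0" unfolding F_def by (intro V0_add basis_elt_V0 m T lower_V0[OF P(1)])
  have fF: "f = of_model F" using P by (simp add: F_def)
  note ev = leading_eigenvalues[OF T m P(1) F_def f(1)[unfolded fF] i]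
  show "h (tg (zeta_mat r n i)) \<odot>\<^bsub>MM\<^esub> f = h (scal (tval i m T)) \<odot>\<^bsub>MM\<^esub> f"
    unfolding fF of_model_smult[OF FA_tg[OF zeta_mat_in_G] F0] of_model_smult[OF FA_scal F0] act_tg_zeta act_scal ev(2) ..
  show "h (zg r n c0 i) \<odot>\<^bsub>MM\<^esub> f = h (scal (zval i m T)) \<odot>\<^bsub>MM\<^esub> f"
    unfolding fF of_model_smult[OF FA_zg[OF i] F0] of_model_smult[OF FA_scal F0] act_zg[OF i] act_scal ev(1) ..
qed

end

theorem theorem5p1:
  fixes emb :: "complex \<Rightarrow> 'f::field"
    and r n :: nat
    and kappa c0 :: 'f and d :: "nat \<Rightarrow> 'f"
    and lam :: "nat list list"
    and rho :: "complex mat \<Rightarrow> tableau \<Rightarrow> tableau \<Rightarrow> complex"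
    and mu :: "nat \<Rightarrow> nat" and T :: tableau
  assumes "field_hom emb"
    and "r \<ge> 1" and "n \<ge> 1"
    and "is_multipartition r n lam"
    and "is_S_lambda r n lam rho"
    and "mu \<in> compositions n"
    and "T \<in> SYT n lam"
  shows
    "let M = standard_module emb r n kappa c0 d lam rho;
         h = cls emb r n kappa c0 d;
         xvb = xv emb r n kappa c0 d lam rho;
         L = lower_pairs n lam mu;
         b = (\<lambda>i. T (w_comp n mu i));
         tval = (\<lambda>i. emb (zeta r powi (int (beta (b i)) - int (mu i))));
         zval = (\<lambda>i. kappa * of_nat (mu i + 1)
                   - (d_ext r d (int (beta (b i))) - d_ext r d (int (beta (b i)) - int (mu i) - 1))
                   - c0 * of_nat r * of_int (ct (b i)))
     in
       (\<forall>i \<in> {1..n}.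
          h (tg (zeta_mat r n i)) \<odot>\<^bsub>M\<^esub> xvb mu T = h (scal (tval i)) \<odot>\<^bsub>M\<^esub> xvb mu T \<and>
          (\<exists>c :: (nat \<Rightarrow> nat) \<times> tableau \<Rightarrow> 'f.
             h (zg r n c0 i) \<odot>\<^bsub>M\<^esub> xvb mu T = h (scal (zval i)) \<odot>\<^bsub>M\<^esub> xvb mu T
               \<oplus>\<^bsub>M\<^esub> (\<Oplus>\<^bsub>M\<^esub>p \<in> L. h (scal (c p)) \<odot>\<^bsub>M\<^esub> xvb (fst p) (snd p)))) \<and>
       (generic emb r kappa c0 d \<longrightarrow>
          (let leading = (\<lambda>f. \<exists>c :: (nat \<Rightarrow> nat) \<times> tableau \<Rightarrow> 'f.
                 f = xvb mu T \<oplus>\<^bsub>M\<^esub> (\<Oplus>\<^bsub>M\<^esub>p \<in> L. h (scal (c p)) \<odot>\<^bsub>M\<^esub> xvb (fst p) (snd p)))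
           in
             (\<exists>!f. t_eigenvector emb r n kappa c0 d lam rho f \<and> leading f) \<and>
             (\<forall>f. t_eigenvector emb r n kappa c0 d lam rho f \<and> leading f \<longrightarrow>
                (\<forall>i \<in> {1..n}. h (tg (zeta_mat r n i)) \<odot>\<^bsub>M\<^esub> f = h (scal (tval i)) \<odot>\<^bsub>M\<^esub> f \<and>
                              h (zg r n c0 i) \<odot>\<^bsub>M\<^esub> f = h (scal (zval i)) \<odot>\<^bsub>M\<^esub> f))))"
proof -
  interpret lambda_model emb r n kappa c0 d lam rho
    using assms by (intro lambda_model.intro cherednik_setup.intro cherednik_setup_axioms.intro
        lambda_model_axioms.intro)
  note m = \<open>mu \<in> compositions n\<close> and T = \<open>T \<in> SYT n lam\<close>
  note eigenvalues = zval_def tval_def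
  show ?thesis
    unfolding Let_def standard_module_MM leading_iff[OF m T]
  proof (intro conjI ballI impI allI)
    fix i assume i: "i \<in> {1..n}"
    note basis_action[OF m T i, unfolded eigenvalues]
    then show "h (tg (zeta_mat r n i)) \<odot>\<^bsub>MM\<^esub> xvb mu T
        = h (scal (emb (zeta r powi (int (beta (T (w_comp n mu i))) - int (mu i))))) \<odot>\<^bsub>MM\<^esub> xvb mu T"
      and "\<exists>c. h (zg r n c0 i) \<odot>\<^bsub>MM\<^esub> xvb mu T
        = h (scal (kappa * of_nat (mu i + 1)
            - (d_ext r d (int (beta (T (w_comp n mu i)))) - d_ext r d (int (beta (T (w_comp n mu i))) - int (mu i) - 1))
            - c0 * of_nat r * of_int (ct (T (w_comp n mu i))))) \<odot>\<^bsub>MM\<^esub> xvb mu T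
          \<oplus>\<^bsub>MM\<^esub> (\<Oplus>\<^bsub>MM\<^esub>p\<in>lower_pairs n lam mu. h (scal (c p)) \<odot>\<^bsub>MM\<^esub> xvb (fst p) (snd p))"
      by this+
  next
    assume "generic emb r kappa c0 d"
    then have "alg_independent emb r (param kappa c0 d)" by (simp add: generic_def)
    then show "\<exists>!f. t_eigenvector emb r n kappa c0 d lam rho f \<and> (\<exists>P\<in>lower mu. f = of_model (basis_elt (mu, T) + P))"
      by (rule leading_eigenvector_exists_unique[OF m T])
  next
    fix f i
    assume "t_eigenvector emb r n kappa c0 d lam rho f \<and> (\<exists>P\<in>lower mu. f = of_model (basis_elt (mu, T) + P))"
      and i: "i \<in> {1..n}"
    then have f: "t_eigenvector emb r n kappa c0 d lam rho f" "\<exists>P\<in>lower mu. f = of_model (basis_elt (mu, T) + P)" by auto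
    note leading_eigenvector_eigenvalues[OF m T f i, unfolded eigenvalues]
    then show "h (tg (zeta_mat r n i)) \<odot>\<^bsub>MM\<^esub> f
        = h (scal (emb (zeta r powi (int (beta (T (w_comp n mu i))) - int (mu i))))) \<odot>\<^bsub>MM\<^esub> f"
      and "h (zg r n c0 i) \<odot>\<^bsub>MM\<^esub> f
        = h (scal (kappa * of_nat (mu i + 1)
            - (d_ext r d (int (beta (T (w_comp n mu i)))) - d_ext r d (int (beta (T (w_comp n mu i))) - int (mu i) - 1))
            - c0 * of_nat r * of_int (ct (T (w_comp n mu i))))) \<odot>\<^bsub>MM\<^esub> f"
      by this+
  qed
qed

end
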